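(* Let $\Delta$ be the triangle graph with bond dimensions $\mathbf m=(m_{01},m_{12},m_{02})=(m,m_{12},m)$, $m\ge2$, and local dimensions $\mathbf n=(2,n_1,n_2)$, where $n_1=m_{12}m-k_1$ and $n_2=m_{12}m-k_2$ with $k_1,k_2\ge0$. Let $V_0=\mathbb C^2$, $V_1=\mathbb C^{n_1}$, $V_2=\mathbb C^{n_2}$. Then $$\mathcal{TNS}^\Delta_{\mathbf m,\mathbf n}=\overline{\left\{T\in V_0\otimes V_1\otimes V_2:\ \mathbb P\big(\mathrm{im}(T:V_0^*\to V_1\otimes V_2)\big)\text{ is a line intersecting }\sigma^{n_1\times n_2}_{m_{12}(m-1)}\text{ in at least }m\text{ distinct points}\right\}}.$$
   Context: Everything is over $\mathbb C$; all bond and local dimensions are positive integers; the overline denotes Zariski (equivalently Euclidean) closure. Given bond dimensions $\mathbf m=(m_{01},m_{12},m_{02})$, let $(e_a)_{a\le m_{01}}$, $(f_b)_{b\le m_{12}}$, $(g_c)_{c\le m_{02}}$ be the standard bases of $\mathbb C^{m_{01}},\mathbb C^{m_{12}},\mathbb C^{m_{02}}$, and let $W_0=\mathbb C^{m_{01}}\otimes\mathbb C^{m_{02}}$, $W_1=\mathbb C^{m_{01}}\otimes\mathbb C^{m_{12}}$, $W_2=\mathbb C^{m_{12}}\otimes\mathbb C^{m_{02}}$. The graph tensor is $$T(\Delta,\mathbf m)=\sum_{a,b,c}(e_a\otimes g_c)\otimes(e_a\otimes f_b)\otimes(f_b\otimes g_c)\in W_0\otimes W_1\otimes W_2.$$ For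 local dimensions $\mathbf n=(n_0,n_1,n_2)$ and $V_i=\mathbb C^{n_i}$, $\mathcal{TNS}^\Delta_{\mathbf m,\mathbf n}\subseteq V_0\otimes V_1\otimes V_2$ is the closure of the set of all $(X_0\otimes X_1\otimes X_2)(T(\Delta,\mathbf m))$ with $X_i\in\mathrm{Hom}(W_i,V_i)$. A tensor $T\in V_0\otimes V_1\otimes V_2$ defines by contraction the flattening map $T:V_0^*\to V_1\otimes V_2$. Elements of $V_1\otimes V_2$ are identified with $n_1\times n_2$ matrices, and $\sigma^{n_1\times n_2}_r\subseteq\mathbb P(\mathbb C^{n_1}\otimes\mathbb C^{n_2})$ is the variety of (classes of nonzero) matrices of rank at most $r$. "Line" means a projective line $\mathbb P^1$, i.e. the image is 2-dimensional.
   Formalization: The case n_1 = n_2 = 1 is excluded: there V_1⊗V_2 is one-dimensional and contains no line, so the right-hand side is the closure of the empty set while the tensor network variety contains 0. *)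

theory Defs
  imports "HOL-Analysis.Analysis"
begin

text \<open>
  A space \<open>\<complex>\<^sup>n\<close> is rendered as \<^typ>\<open>complex^'n\<close> with \<open>CARD('n) = n\<close>, and the tensor product of
  \<^typ>\<open>complex^'a\<close> and \<^typ>\<open>complex^'b\<close> as \<^typ>\<open>complex^('a \<times> 'b)\<close>. Iterated products associate to
  the right, so a tensor in \<open>V\<^sub>0 \<otimes> V\<^sub>1 \<otimes> V\<^sub>2\<close> has type \<^typ>\<open>complex^('n0 \<times> 'n1 \<times> 'n2)\<close>.
  Elements of \<open>Hom(W, V)\<close> are matrices \<^typ>\<open>complex^'w^'v\<close>. All spans and dimensions are over
  \<open>\<complex>\<close>, hence \<^const>\<open>vec.span\<close> and \<^const>\<open>vec.dim\<close> rather than the real \<^const>\<open>span\<close> and \<^const>\<open>dim\<close>.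
\<close>

definition tensor_vec :: "complex^('a::finite) \<Rightarrow> complex^('b::finite) \<Rightarrow> complex^('a \<times> 'b)"  (infixr "\<otimes>\<^sub>v" 75)
  where "u \<otimes>\<^sub>v v = (\<chi> p. u $ fst p * v $ snd p)"

definition tensor_map :: "complex^('a::finite)^('c::finite) \<Rightarrow> complex^('b::finite)^('d::finite) \<Rightarrow> complex^('a \<times> 'b)^('c \<times> 'd)"  (infixr "\<otimes>\<^sub>m" 75)
  where "X \<otimes>\<^sub>m Y = (\<chi> p q. X $ fst p $ fst q * Y $ snd p $ snd q)"

text \<open>The tensor product of matrices is the tensor product of linear maps:\<close>

lemma tensor_map_tensor_vec:
  fixes X :: "complex^('a::finite)^('c::finite)" and Y :: "complex^('b::finite)^('d::finite)"
  shows "(X \<otimes>\<^sub>m Y) *v (u \<otimes>\<^sub>v v) = (X *v u) \<otimes>\<^sub>v (Y *v v)"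
  by (simp add: vec_eq_iff matrix_vector_mult_def tensor_map_def tensor_vec_def
      sum_product UNIV_Times_UNIV[symmetric] sum.cartesian_product' mult_ac
      del: UNIV_Times_UNIV)

definition triangle_tensor ::
  "complex^(('e01::finite \<times> 'e02::finite) \<times> ('e01 \<times> 'e12::finite) \<times> ('e12 \<times> 'e02))"
  where "triangle_tensor =
    (\<Sum>a\<in>UNIV. \<Sum>b\<in>UNIV. \<Sum>c\<in>UNIV.
       (axis a 1 \<otimes>\<^sub>v axis c 1) \<otimes>\<^sub>v (axis a 1 \<otimes>\<^sub>v axis b 1) \<otimes>\<^sub>v (axis b 1 \<otimes>\<^sub>v axis c 1))"

text \<open>
  The bond dimensions are not determined by the ambient space of the result, so the bond index
  types are passed explicitly, in the order \<open>01, 12, 02\<close>.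
\<close>

definition triangle_TNS ::
  "'e01::finite itself \<Rightarrow> 'e12::finite itself \<Rightarrow> 'e02::finite itself \<Rightarrow>
    (complex^('n0::finite \<times> 'n1::finite \<times> 'n2::finite)) set"
  where "triangle_TNS _ _ _ = closure
    {(X0 \<otimes>\<^sub>m X1 \<otimes>\<^sub>m X2) *v triangle_tensor | X0 X1 X2.
       X0 \<in> (UNIV :: (complex^('e01 \<times> 'e02)^'n0) set) \<and>
       X1 \<in> (UNIV :: (complex^('e01 \<times> 'e12)^'n1) set) \<and>
       X2 \<in> (UNIV :: (complex^('e12 \<times> 'e02)^'n2) set)}"

text \<open>The functional on \<open>V\<^sub>0\<close> is given by its coordinates in the dual basis.\<close>

definition flattening ::
  "complex^('n0::finite \<times> 'n1::finite \<times> 'n2::finite) \<Rightarrow> complex^'n0 \<Rightarrow> complex^('n1 \<times> 'n2)"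
  where "flattening T \<alpha> = (\<chi> p. \<Sum>i\<in>UNIV. \<alpha> $ i * T $ (i, p))"

definition to_matrix :: "complex^('n1::finite \<times> 'n2::finite) \<Rightarrow> complex^'n2^'n1"
  where "to_matrix v = (\<chi> i j. v $ (i, j))"

text \<open>Points of projective space are represented by the corresponding lines through the origin.\<close>

definition projectivization :: "(complex^'n) set \<Rightarrow> (complex^'n) set set"
  where "projectivization S = {vec.span {v} | v. v \<in> S \<and> v \<noteq> 0}"

definition sigma_variety :: "nat \<Rightarrow> (complex^('n1::finite \<times> 'n2::finite)) set set"
  where "sigma_variety r = projectivization {v. rank (to_matrix v) \<le> r}"

text \<open>
  The intersection may be infinite (when the line lies in the variety), so ``at least \<open>m\<close>
  points'' asks for a finite subset of that size.
\<close>

definition line_meets_sigma :: "nat \<Rightarrow> nat \<Rightarrow> complex^('n0::finite \<times> 'n1::finite \<times> 'n2::finite) \<Rightarrow> bool"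
  where "line_meets_sigma r m T \<longleftrightarrow>
    vec.dim (range (flattening T)) = 2 \<and>
    (\<exists>P. P \<subseteq> projectivization (range (flattening T)) \<inter> sigma_variety r \<and> finite P \<and> m \<le> card P)"

text \<open>
  If both \<open>V\<^sub>1\<close> and \<open>V\<^sub>2\<close> are one-dimensional then no image is a line, whereas the tensor network
  variety is never empty. Any equality between the two sets has to exclude this case.
\<close>

lemma not_line_meets_sigma_one_one:
  fixes T :: "complex^('n0::finite \<times> 'n1::finite \<times> 'n2::finite)"
  assumes "CARD('n1) = 1" "CARD('n2) = 1"
  shows "\<not> line_meets_sigma r m T"
proof -
  have "vec.dim (range (flattening T)) \<le> CARD('n1 \<times> 'n2)"
    using vec.dim_subset_UNIV[of "range (flattening T)"] vec.dimension_def[where 'a = complex and 'b = "'n1 \<times> 'n2"]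
    by (simp add: card_cart_basis)
  then show ?thesis using assms by (simp add: line_meets_sigma_def)
qed

lemma triangle_TNS_nonempty: "triangle_TNS e01 e12 e02 \<noteq> {}"
  unfolding triangle_TNS_def closure_eq_empty by blast

end

theory Submission
  imports Defs "HOL-Computational_Algebra.Fundamental_Theorem_Algebra"
begin

text \<open>
  Contracting with \<open>\<alpha>\<close> turns a tensor with \<open>V\<^sub>0 = \<complex>\<^sup>2\<close> into a pencil of matrices, and the tensor
  network gives exactly the pencils \<open>X\<^sub>1 (A(\<alpha>) \<otimes> 1) X\<^sub>2\<^sup>T\<close> with \<open>A\<close> an \<open>m \<times> m\<close> pencil. Generically \<open>A\<close>
  is singular at \<open>m\<close> distinct points, and there the rank is at most \<open>m\<^sub>1\<^sub>2 (m - 1)\<close>.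

  Conversely, pad a pencil that drops rank at the points \<open>p i\<close> by zeros to size \<open>m m\<^sub>1\<^sub>2\<close>; its nullity
  at each \<open>p i\<close> is then at least \<open>m\<^sub>1\<^sub>2\<close>. If it is regular, kernel vectors at the \<open>p i\<close> form a basis,
  which diagonalizes it into \<open>m\<close> linear forms of multiplicity \<open>m\<^sub>1\<^sub>2\<close> and exhibits it as a network.
  If it is singular, small perturbations that keep the nullities at the \<open>p i\<close> make it regular. Let \<open>g\<close>
  be the generic nullity and \<open>a\<close>, \<open>a'\<close> the dimensions of the spans of all generic right and left
  kernels. When \<open>a + a' \<ge> (m + 1) g\<close>, a dimension count finds a rank-one perturbation that lowers \<open>g\<close>.
  Otherwise the regular part of the pencil has an eigenvector beyond those forced at the \<open>p i\<close>, and
  merging it into the generic kernel increases \<open>a\<close>. Hence \<open>g\<close> drops to \<open>0\<close> after finitely many steps.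
\<close>

section \<open>Linear algebra over the complex numbers\<close>

text \<open>Singular pencils are the typical case: as soon as \<open>n1\<close> or \<open>n2\<close>
  is below \<open>m * m12\<close>, zero padding makes every member of the pencil singular. No
  Kronecker form is computed. What replaces it is that all members at nonzero points have the same
  image on \<open>gker B\<close>, so that kernels at distinct points are independent modulo
  \<open>gker B\<close>. The threshold \<open>(m + 1) g\<close> is where two counts meet. A rank-one
  term multiplied by the linear form with root \<open>p k\<close> does no harm at
  \<open>p k\<close>. It can be made harmless at \<open>k\<close> other points through its row
  vector if \<open>k g < a\<close>, and at the remaining \<open>m - 1 - k\<close> through its column
  vector if \<open>(m - 1 - k) g < a'\<close>; a suitable \<open>k\<close> exists once
  \<open>a + a'\<close> reaches \<open>(m + 1) g\<close>. Below that value, the vectors compatible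
  with \<open>d\<close> dimensions of left kernel at each \<open>p i\<close> and with the left
  generic kernel form a space of dimension at least \<open>(m + 1) g - a' > a\<close>, which leaves
  room for an eigenvector outside \<open>gker B\<close>. The points \<open>p i\<close> stay fixed
  throughout, so the nullity conditions are kept exactly and only the rest of the pencil
  moves.\<close>

declare transpose_matrix_vector [simp del] vector_transpose_matrix [simp del]

text \<open>Bilinear, without conjugation: vectors double as functionals, and a subspace may meet
  its own annihilator.\<close>

abbreviation sp :: "complex^'n \<Rightarrow> complex^'n \<Rightarrow> complex" (infixl "\<odot>" 70)
  where "w \<odot> u \<equiv> scalar_product w u"

lemma sp_commute: "w \<odot> u = u \<odot> w"
  by (simp add: scalar_product_def mult.commute)

lemma sp_simps [simp]:
  "w \<odot> 0 = 0" "0 \<odot> u = 0"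
  "w \<odot> (u + v) = w \<odot> u + w \<odot> v" "(u + v) \<odot> w = u \<odot> w + v \<odot> w"
  "w \<odot> (u - v) = w \<odot> u - w \<odot> v" "(u - v) \<odot> w = u \<odot> w - v \<odot> w"
  "w \<odot> (c *s u) = c * (w \<odot> u)" "(c *s w) \<odot> u = c * (w \<odot> u)"
  by (simp_all add: scalar_product_def sum.distrib sum_subtractf algebra_simps sum_distrib_left)

lemma sp_matrix: "w \<odot> (M *v u) = (transpose M *v w) \<odot> u"
  by (simp add: scalar_product_def matrix_vector_mult_def transpose_def sum_distrib_left
      sum_distrib_right mult_ac) (rule sum.swap)

lemma tendsto_sp [tendsto_intros]:
  assumes "(f \<longlongrightarrow> u) F"
  shows "((\<lambda>x. w \<odot> f x) \<longlongrightarrow> w \<odot> u) F"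
  unfolding scalar_product_def by (intro tendsto_intros assms)

text \<open>A linear map that fixes \<open>u\<close> and kills a basis of \<open>S\<close> has a
  coordinate that does not vanish at \<open>u\<close>; the matrix row of that coordinate is
  \<open>y\<close>.\<close>

lemma separating_functional:
  fixes u :: "complex^'a"
  assumes "vec.subspace S" "u \<notin> S"
  obtains y where "\<And>x. x \<in> S \<Longrightarrow> y \<odot> x = 0" "y \<odot> u \<noteq> 0"
proof -
  obtain B where B: "B \<subseteq> S" "vec.independent B" "vec.span B = S"
    using vec.basis_subspace_exists[OF assms(1)] by metis
  have "vec.independent (insert u B)"
    using B assms(2) by (intro vec.independent_insertI) auto
  from vec.linear_independent_extend[OF this, of "\<lambda>x. if x = u then u else 0"]
  obtain f :: "complex^'a \<Rightarrow> complex^'a" where f: "Vector_Spaces.linear (*s) (*s) f"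
    "\<forall>x\<in>insert u B. f x = (if x = u then u else 0)"
    by metis
  have u0: "u \<noteq> 0" using assms vec.subspace_0 by auto
  then obtain k where k: "u $ k \<noteq> 0" by (auto simp: vec_eq_iff)
  define y where "y = (\<chi> j. f (axis j 1) $ k)"
  have y: "y \<odot> x = f x $ k" for x
    unfolding y_def scalar_product_def using linear_componentwise[OF f(1), of x k]
    by (simp add: mult.commute)
  have "f x = 0" if "x \<in> S" for x
  proof (rule vec.linear_eq_0_on_span[OF f(1)])
    show "f b = 0" if "b \<in> B" for b using f(2) that B assms(2) by auto
  qed (use that B in auto)
  moreover have "f u = u" using f(2) by auto
  ultimately show ?thesis using that[of y] y k by auto
qed

section \<open>Annihilators\<close>

definition ann :: "(complex^'n) set \<Rightarrow> (complex^'n) set"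
  where "ann S = {u. \<forall>w\<in>S. w \<odot> u = 0}"

lemma annI: "(\<And>w. w \<in> S \<Longrightarrow> w \<odot> u = 0) \<Longrightarrow> u \<in> ann S"
  by (auto simp: ann_def)

lemma subspace_ann [simp]: "vec.subspace (ann S)"
  by (auto simp: ann_def vec.subspace_def)

lemma ann_span [simp]: "ann (vec.span S) = ann S"
proof
  show "ann S \<subseteq> ann (vec.span S)"
  proof
    fix u assume u: "u \<in> ann S"
    have "vec.subspace {w. w \<odot> u = 0}" by (auto simp: vec.subspace_def)
    then have "vec.span S \<subseteq> {w. w \<odot> u = 0}"
      using u by (intro vec.span_minimal) (auto simp: ann_def)
    then show "u \<in> ann (vec.span S)" by (auto simp: ann_def)
  qed
qed (auto simp: ann_def vec.span_base)

lemma subspace_hyperplane [simp]: "vec.subspace {u. y \<odot> u = 0}"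
  by (auto simp: vec.subspace_def)

lemma dim_Int_hyperplane_ge:
  assumes "vec.subspace T"
  shows "vec.dim T \<le> vec.dim (T \<inter> {u. y \<odot> u = 0}) + 1"
proof (cases "T \<subseteq> {u. y \<odot> u = 0}")
  case True
  then have "T \<inter> {u. y \<odot> u = 0} = T" by auto
  then show ?thesis by simp
next
  case False
  then obtain u0 where u0: "u0 \<in> T" "y \<odot> u0 \<noteq> 0" by auto
  let ?H = "T \<inter> {u. y \<odot> u = 0}"
  have "T \<subseteq> vec.span (insert u0 ?H)"
  proof
    fix u assume u: "u \<in> T"
    let ?c = "(y \<odot> u) / (y \<odot> u0)"
    have "u - ?c *s u0 \<in> ?H"
      using u u0 assms by (auto intro: vec.subspace_diff vec.subspace_scale)
    then show "u \<in> vec.span (insert u0 ?H)"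
      by (metis vec.span_base vec.span_breakdown_eq)
  qed
  then have "vec.dim T \<le> vec.dim (insert u0 ?H)" by (rule vec.subset_le_dim)
  also have "\<dots> \<le> vec.dim ?H + 1" by (simp add: vec.dim_insert)
  finally show ?thesis .
qed

lemma dim_Int_hyperplane_less:
  assumes "vec.subspace T" "u \<in> T" "y \<odot> u \<noteq> 0"
  shows "vec.dim (T \<inter> {u. y \<odot> u = 0}) < vec.dim T"
proof (rule ccontr)
  assume "\<not> ?thesis"
  then have "T \<inter> {u. y \<odot> u = 0} = T"
    using assms by (intro vec.subspace_dim_equal vec.subspace_inter) auto
  then show False using assms by auto
qed

text \<open>Each new independent vector cuts the annihilator by a hyperplane. The cut is proper: a
  functional that kills the earlier vectors but not the new one lies in the old annihilator.\<close>

lemma dim_ann: "vec.dim (ann S) + vec.dim S = CARD('n)" for S :: "(complex^'n) set"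
proof -
  have *: "vec.independent F \<Longrightarrow> vec.dim (ann F) + card F = CARD('n)" if "finite F"
    for F :: "(complex^'n) set"
    using that
  proof induction
    case empty
    then show ?case by (simp add: ann_def vec_dim_card[unfolded vec.dim_UNIV] card_cart_basis)
  next
    case (insert w F)
    have ins: "ann (insert w F) = ann F \<inter> {u. w \<odot> u = 0}" by (auto simp: ann_def)
    have w: "w \<notin> vec.span F" "vec.independent F"
      using insert.prems insert.hyps by (auto simp: vec.independent_insert)
    obtain y where y: "\<And>x. x \<in> vec.span F \<Longrightarrow> y \<odot> x = 0" "y \<odot> w \<noteq> 0"
      using separating_functional[OF vec.subspace_span w(1)] by blast
    have "y \<in> ann F" using y(1) vec.span_base by (auto simp: ann_def sp_commute)
    then have "vec.dim (ann (insert w F)) < vec.dim (ann F)"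
      unfolding ins using y(2) by (intro dim_Int_hyperplane_less[of _ y]) (auto simp: sp_commute)
    moreover have "vec.dim (ann F) \<le> vec.dim (ann (insert w F)) + 1"
      unfolding ins by (rule dim_Int_hyperplane_ge) simp
    ultimately show ?case using insert w by auto
  qed
  obtain B where B: "B \<subseteq> vec.span S" "finite B" "vec.independent B" "vec.span B = vec.span S"
    using vec.basis_subspace_exists[OF vec.subspace_span] by metis
  have "ann S = ann B" by (metis B(4) ann_span)
  moreover have "vec.dim S = card B"
    by (metis B(3,4) vec.dim_span vec.dim_eq_card_independent)
  ultimately show ?thesis using *[OF B(2,3)] by simp
qed

lemma ann_ann:
  assumes "vec.subspace S"
  shows "ann (ann S) = S"
proof
  show "ann (ann S) \<subseteq> S"
  proof
    fix u assume u: "u \<in> ann (ann S)"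
    show "u \<in> S"
    proof (rule ccontr)
      assume "u \<notin> S"
      then obtain y where y: "\<And>x. x \<in> S \<Longrightarrow> y \<odot> x = 0" "y \<odot> u \<noteq> 0"
        using separating_functional[OF assms] by blast
      then have "y \<in> ann S" by (auto simp: ann_def sp_commute)
      then show False using u y(2) by (auto simp: ann_def)
    qed
  qed
qed (auto simp: ann_def sp_commute)

section \<open>Kernels and nullity\<close>

definition kern :: "complex^'n^'m \<Rightarrow> (complex^'n) set"
  where "kern M = {u. M *v u = 0}"

definition nullity :: "complex^'n^'m \<Rightarrow> nat"
  where "nullity M = vec.dim (kern M)"

lemma in_kern [simp]: "u \<in> kern M \<longleftrightarrow> M *v u = 0"
  by (simp add: kern_def)

lemma subspace_kern [simp]: "vec.subspace (kern M)"
  by (auto simp: kern_def vec.subspace_def matrix_vector_right_distrib vector_scalar_commute)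

lemma rank_nullity: "rank M + nullity M = CARD('n)" for M :: "complex^'n^'m"
proof -
  have "M *v u = 0 \<longleftrightarrow> (\<forall>i. row i M \<odot> u = 0)" for u
    by (simp add: row_def scalar_product_def matrix_vector_mult_def vec_eq_iff)
  moreover have "ann (rows M) = {u. \<forall>i. row i M \<odot> u = 0}"
    unfolding ann_def rows_def by blast
  ultimately have "kern M = ann (rows M)"
    by (simp add: kern_def)
  then show ?thesis
    using dim_ann[of "rows M"] by (simp add: nullity_def row_rank_def_gen)
qed

lemma subspace_image [simp]: "vec.subspace S \<Longrightarrow> vec.subspace ((*v) M ` S)"
  for M :: "complex^'n^'m"
  by (rule vec.linear_subspace_image[OF matrix_vector_mul_linear_gen])

text \<open>A linear right inverse \<open>h\<close> of \<open>M\<close> on the image embeds the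
  image in \<open>S\<close> as a complement of the kernel.\<close>

lemma dim_image_kern:
  fixes M :: "complex^'n^'m"
  assumes S: "vec.subspace S"
  shows "vec.dim ((*v) M ` S) + vec.dim (S \<inter> kern M) = vec.dim S"
proof -
  obtain h where h: "range h \<subseteq> S" "Vector_Spaces.linear (*s) (*s) h"
    "\<forall>v\<in>(*v) M ` S. M *v (h v) = v"
    using vec.linear_exists_right_inverse_on[OF matrix_vector_mul_linear_gen[of M] S] by blast
  let ?Y = "(*v) M ` S"
  have Y: "vec.subspace ?Y" using S by simp
  have inj: "inj_on h (vec.span ?Y)"
    using h(3) Y by (auto simp: vec.span_eq_iff[THEN iffD2, OF Y] intro!: inj_onI) metis
  have dimY: "vec.dim (h ` ?Y) = vec.dim ?Y"
    by (rule vec.dim_image_eq[OF h(2) inj])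
  have hY: "vec.subspace (h ` ?Y)" by (rule vec.linear_subspace_image[OF h(2) Y])
  have sum: "{x + y |x y. x \<in> h ` ?Y \<and> y \<in> S \<inter> kern M} = S"
  proof
    show "S \<subseteq> {x + y |x y. x \<in> h ` ?Y \<and> y \<in> S \<inter> kern M}"
    proof
      fix x assume x: "x \<in> S"
      have "x - h (M *v x) \<in> S \<inter> kern M"
        using x h S by (auto simp: matrix_vector_mult_diff_distrib intro!: vec.subspace_diff)
      moreover have "x = h (M *v x) + (x - h (M *v x))" by simp
      ultimately show "x \<in> {x + y |x y. x \<in> h ` ?Y \<and> y \<in> S \<inter> kern M}"
        using x by blast
    qed
  qed (use h S in \<open>auto intro!: vec.subspace_add\<close>)
  have "h ` ?Y \<inter> (S \<inter> kern M) \<subseteq> {0}"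
    using h(3) vec.linear_0[OF h(2)] by auto
  then have "vec.dim (h ` ?Y \<inter> (S \<inter> kern M)) = 0" by simp
  then show ?thesis
    using vec.dim_sums_Int[OF hY vec.subspace_inter[OF S subspace_kern[of M]]] dimY
    unfolding sum by linarith
qed

lemma rank_eq_dim_range: "rank M = vec.dim (range ((*v) M))" for M :: "complex^'n^'m"
proof -
  have "vec.dim (range ((*v) M)) + nullity M = CARD('n)"
    using dim_image_kern[of UNIV M] by (simp only: nullity_def vec_dim_card Int_UNIV_left vec.subspace_UNIV)
  then show ?thesis using rank_nullity[of M] by linarith
qed

lemma kern_transpose: "kern (transpose M) = ann (range ((*v) M))" for M :: "complex^'n^'m"
proof -
  have "transpose M *v w = 0 \<longleftrightarrow> (\<forall>u. w \<odot> (M *v u) = 0)" for w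
  proof
    assume "\<forall>u. w \<odot> (M *v u) = 0"
    then have "(transpose M *v w) \<odot> axis i 1 = 0" for i by (simp add: sp_matrix)
    then show "transpose M *v w = 0"
      by (simp add: scalar_product_def axis_def vec_eq_iff if_distrib cong: if_cong)
  qed (simp add: sp_matrix)
  then show ?thesis by (auto simp: ann_def sp_commute)
qed

lemma nullity_transpose: "nullity (transpose M) = nullity M" for M :: "complex^'n^'n"
  using dim_ann[of "range ((*v) M)"] dim_image_kern[of UNIV M]
  by (simp add: nullity_def kern_transpose vec_dim_card[unfolded vec.dim_UNIV])

lemma det_nz_iff_nullity: "det M \<noteq> 0 \<longleftrightarrow> nullity M = 0" for M :: "complex^'n^'n"
  unfolding invertible_det_nz[symmetric] invertible_left_inverse matrix_left_invertible_ker
  by (auto simp: nullity_def)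

lemma mat_mult_vec: "mat c *v x = c *s x" for x :: "complex^'n"
  by (simp add: matrix_vector_mult_def mat_def vec_eq_iff mult_delta_left)

section \<open>Rank-one updates of a matrix\<close>

definition outer :: "complex^'m \<Rightarrow> complex^'n \<Rightarrow> complex^'n^'m"
  where "outer x y = (\<chi> i j. x $ i * y $ j)"

lemma outer_mult [simp]: "outer x y *v v = (y \<odot> v) *s x"
  by (simp add: vec_eq_iff outer_def matrix_vector_mult_def scalar_product_def mult_ac sum_distrib_left)

lemma transpose_outer [simp]: "transpose (outer x y) = outer y x"
  by (simp add: vec_eq_iff outer_def transpose_def mult.commute)

lemma transpose_add [simp]: "transpose (M + M') = transpose M + transpose (M' :: complex^'n^'m)"
  by (simp add: vec_eq_iff transpose_def)

text \<open>Pairing with the left kernel vector \<open>w\<close> removes the \<open>M\<close> term,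
  so the rank-one term has to vanish by itself.\<close>

lemma kern_outer_subset:
  assumes "w \<in> kern (transpose M)" "w \<odot> x \<noteq> 0"
  shows "kern (M + outer x y) \<subseteq> kern M \<inter> {u. y \<odot> u = 0}"
proof
  fix v assume "v \<in> kern (M + outer x y)"
  then have v: "M *v v + (y \<odot> v) *s x = 0"
    by (simp add: matrix_vector_mult_add_rdistrib)
  then have "w \<odot> (M *v v + (y \<odot> v) *s x) = 0" by simp
  then have "y \<odot> v = 0" using assms by (simp add: sp_matrix)
  then show "v \<in> kern M \<inter> {u. y \<odot> u = 0}" using v by simp
qed

lemma nullity_outer_less:
  assumes "w \<in> kern (transpose M)" "w \<odot> x \<noteq> 0" "u \<in> kern M" "y \<odot> u \<noteq> 0"
  shows "nullity (M + outer x y) < nullity M"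
  using vec.dim_subset[OF kern_outer_subset[OF assms(1,2), of y]]
    dim_Int_hyperplane_less[OF _ assms(3,4)] by (simp add: nullity_def)

lemma nullity_outer_ge: "nullity M \<le> nullity (M + outer x y) + 1"
proof -
  have "kern M \<inter> {u. y \<odot> u = 0} \<subseteq> kern (M + outer x y)"
    by (auto simp: matrix_vector_mult_add_rdistrib)
  from vec.dim_subset[OF this] show ?thesis
    using dim_Int_hyperplane_ge[of "kern M" y] by (simp add: nullity_def)
qed

lemma nonzero_pairing:
  assumes "u \<noteq> 0" obtains y where "y \<odot> u \<noteq> 0"
  using separating_functional[of "{0}" u] assms by (auto simp: vec.subspace_def)

lemma nullity_pos: "nullity M > 0 \<longleftrightarrow> (\<exists>u. M *v u = 0 \<and> u \<noteq> 0)"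
proof -
  have "nullity M = 0 \<longleftrightarrow> kern M \<subseteq> {0}" by (simp add: nullity_def)
  then show ?thesis by auto
qed

text \<open>Each rank-one update chosen from a left and a right kernel vector lowers the nullity of
  \<open>M\<close> and costs \<open>C\<close> at most one dimension of kernel. Together with
  \<open>nullity_le_completion\<close> this turns a bound on the nullity into the nonvanishing of
  one determinant, which serves below in place of minors.\<close>

lemma nonsingular_completion:
  fixes M :: "complex^'n^'n"
  obtains C where "det (M + C) \<noteq> 0" "CARD('n) \<le> nullity M + nullity C"
proof -
  have "\<exists>C. det (M + C) \<noteq> 0 \<and> CARD('n) \<le> nullity M + nullity C" for M :: "complex^'n^'n"
  proof (induction "nullity M" arbitrary: M rule: less_induct)
    case less
    show ?case
    proof (cases "nullity M = 0")
      case True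
      have "nullity (0 :: complex^'n^'n) = CARD('n)"
        by (simp add: nullity_def kern_def vec_dim_card[unfolded vec.dim_UNIV])
      then show ?thesis using True by (intro exI[of _ 0]) (simp add: det_nz_iff_nullity)
    next
      case False
      obtain u where u: "M *v u = 0" "u \<noteq> 0" using False nullity_pos[of M] by auto
      obtain w where w: "transpose M *v w = 0" "w \<noteq> 0"
        using False nullity_pos[of "transpose M"] nullity_transpose[of M] by auto
      obtain y where y: "y \<odot> u \<noteq> 0" using u nonzero_pairing by blast
      obtain x where x: "x \<odot> w \<noteq> 0" using w nonzero_pairing by blast
      have lt: "nullity (M + outer x y) < nullity M"
        using u w x y by (intro nullity_outer_less[of w _ _ u]) (auto simp: sp_commute)
      then obtain C where C: "det (M + outer x y + C) \<noteq> 0"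
        "CARD('n) \<le> nullity (M + outer x y) + nullity C"
        using less by blast
      then show ?thesis
        using lt nullity_outer_ge[of C x y]
        by (intro exI[of _ "outer x y + C"]) (auto simp: add_ac)
    qed
  qed
  then show ?thesis using that by blast
qed

lemma nullity_le_completion:
  fixes M :: "complex^'n^'n"
  assumes "det (M + C) \<noteq> 0"
  shows "nullity M + nullity C \<le> CARD('n)"
proof -
  have "kern M \<inter> kern C \<subseteq> kern (M + C)" by (auto simp: matrix_vector_mult_add_rdistrib)
  moreover have "kern (M + C) \<subseteq> {0}"
    using assms by (simp add: det_nz_iff_nullity nullity_def)
  ultimately have "vec.dim (kern M \<inter> kern C) = 0" by auto
  moreover have "vec.dim {x + y |x y. x \<in> kern M \<and> y \<in> kern C} \<le> CARD('n)"
    by (rule dim_subset_UNIV_cart_gen)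
  ultimately show ?thesis
    using vec.dim_sums_Int[OF subspace_kern[of M] subspace_kern[of C]] unfolding nullity_def by linarith
qed

section \<open>Nullity along a line of matrices\<close>

definition affine_path :: "complex^'n^'m \<Rightarrow> complex^'n^'m \<Rightarrow> complex \<Rightarrow> complex^'n^'m"
  where "affine_path M0 M1 \<tau> = (\<chi> i j. M0 $ i $ j + \<tau> * M1 $ i $ j)"

lemma det_affine_path_poly:
  obtains p where "\<And>\<tau>. det (affine_path M0 M1 \<tau>) = poly p \<tau>"
proof -
  define P where "P = (\<chi> i j. [:M0 $ i $ j, M1 $ i $ j:])"
  have "det (affine_path M0 M1 \<tau>) = poly (det P) \<tau>" for \<tau>
    by (simp add: det_def P_def poly_sum poly_prod affine_path_def)
  then show ?thesis using that by blast
qed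

text \<open>With \<open>C\<close> completing the matrix at \<open>\<tau>0\<close>, a nullity above
  \<open>k\<close> forces the determinant of the completed path to vanish; that determinant is a
  polynomial in \<open>\<tau>\<close>, nonzero at \<open>\<tau>0\<close>.\<close>

lemma finite_nullity_gt:
  fixes M0 :: "complex^'n^'n"
  assumes "nullity (affine_path M0 M1 \<tau>0) \<le> k"
  shows "finite {\<tau>. nullity (affine_path M0 M1 \<tau>) > k}"
proof -
  obtain C where C: "det (affine_path M0 M1 \<tau>0 + C) \<noteq> 0"
    "CARD('n) \<le> nullity (affine_path M0 M1 \<tau>0) + nullity C"
    by (rule nonsingular_completion)
  have shift: "affine_path M0 M1 \<tau> + C = affine_path (M0 + C) M1 \<tau>" for \<tau>
    by (simp add: affine_path_def vec_eq_iff)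
  obtain p where p: "\<And>\<tau>. det (affine_path (M0 + C) M1 \<tau>) = poly p \<tau>"
    using det_affine_path_poly by blast
  have "p \<noteq> 0" using C p by (auto simp: shift)
  moreover have "{\<tau>. nullity (affine_path M0 M1 \<tau>) > k} \<subseteq> {\<tau>. poly p \<tau> = 0}"
  proof clarify
    fix \<tau> assume *: "nullity (affine_path M0 M1 \<tau>) > k"
    show "poly p \<tau> = 0"
    proof (rule ccontr)
      assume "poly p \<tau> \<noteq> 0"
      then have "det (affine_path M0 M1 \<tau> + C) \<noteq> 0" using p shift by simp
      from nullity_le_completion[OF this] show False using * C assms by simp
    qed
  qed
  ultimately show ?thesis using poly_roots_finite finite_subset by blast
qed

lemma tendsto_affine_path: "((\<lambda>\<tau>. affine_path M0 M1 \<tau>) \<longlongrightarrow> M0) (at 0)"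
proof -
  have "((\<lambda>\<tau>. affine_path M0 M1 \<tau>) \<longlongrightarrow> (\<chi> i j. M0 $ i $ j + 0 * M1 $ i $ j)) (at 0)"
    unfolding affine_path_def by (intro tendsto_intros)
  moreover have "(\<chi> i j. M0 $ i $ j + 0 * M1 $ i $ j) = M0" by (simp add: vec_eq_iff)
  ultimately show ?thesis by simp
qed

lemma tendsto_det [tendsto_intros]:
  fixes f :: "'a \<Rightarrow> complex^'n^'n"
  assumes "(f \<longlongrightarrow> M) F"
  shows "((\<lambda>x. det (f x)) \<longlongrightarrow> det M) F"
  unfolding det_def by (intro tendsto_intros assms)

text \<open>Complete \<open>M0\<close> by \<open>C\<close> and solve
  \<open>(affine_path M0 M1 \<tau> + C) *v v = C *v u\<close>. Cramer's rule makes the solution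
  continuous in \<open>\<tau>\<close> near \<open>0\<close>, and at \<open>0\<close> it is
  \<open>u\<close>.\<close>

lemma kernel_vector_continuation:
  fixes M0 :: "complex^'n^'n"
  assumes min: "\<And>\<tau>. nullity (affine_path M0 M1 \<tau>) \<ge> nullity M0" and u: "u \<in> kern M0"
  obtains f where "(f \<longlongrightarrow> u) (at 0)"
    "\<forall>\<^sub>F \<tau> in at 0. nullity (affine_path M0 M1 \<tau>) = nullity M0 \<and> f \<tau> \<in> kern (affine_path M0 M1 \<tau>)"
proof -
  obtain C where C: "det (M0 + C) \<noteq> 0" "CARD('n) \<le> nullity M0 + nullity C"
    by (rule nonsingular_completion)
  let ?M = "\<lambda>\<tau>. affine_path M0 M1 \<tau> + C"
  define f where "f b \<tau> = (\<chi> k. det (\<chi> i j. if j = k then b $ i else ?M \<tau> $ i $ j) / det (?M \<tau>))"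
    for b :: "complex^'n" and \<tau>
  have M: "(?M \<longlongrightarrow> M0 + C) (at 0)"
    by (intro tendsto_intros tendsto_affine_path)
  have det: "((\<lambda>\<tau>. det (?M \<tau>)) \<longlongrightarrow> det (M0 + C)) (at 0)"
    by (intro tendsto_intros M)
  have num: "((\<lambda>\<tau>. (\<chi> i j. if j = k then b $ i else ?M \<tau> $ i $ j)) \<longlongrightarrow>
      (\<chi> i j. if j = k then b $ i else (M0 + C) $ i $ j)) (at 0)" for k and b :: "complex^'n"
  proof (intro tendsto_vec_lambda)
    fix i j
    show "((\<lambda>\<tau>. if j = k then b $ i else ?M \<tau> $ i $ j) \<longlongrightarrow>
      (if j = k then b $ i else (M0 + C) $ i $ j)) (at 0)"
      using tendsto_vec_nth[OF tendsto_vec_nth[OF M, of i], of j] by simp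
  qed
  have lim: "(f b \<longlongrightarrow> (\<chi> k. det (\<chi> i j. if j = k then b $ i else (M0 + C) $ i $ j) / det (M0 + C))) (at 0)"
    for b
    unfolding f_def by (intro tendsto_vec_lambda tendsto_divide tendsto_det num M C(1))
  have "(M0 + C) *v u = C *v u" using u by (simp add: matrix_vector_mult_add_rdistrib)
  then have "u = (\<chi> k. det (\<chi> i j. if j = k then (C *v u) $ i else (M0 + C) $ i $ j) / det (M0 + C))"
    using cramer[OF C(1)] by blast
  then have 1: "(f (C *v u) \<longlongrightarrow> u) (at 0)" using lim[of "C *v u"] by simp
  have ev: "\<forall>\<^sub>F \<tau> in at 0. det (?M \<tau>) \<noteq> 0"
    using tendsto_imp_eventually_ne[OF det C(1)] .
  have 2: "nullity (affine_path M0 M1 \<tau>) = nullity M0 \<and> f (C *v u) \<tau> \<in> kern (affine_path M0 M1 \<tau>)"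
    if d: "det (?M \<tau>) \<noteq> 0" for \<tau>
  proof -
    \<comment> \<open>By minimality the nullities of the path and of \<open>C\<close> add up to the
      full dimension, so the two kernels are complementary and \<open>C\<close> maps the kernel of
      the path onto all of its range. Hence the solution is a kernel vector.\<close>
    have n: "nullity (affine_path M0 M1 \<tau>) = nullity M0" "nullity M0 + nullity C = CARD('n)"
      using nullity_le_completion[OF d] min[of \<tau>] C(2) nullity_le_completion[OF C(1)] by auto
    have "(*v) C ` kern (affine_path M0 M1 \<tau>) = range ((*v) C)"
    proof (rule vec.subspace_dim_equal)
      have "kern (affine_path M0 M1 \<tau>) \<inter> kern C \<subseteq> kern (?M \<tau>)"
        by (auto simp: matrix_vector_mult_add_rdistrib)
      moreover have "kern (?M \<tau>) \<subseteq> {0}" using d by (simp add: det_nz_iff_nullity nullity_def)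
      ultimately have "vec.dim (kern (affine_path M0 M1 \<tau>) \<inter> kern C) = 0" by auto
      then have "vec.dim ((*v) C ` kern (affine_path M0 M1 \<tau>)) = nullity M0"
        using dim_image_kern[OF subspace_kern[of "affine_path M0 M1 \<tau>"], of C] n
        unfolding nullity_def by linarith
      moreover have "vec.dim (range ((*v) C)) = nullity M0"
        using dim_image_kern[of UNIV C] n by (simp add: nullity_def vec_dim_card[unfolded vec.dim_UNIV])
      ultimately show "vec.dim (range ((*v) C)) \<le> vec.dim ((*v) C ` kern (affine_path M0 M1 \<tau>))"
        by simp
    qed auto
    then have "C *v u \<in> (*v) C ` kern (affine_path M0 M1 \<tau>)" by simp
    then obtain v where v: "v \<in> kern (affine_path M0 M1 \<tau>)" "C *v v = C *v u"
      by force
    then have "?M \<tau> *v v = C *v u" by (simp add: matrix_vector_mult_add_rdistrib)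
    then have "f (C *v u) \<tau> = v" using cramer[OF d, of v "C *v u"] by (simp add: f_def)
    then show ?thesis using n v by simp
  qed
  show ?thesis
    by (rule that[OF 1 eventually_mono[OF ev 2]])
qed

section \<open>Pencils and their generic kernels\<close>

text \<open>Homogeneous in \<open>s\<close>: a point of the projective line is a nonzero
  \<open>s\<close> up to scaling, and no point at infinity is special.\<close>

definition pencil :: "complex^'n^'n^2 \<Rightarrow> complex^2 \<Rightarrow> complex^'n^'n"
  where "pencil B s = (\<chi> i j. s $ 1 * B $ 1 $ i $ j + s $ 2 * B $ 2 $ i $ j)"

text \<open>As a function of \<open>s\<close>, \<open>det2 p s\<close> is the linear form on \<open>\<complex>\<^sup>2\<close> with root \<open>p\<close>.\<close>

definition det2 :: "complex^2 \<Rightarrow> complex^2 \<Rightarrow> complex"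
  where "det2 p s = p $ 1 * s $ 2 - p $ 2 * s $ 1"

definition transpose_pencil :: "complex^'n^'n^2 \<Rightarrow> complex^'n^'n^2"
  where "transpose_pencil B = (\<chi> k. transpose (B $ k))"

lemma pencil_transpose [simp]: "pencil (transpose_pencil B) s = transpose (pencil B s)"
  by (simp add: pencil_def transpose_pencil_def transpose_def vec_eq_iff)

lemma pencil_mult: "pencil B s *v u = s $ 1 *s (B $ 1 *v u) + s $ 2 *s (B $ 2 *v u)"
  by (simp add: pencil_def matrix_vector_mult_def vec_eq_iff algebra_simps sum.distrib sum_distrib_left)

text \<open>The expansion of \<open>s\<close> in terms of \<open>p\<close> and \<open>q\<close>,
  cleared of denominators. If \<open>u\<close> lies in the kernel at \<open>p\<close> and
  \<open>det2 p q\<close> is nonzero, it shows that \<open>pencil B s *v u\<close> is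
  \<open>det2 p s\<close> times a fixed vector.\<close>

lemma pencil_interpolation:
  "det2 p q *s (pencil B s *v u) = det2 s q *s (pencil B p *v u) + det2 p s *s (pencil B q *v u)"
  by (simp add: pencil_mult det2_def vec_eq_iff) (simp add: algebra_simps)

lemma pencil_affine_path: "pencil B (s + \<tau> *s d) = affine_path (pencil B s) (pencil B d) \<tau>"
  by (simp add: pencil_def affine_path_def vec_eq_iff algebra_simps)

lemma det2_linear [simp]:
  "det2 p (s + s') = det2 p s + det2 p s'" "det2 p (c *s s) = c * det2 p s" "det2 p p = 0"
  by (simp_all add: det2_def algebra_simps)

lemma det2_swap: "det2 q p = - det2 p q"
  by (simp add: det2_def)

lemma det2_complement:
  assumes "p \<noteq> 0" obtains q where "det2 p q = 1"
proof (cases "p $ 1 = 0")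
  case True
  then have "p $ 2 \<noteq> 0" using assms by (auto simp: vec_eq_iff forall_2)
  then have "det2 p (\<chi> k. if k = 1 then - 1 / p $ 2 else 0) = 1" by (simp add: det2_def)
  then show ?thesis using that by blast
next
  case False
  then have "det2 p (\<chi> k. if k = 1 then 0 else 1 / p $ 1) = 1" by (simp add: det2_def)
  then show ?thesis using that by blast
qed

section \<open>Generic nullity and generic kernels\<close>

definition gnull :: "complex^'n^'n^2 \<Rightarrow> nat"
  where "gnull B = (LEAST k. \<exists>s. nullity (pencil B s) = k)"

definition generic :: "complex^'n^'n^2 \<Rightarrow> (complex^2) set"
  where "generic B = {s. nullity (pencil B s) = gnull B}"

text \<open>
  In terms of the Kronecker canonical form, \<open>gker B\<close> is the source space of the blocks \<open>L\<^sub>\<epsilon>\<close>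
  (those of shape \<open>\<epsilon> \<times> (\<epsilon> + 1)\<close>).
\<close>

definition gker :: "complex^'n^'n^2 \<Rightarrow> (complex^'n) set"
  where "gker B = vec.span (\<Union>s\<in>generic B. kern (pencil B s))"

lemma gnull_le: "gnull B \<le> nullity (pencil B s)"
  unfolding gnull_def by (rule Least_le) blast

lemma generic_exists: obtains s where "s \<in> generic B" "s \<noteq> 0"
proof -
  have "\<exists>s. nullity (pencil B s) = gnull B"
    unfolding gnull_def by (rule LeastI[of _ "nullity (pencil B 0)"]) auto
  then obtain s where s: "nullity (pencil B s) = gnull B" by blast
  show ?thesis
  proof (cases "s = 0")
    case True
    \<comment> \<open>If \<open>0\<close> is generic, the generic nullity is full, so any nonzero
      point is generic as well.\<close>
    have "kern (pencil B 0) = UNIV" by (auto simp: pencil_mult)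
    then have "nullity (pencil B 0) = CARD('a)"
      unfolding nullity_def by (simp only: vec_dim_card)
    moreover have "nullity (pencil B 1) \<le> CARD('a)"
      unfolding nullity_def by (rule dim_subset_UNIV_cart_gen)
    ultimately have "nullity (pencil B 1) = gnull B"
      using s gnull_le[of B 1] unfolding True by linarith
    moreover have "(1 :: complex^2) \<noteq> 0" by simp
    ultimately show ?thesis using that[of 1] by (simp add: generic_def)
  qed (use s that in \<open>auto simp: generic_def\<close>)
qed

lemma gnull_transpose [simp]: "gnull (transpose_pencil B) = gnull B"
  by (simp add: gnull_def nullity_transpose)

lemma generic_transpose [simp]: "generic (transpose_pencil B) = generic B"
  by (simp add: generic_def nullity_transpose)

lemma subspace_gker [simp]: "vec.subspace (gker B)"
  by (simp add: gker_def)

lemma kern_subset_gker: "s \<in> generic B \<Longrightarrow> kern (pencil B s) \<subseteq> gker B"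
  unfolding gker_def by (rule subset_trans[OF _ vec.span_superset]) blast

lemma dim_kern_generic: "s \<in> generic B \<Longrightarrow> vec.dim (kern (pencil B s)) = gnull B"
  by (simp add: generic_def nullity_def)

lemma generic_kernel_continuation:
  assumes "s \<in> generic B" "u \<in> kern (pencil B s)"
  obtains f where "(f \<longlongrightarrow> u) (at 0)"
    "\<forall>\<^sub>F \<tau> in at 0. s + \<tau> *s d \<in> generic B \<and> f \<tau> \<in> kern (pencil B (s + \<tau> *s d))"
proof -
  have "nullity (pencil B s) \<le> nullity (affine_path (pencil B s) (pencil B d) \<tau>)" for \<tau>
    using assms(1) gnull_le[of B "s + \<tau> *s d"] by (simp add: generic_def pencil_affine_path)
  then obtain f where f: "(f \<longlongrightarrow> u) (at 0)"
    "\<forall>\<^sub>F \<tau> in at 0. nullity (affine_path (pencil B s) (pencil B d) \<tau>) = nullity (pencil B s)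
      \<and> f \<tau> \<in> kern (affine_path (pencil B s) (pencil B d) \<tau>)"
    by (rule kernel_vector_continuation[OF _ assms(2)])
  show ?thesis
    by (rule that[OF f(1)]) (use f(2) assms(1) in \<open>simp add: generic_def pencil_affine_path\<close>)
qed

text \<open>For a kernel vector \<open>v\<close> at a generic \<open>s'\<close> with
  \<open>det2 p s'\<close> nonzero, interpolation between \<open>p\<close> and \<open>q\<close> at
  \<open>s'\<close> shows that \<open>z\<close> kills \<open>pencil B q *v v\<close>. Kernel vectors
  at generic points with \<open>det2 p s = 0\<close> are limits of such \<open>v\<close> along the
  direction \<open>q\<close>. Since \<open>p\<close> and \<open>q\<close> span the plane,
  \<open>z\<close> then kills the images under every member.\<close>

lemma gker_annihilator:
  assumes p: "p \<noteq> 0" and z: "\<And>u. u \<in> gker B \<Longrightarrow> z \<odot> (pencil B p *v u) = 0" and u: "u \<in> gker B"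
  shows "z \<odot> (pencil B s *v u) = 0"
proof -
  obtain q where q: "det2 p q = 1" using det2_complement[OF p] .
  have eq: "z \<odot> (pencil B s *v u) = det2 p s * (z \<odot> (pencil B q *v u))" if "u \<in> gker B" for u s
    using arg_cong[OF pencil_interpolation[of p q B s u], of "\<lambda>v. z \<odot> v"] z[OF that] q by simp
  have "gker B \<subseteq> {u. z \<odot> (pencil B q *v u) = 0}"
    unfolding gker_def
  proof (rule vec.span_minimal)
    show "vec.subspace {u. z \<odot> (pencil B q *v u) = 0}"
      by (simp add: sp_matrix)
    show "(\<Union>s\<in>generic B. kern (pencil B s)) \<subseteq> {u. z \<odot> (pencil B q *v u) = 0}"
    proof clarify
      fix s u assume s: "s \<in> generic B" and us: "u \<in> kern (pencil B s)"
      have nz: "z \<odot> (pencil B q *v v) = 0"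
        if "s' \<in> generic B" "v \<in> kern (pencil B s')" "det2 p s' \<noteq> 0" for s' v
      proof -
        have "v \<in> gker B" using that kern_subset_gker by blast
        from eq[OF this, of s'] show ?thesis using that by simp
      qed
      show "z \<odot> (pencil B q *v u) = 0"
      proof (cases "det2 p s = 0")
        case True
        obtain f where f: "(f \<longlongrightarrow> u) (at 0)"
          "\<forall>\<^sub>F \<tau> in at 0. s + \<tau> *s q \<in> generic B \<and> f \<tau> \<in> kern (pencil B (s + \<tau> *s q))"
          by (rule generic_kernel_continuation[OF s us])
        have "\<forall>\<^sub>F \<tau> in at 0. z \<odot> (pencil B q *v f \<tau>) = 0"
          using f(2) eventually_neq_at_within[of 0 0 UNIV]
        proof eventually_elim
          case (elim \<tau>)
          then show ?case using nz[of "s + \<tau> *s q" "f \<tau>"] True q by simp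
        qed
        then have "((\<lambda>\<tau>. z \<odot> (pencil B q *v f \<tau>)) \<longlongrightarrow> 0) (at 0)"
          by (rule tendsto_eventually)
        moreover have "((\<lambda>\<tau>. z \<odot> (pencil B q *v f \<tau>)) \<longlongrightarrow> z \<odot> (pencil B q *v u)) (at 0)"
          unfolding sp_matrix by (intro tendsto_intros f(1))
        ultimately show ?thesis using tendsto_unique[OF at_neq_bot, symmetric] by metis
      qed (rule nz[OF s us])
    qed
  qed
  then show ?thesis using eq[OF u, of s] u by auto
qed

lemma gker_image_subset:
  assumes "p \<noteq> 0"
  shows "(*v) (pencil B s) ` gker B \<subseteq> (*v) (pencil B p) ` gker B"
proof -
  let ?Y = "(*v) (pencil B p) ` gker B"
  have "(*v) (pencil B s) ` gker B \<subseteq> ann (ann ?Y)"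
  proof clarify
    fix u assume u: "u \<in> gker B"
    show "pencil B s *v u \<in> ann (ann ?Y)"
    proof (rule annI)
      fix z assume "z \<in> ann ?Y"
      then have "z \<odot> (pencil B p *v v) = 0" if "v \<in> gker B" for v
        using that by (auto simp: ann_def sp_commute)
      from gker_annihilator[OF assms this u] show "z \<odot> (pencil B s *v u) = 0" by blast
    qed
  qed
  then show ?thesis by (simp add: ann_ann)
qed

text \<open>Equal images on \<open>gker B\<close> give equal nullities there, and at a generic point
  the whole kernel lies in \<open>gker B\<close>.\<close>

lemma dim_kern_Int_gker:
  assumes "p \<noteq> 0"
  shows "vec.dim (kern (pencil B p) \<inter> gker B) = gnull B"
proof -
  obtain s where s: "s \<in> generic B" "s \<noteq> 0" by (rule generic_exists)
  have "(*v) (pencil B s) ` gker B = (*v) (pencil B p) ` gker B"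
    using gker_image_subset s assms by blast
  moreover have "gker B \<inter> kern (pencil B s) = kern (pencil B s)"
    using kern_subset_gker[OF s(1)] by auto
  ultimately show ?thesis
    using dim_image_kern[of "gker B" "pencil B s"] dim_image_kern[of "gker B" "pencil B p"]
      dim_kern_generic[OF s(1)] by (simp add: Int_commute)
qed

lemma generic_proportional:
  assumes "s \<in> generic B" "s \<noteq> 0" "p \<noteq> 0" "det2 p s = 0"
  shows "p \<in> generic B"
proof -
  obtain q where q: "det2 p q = 1" using det2_complement[OF assms(3)] .
  have eq: "pencil B s *v u = det2 s q *s (pencil B p *v u)" for u
    using pencil_interpolation[of p q B s u] q assms by simp
  then have "kern (pencil B p) \<subseteq> kern (pencil B s)" by auto
  then have "nullity (pencil B p) \<le> nullity (pencil B s)"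
    unfolding nullity_def by (rule vec.dim_subset)
  then show ?thesis using assms gnull_le[of B p] by (simp add: generic_def)
qed

text \<open>
  Eigenvectors for distinct eigenvalues are independent: modulo \<open>gker B\<close> a generic member of the
  pencil is injective, and composing \<open>pencil B (p j)\<close> with its inverse rescales each \<open>u i\<close> and
  removes \<open>u j\<close>.
\<close>

lemma kernels_independent_aux:
  assumes "finite I" "\<And>i. i \<in> I \<Longrightarrow> p i \<noteq> 0" "\<And>i. i \<in> I \<Longrightarrow> p i \<notin> generic B"
    "\<And>i j. i \<in> I \<Longrightarrow> j \<in> I \<Longrightarrow> i \<noteq> j \<Longrightarrow> det2 (p i) (p j) \<noteq> 0"
    "\<And>i. i \<in> I \<Longrightarrow> u i \<in> kern (pencil B (p i))" "sum u I \<in> gker B" "i \<in> I"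
  shows "u i \<in> gker B"
  using assms
proof (induction I arbitrary: u i)
  case empty
  then show ?case by simp
next
  case (insert j I)
  obtain s where s: "s \<in> generic B" "s \<noteq> 0" by (rule generic_exists)
  have ds: "det2 (p i) s \<noteq> 0" if "i \<in> insert j I" for i
    using generic_proportional[OF s] insert.prems(1,2)[OF that] by blast
  define c where "c i = det2 (p i) (p j) / det2 (p i) s" for i
  have c: "pencil B (p j) *v u i = pencil B s *v (c i *s u i)" if "i \<in> insert j I" for i
  proof -
    have "det2 (p i) s *s (pencil B (p j) *v u i) = det2 (p i) (p j) *s (pencil B s *v u i)"
      using pencil_interpolation[of "p i" s B "p j" "u i"] insert.prems(4)[OF that] by simp
    then have "(1 / det2 (p i) s) *s (det2 (p i) s *s (pencil B (p j) *v u i)) =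
      (1 / det2 (p i) s) *s (det2 (p i) (p j) *s (pencil B s *v u i))" by simp
    then show ?thesis using ds[OF that]
      by (simp add: vector_smult_assoc c_def vector_scalar_commute)
  qed
  let ?w = "sum u (insert j I)"
  have "pencil B (p j) *v ?w \<in> (*v) (pencil B s) ` gker B"
    using gker_image_subset[OF s(2), of B "p j"] insert.prems(5) by auto
  then obtain a where a: "a \<in> gker B" "pencil B (p j) *v ?w = pencil B s *v a" by auto
  have "pencil B (p j) *v ?w = (\<Sum>i\<in>insert j I. pencil B s *v (c i *s u i))"
    unfolding vec.linear_sum[OF matrix_vector_mul_linear_gen] using c by (intro sum.cong) auto
  also have "\<dots> = pencil B s *v (\<Sum>i\<in>insert j I. c i *s u i)"
    by (rule vec.linear_sum[OF matrix_vector_mul_linear_gen, symmetric])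
  also have "(\<Sum>i\<in>insert j I. c i *s u i) = (\<Sum>i\<in>I. c i *s u i)"
    using insert.hyps by (simp add: c_def)
  finally have "(\<Sum>i\<in>I. c i *s u i) - a \<in> kern (pencil B s)"
    using a by (simp add: matrix_vector_mult_diff_distrib)
  then have "(\<Sum>i\<in>I. c i *s u i) - a \<in> gker B" using kern_subset_gker[OF s(1)] by blast
  then have sumI: "(\<Sum>i\<in>I. c i *s u i) \<in> gker B"
    using vec.subspace_add[OF subspace_gker _ a(1)] by force
  have uI: "u i \<in> gker B" if i: "i \<in> I" for i
  proof -
    have "c i *s u i \<in> gker B"
      using i insert.prems sumI
      by (intro insert.IH[of "\<lambda>i. c i *s u i"]) (auto simp: vector_scalar_commute)
    then have "(1 / c i) *s (c i *s u i) \<in> gker B" by (rule vec.subspace_scale[OF subspace_gker])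
    moreover have "c i \<noteq> 0"
      using i insert.prems(3)[of i j] insert.hyps ds[of i] by (auto simp: c_def)
    then have "(1 / c i) *s (c i *s u i) = u i" unfolding vector_smult_assoc by simp
    ultimately show ?thesis by simp
  qed
  have "sum u I \<in> gker B" using uI by (intro vec.subspace_sum) auto
  then have "?w - sum u I \<in> gker B" using insert.prems(5) by (intro vec.subspace_diff) auto
  then have "u j \<in> gker B" using insert.hyps by simp
  then show ?case using uI insert.prems(6) by auto
qed

text \<open>Kernels at generic points lie in \<open>gker B\<close> already, so these points are
  dropped from the sum before the eigenvector argument.\<close>

lemma kernels_independent:
  assumes "finite I" "\<And>i. i \<in> I \<Longrightarrow> p i \<noteq> 0"
    "\<And>i j. i \<in> I \<Longrightarrow> j \<in> I \<Longrightarrow> i \<noteq> j \<Longrightarrow> det2 (p i) (p j) \<noteq> 0"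
    "\<And>i. i \<in> I \<Longrightarrow> u i \<in> kern (pencil B (p i))" "sum u I \<in> gker B" "i \<in> I"
  shows "u i \<in> gker B"
proof (cases "p i \<in> generic B")
  case True
  then show ?thesis using assms(4,6) kern_subset_gker by blast
next
  case False
  let ?J = "{i\<in>I. p i \<in> generic B}"
  have "u j \<in> gker B" if "j \<in> ?J" for j
    using assms(4)[of j] kern_subset_gker[of "p j" B] that by blast
  then have "sum u ?J \<in> gker B"
    by (intro vec.subspace_sum) auto
  moreover have "sum u (I - ?J) = sum u I - sum u ?J"
    using assms(1) by (simp add: sum_diff)
  ultimately have "sum u (I - ?J) \<in> gker B"
    using assms(5) by (auto intro: vec.subspace_diff)
  then show ?thesis
    using assms False by (intro kernels_independent_aux[of "I - ?J" p B u i]) auto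
qed

section \<open>Dimension counts for spans of kernels\<close>

lemma span_UN_sum:
  fixes S :: "'i \<Rightarrow> (complex^'n) set"
  assumes "finite I" "\<And>i. i \<in> I \<Longrightarrow> vec.subspace (S i)" "x \<in> vec.span (\<Union>i\<in>I. S i)"
  obtains u where "\<And>i. i \<in> I \<Longrightarrow> u i \<in> S i" "x = sum u I"
proof -
  let ?T = "{sum u I | u. \<forall>i\<in>I. u i \<in> S i}"
  have "vec.subspace ?T"
    unfolding vec.subspace_def
  proof (intro conjI ballI allI)
    show "0 \<in> ?T" using assms(2) vec.subspace_0 by (intro CollectI exI[of _ "\<lambda>_. 0"]) auto
    show "x + y \<in> ?T" if xy: "x \<in> ?T" "y \<in> ?T" for x y
    proof -
      obtain u v where "x = sum u I" "y = sum v I" "\<forall>i\<in>I. u i \<in> S i" "\<forall>i\<in>I. v i \<in> S i"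
        using xy by auto
      then show ?thesis using vec.subspace_add[OF assms(2)]
        by (intro CollectI exI[of _ "\<lambda>i. u i + v i"]) (simp add: sum.distrib)
    qed
    show "c *s x \<in> ?T" if x: "x \<in> ?T" for c x
    proof -
      obtain u where "x = sum u I" "\<forall>i\<in>I. u i \<in> S i" using x by auto
      then show ?thesis using vec.subspace_scale[OF assms(2)]
        by (intro CollectI exI[of _ "\<lambda>i. c *s u i"]) (simp add: vec.scale_sum_right)
    qed
  qed
  moreover have "(\<Union>i\<in>I. S i) \<subseteq> ?T"
  proof clarify
    fix i x assume i: "i \<in> I" "x \<in> S i"
    show "\<exists>u. x = sum u I \<and> (\<forall>i\<in>I. u i \<in> S i)"
      using i assms vec.subspace_0
      by (intro exI[of _ "\<lambda>j. if j = i then x else 0"]) (auto simp: sum.delta)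
  qed
  ultimately have "vec.span (\<Union>i\<in>I. S i) \<subseteq> ?T" by (intro vec.span_minimal)
  then have "x \<in> ?T" using assms(3) by blast
  then obtain u where "x = sum u I" "\<forall>i\<in>I. u i \<in> S i" by blast
  then show ?thesis using that[of u] by simp
qed

lemma dim_UN_le:
  fixes S :: "'i \<Rightarrow> (complex^'n) set"
  assumes "finite I"
  shows "vec.dim (\<Union>i\<in>I. S i) \<le> (\<Sum>i\<in>I. vec.dim (S i))"
proof -
  have "\<exists>B. B \<subseteq> S i \<and> finite B \<and> S i \<subseteq> vec.span B \<and> card B = vec.dim (S i)" for i
    by (metis vec.basis_exists vec.finiteI_independent)
  then obtain B where B: "\<And>i. finite (B i)" "\<And>i. S i \<subseteq> vec.span (B i)" "\<And>i. card (B i) = vec.dim (S i)"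
    by metis
  have "(\<Union>i\<in>I. S i) \<subseteq> vec.span (\<Union>i\<in>I. B i)"
  proof clarify
    fix i x assume "i \<in> I" "x \<in> S i"
    then show "x \<in> vec.span (\<Union>i\<in>I. B i)"
      using B(2)[of i] vec.span_mono[of "B i" "\<Union>i\<in>I. B i"] by blast
  qed
  then have "vec.dim (\<Union>i\<in>I. S i) \<le> card (\<Union>i\<in>I. B i)"
    using B(1) assms by (intro vec.dim_le_card) auto
  also have "\<dots> \<le> (\<Sum>i\<in>I. card (B i))" by (rule card_UN_le[OF assms])
  finally show ?thesis by (simp add: B(3))
qed

text \<open>If \<open>gker B\<close> were inside the span of the kernels, independence modulo
  \<open>gker B\<close> would make it the sum of their intersections with \<open>gker B\<close>.
  Each of these has dimension \<open>gnull B\<close>, too little in total.\<close>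

lemma functional_vanishing_on_kernels:
  fixes B :: "complex^'n^'n^2"
  assumes I: "finite I" "\<And>i. i \<in> I \<Longrightarrow> p i \<noteq> 0"
      "\<And>i j. i \<in> I \<Longrightarrow> j \<in> I \<Longrightarrow> i \<noteq> j \<Longrightarrow> det2 (p i) (p j) \<noteq> 0"
    and less: "card I * gnull B < vec.dim (gker B)"
  obtains y s u where "\<And>i v. i \<in> I \<Longrightarrow> v \<in> kern (pencil B (p i)) \<Longrightarrow> y \<odot> v = 0"
    "s \<in> generic B" "u \<in> kern (pencil B s)" "y \<odot> u \<noteq> 0"
proof -
  let ?S = "vec.span (\<Union>i\<in>I. kern (pencil B (p i)))"
  have "\<not> gker B \<subseteq> ?S"
  proof
    assume sub: "gker B \<subseteq> ?S"
    have "gker B \<subseteq> vec.span (\<Union>i\<in>I. kern (pencil B (p i)) \<inter> gker B)"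
    proof
      fix x assume x: "x \<in> gker B"
      then obtain u where u: "\<And>i. i \<in> I \<Longrightarrow> u i \<in> kern (pencil B (p i))" "x = sum u I"
        using span_UN_sum[OF I(1), of "\<lambda>i. kern (pencil B (p i))" x] sub by auto
      have "u i \<in> gker B" if "i \<in> I" for i
        using kernels_independent[of I p u B i] I u x that by blast
      then show "x \<in> vec.span (\<Union>i\<in>I. kern (pencil B (p i)) \<inter> gker B)"
        unfolding u(2) using u(1) by (intro vec.span_sum vec.span_base) auto
    qed
    then have "vec.dim (gker B) \<le> vec.dim (\<Union>i\<in>I. kern (pencil B (p i)) \<inter> gker B)"
      by (rule vec.subset_le_dim)
    also have "\<dots> \<le> (\<Sum>i\<in>I. vec.dim (kern (pencil B (p i)) \<inter> gker B))"
      by (rule dim_UN_le[OF I(1)])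
    also have "\<dots> = card I * gnull B" using I(2) by (simp add: dim_kern_Int_gker)
    finally show False using less by simp
  qed
  then obtain x where x: "x \<in> gker B" "x \<notin> ?S" by blast
  obtain y where y: "\<And>v. v \<in> ?S \<Longrightarrow> y \<odot> v = 0" "y \<odot> x \<noteq> 0"
    using separating_functional[OF vec.subspace_span x(2)] by blast
  have "\<exists>s\<in>generic B. \<exists>u\<in>kern (pencil B s). y \<odot> u \<noteq> 0"
  proof (rule ccontr)
    assume *: "\<not> ?thesis"
    have "gker B \<subseteq> {u. y \<odot> u = 0}"
      unfolding gker_def by (rule vec.span_minimal) (use * in auto)
    then show False using x y by auto
  qed
  then obtain s u where "s \<in> generic B" "u \<in> kern (pencil B s)" "y \<odot> u \<noteq> 0" by blast
  moreover have "y \<odot> v = 0" if "i \<in> I" "v \<in> kern (pencil B (p i))" for i v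
    by (rule y(1), rule vec.span_base) (use that in blast)
  ultimately show ?thesis using that[of y s u] by simp
qed

section \<open>Perturbing a singular pencil\<close>

text \<open>Stated for sequences because the iterates of an operator may repeat; a repetition is
  itself a relation.\<close>

lemma dependent_sequence:
  fixes v :: "nat \<Rightarrow> complex^'n"
  obtains c where "\<exists>i\<le>CARD('n). c i \<noteq> 0" "(\<Sum>i\<le>CARD('n). c i *s v i) = 0"
proof (cases "inj_on v {..CARD('n)}")
  case True
  have "vec.dim (v ` {..CARD('n)}) < card (v ` {..CARD('n)})"
    using dim_subset_UNIV_cart_gen[of "v ` {..CARD('n)}"] card_image[OF True] by simp
  then have "vec.dependent (v ` {..CARD('n)})"
    by (intro vec.dependent_biggerset_general)
  then obtain u where u: "\<exists>x\<in>v ` {..CARD('n)}. u x \<noteq> 0" "(\<Sum>x\<in>v ` {..CARD('n)}. u x *s x) = 0"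
    using vec.dependent_finite[of "v ` {..CARD('n)}"] by auto
  then show ?thesis
    using True by (intro that[of "\<lambda>i. u (v i)"]) (auto simp: sum.reindex)
next
  case False
  then obtain i j where ij: "i \<le> CARD('n)" "j \<le> CARD('n)" "i \<noteq> j" "v i = v j"
    by (auto simp: inj_on_def)
  define c :: "nat \<Rightarrow> complex" where "c k = (if k = i then 1 else 0) - (if k = j then 1 else 0)" for k
  have "(\<Sum>k\<le>CARD('n). c k *s v k) =
      (\<Sum>k\<le>CARD('n). if k = i then v k else 0) - (\<Sum>k\<le>CARD('n). if k = j then v k else 0)"
    unfolding c_def vector_sub_rdistrib sum_subtractf by (intro arg_cong2[of _ _ _ _ minus] sum.cong) auto
  also have "\<dots> = 0" using ij by (simp add: sum.delta)
  finally show ?thesis using ij by (intro that[of c]) (auto simp: c_def)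
qed

text \<open>Split off a root \<open>\<mu>\<close> of \<open>p\<close>: either
  \<open>f u - \<mu> *s u\<close> already lies in \<open>A\<close>, or it replaces \<open>u\<close>
  while the cofactor \<open>q\<close>, of smaller degree, replaces \<open>p\<close>.\<close>

lemma eigenvector_modulo_aux:
  fixes f :: "complex^'n \<Rightarrow> complex^'n"
  assumes f: "Vector_Spaces.linear (*s) (*s) f" and U: "vec.subspace U"
    and fU: "\<And>u. u \<in> U \<Longrightarrow> f u \<in> U"
  shows "degree p = n \<Longrightarrow> p \<noteq> 0 \<Longrightarrow> A \<subseteq> U \<Longrightarrow> vec.subspace A \<Longrightarrow> u \<in> U \<Longrightarrow> u \<notin> A \<Longrightarrow>
    (\<Sum>i\<le>n. coeff p i *s (f ^^ i) u) \<in> A \<Longrightarrow>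
    \<exists>\<mu> u. u \<in> U \<and> u \<notin> A \<and> f u - \<mu> *s u \<in> A"
proof (induction n arbitrary: p u)
  case 0
  then have "coeff p 0 \<noteq> 0" by (metis leading_coeff_0_iff)
  moreover have "coeff p 0 *s u \<in> A" using 0 by simp
  then have "(1 / coeff p 0) *s (coeff p 0 *s u) \<in> A"
    by (rule vec.subspace_scale[OF 0(4)])
  ultimately have "u \<in> A" unfolding vector_smult_assoc by simp
  then show ?case using 0(6) by simp
next
  case (Suc n)
  then have "\<not> constant (poly p)" by (simp add: constant_degree)
  then obtain \<mu> where "poly p \<mu> = 0" using fundamental_theorem_of_algebra by blast
  then obtain q where p: "p = [:-\<mu>, 1:] * q" by (metis poly_eq_0_iff_dvd dvdE)
  then have q: "q \<noteq> 0" using Suc.prems by auto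
  then have "degree p = 1 + degree q" unfolding p by (subst degree_mult_eq) auto
  then have "degree q = n" using Suc.prems(1) by simp
  let ?u = "f u - \<mu> *s u"
  show ?case
  proof (cases "?u \<in> A")
    case False
    have lin: "(f ^^ i) (f u - \<mu> *s u) = (f ^^ Suc i) u - \<mu> *s (f ^^ i) u" for i
      by (induction i) (simp_all add: vec.linear_diff[OF f] vec.linear_scale[OF f])
    have pc: "coeff p i = (if i = 0 then 0 else coeff q (i - 1)) - \<mu> * coeff q i" for i
      unfolding p by (cases i) (simp_all add: coeff_pCons)
    have "(\<Sum>i\<le>Suc n. coeff p i *s (f ^^ i) u) =
      (\<Sum>i\<le>Suc n. (if i = 0 then 0 else coeff q (i - 1)) *s (f ^^ i) u)
      - (\<Sum>i\<le>Suc n. (\<mu> * coeff q i) *s (f ^^ i) u)"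
      unfolding pc vector_sub_rdistrib sum_subtractf ..
    also have "(\<Sum>i\<le>Suc n. (if i = 0 then 0 else coeff q (i - 1)) *s (f ^^ i) u)
        = (\<Sum>i\<le>n. coeff q i *s (f ^^ Suc i) u)"
      by (subst sum.atMost_Suc_shift) simp
    also have "(\<Sum>i\<le>Suc n. (\<mu> * coeff q i) *s (f ^^ i) u) = (\<Sum>i\<le>n. (\<mu> * coeff q i) *s (f ^^ i) u)"
      using \<open>degree q = n\<close> by (simp add: coeff_eq_0)
    also have "(\<Sum>i\<le>n. coeff q i *s (f ^^ Suc i) u) - (\<Sum>i\<le>n. (\<mu> * coeff q i) *s (f ^^ i) u)
        = (\<Sum>i\<le>n. coeff q i *s (f ^^ i) ?u)"
      unfolding lin sum_subtractf[symmetric]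
      by (intro sum.cong) (simp_all add: vector_ssub_ldistrib vector_smult_assoc mult.commute)
    finally have "(\<Sum>i\<le>n. coeff q i *s (f ^^ i) ?u) \<in> A" using Suc.prems(7) by simp
    moreover have "?u \<in> U" using U fU Suc.prems(5) by (intro vec.subspace_diff vec.subspace_scale)
    ultimately show ?thesis
      using Suc.IH[OF \<open>degree q = n\<close> q] Suc.prems(3,4) False by blast
  qed (use Suc.prems in blast)
qed

lemma eigenvector_modulo:
  fixes f :: "complex^'n \<Rightarrow> complex^'n"
  assumes f: "Vector_Spaces.linear (*s) (*s) f" and U: "vec.subspace U"
    and fU: "\<And>u. u \<in> U \<Longrightarrow> f u \<in> U" and A: "vec.subspace A" "A \<subset> U"
  obtains \<mu> u where "u \<in> U" "u \<notin> A" "f u - \<mu> *s u \<in> A"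
proof -
  obtain u where u: "u \<in> U" "u \<notin> A" using A by auto
  obtain c where c: "\<exists>i\<le>CARD('n). c i \<noteq> 0" "(\<Sum>i\<le>CARD('n). c i *s (f ^^ i) u) = 0"
    by (rule dependent_sequence)
  define p where "p = (\<Sum>i\<le>CARD('n). monom (c i) i)"
  have cp: "coeff p k = (if k \<le> CARD('n) then c k else 0)" for k
    by (simp add: p_def coeff_sum if_distrib sum.delta cong: if_cong)
  have "p \<noteq> 0" using c(1) cp by (metis coeff_0)
  have "degree p \<le> CARD('n)" by (rule degree_le) (simp add: cp)
  then have "(\<Sum>i\<le>degree p. coeff p i *s (f ^^ i) u) = (\<Sum>i\<le>CARD('n). coeff p i *s (f ^^ i) u)"
    by (intro sum.mono_neutral_left) (auto simp: coeff_eq_0)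
  also have "\<dots> = 0" using c(2) by (simp add: cp)
  finally have "(\<Sum>i\<le>degree p. coeff p i *s (f ^^ i) u) \<in> A" using A vec.subspace_0 by auto
  then show ?thesis
    using eigenvector_modulo_aux[OF f U fU refl \<open>p \<noteq> 0\<close> _ A(1) u] A(2) that by blast
qed

text \<open>
  Holding on a line minus finitely many points, once it holds anywhere on the line: the part of
  genericity in the Zariski topology that allows several such conditions to be met at once.
\<close>

definition cofin :: "(complex^2 \<Rightarrow> bool) \<Rightarrow> bool"
  where "cofin P \<longleftrightarrow> (\<forall>s d. (\<exists>\<tau>. P (s + \<tau> *s d)) \<longrightarrow> finite {\<tau>. \<not> P (s + \<tau> *s d)})"

lemma cofin_conj:
  assumes "cofin P" "cofin Q"
  shows "cofin (\<lambda>s. P s \<and> Q s)"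
  unfolding cofin_def
proof (intro allI impI)
  fix s d
  assume "\<exists>\<tau>. P (s + \<tau> *s d) \<and> Q (s + \<tau> *s d)"
  then have "finite {\<tau>. \<not> P (s + \<tau> *s d)}" "finite {\<tau>. \<not> Q (s + \<tau> *s d)}"
    using assms unfolding cofin_def by blast+
  then have "finite ({\<tau>. \<not> P (s + \<tau> *s d)} \<union> {\<tau>. \<not> Q (s + \<tau> *s d)})" by simp
  then show "finite {\<tau>. \<not> (P (s + \<tau> *s d) \<and> Q (s + \<tau> *s d))}"
    by (rule rev_finite_subset) auto
qed

text \<open>On the line through \<open>s\<close> and \<open>s'\<close> both conditions fail only
  finitely often.\<close>

lemma cofin_common_point:
  assumes "cofin P" "cofin Q" "P s" "Q s'"
  obtains r where "P r" "Q r"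
proof -
  have "s + 0 *s (s' - s) = s" "s + 1 *s (s' - s) = s'" by auto
  then have "finite {\<tau>. \<not> P (s + \<tau> *s (s' - s))}" "finite {\<tau>. \<not> Q (s + \<tau> *s (s' - s))}"
    using assms unfolding cofin_def by metis+
  then have "finite ({\<tau>. \<not> P (s + \<tau> *s (s' - s))} \<union> {\<tau>. \<not> Q (s + \<tau> *s (s' - s))})" by simp
  then obtain \<tau> :: complex where "\<tau> \<notin> {\<tau>. \<not> P (s + \<tau> *s (s' - s))} \<union> {\<tau>. \<not> Q (s + \<tau> *s (s' - s))}"
    using ex_new_if_finite[OF infinite_UNIV_char_0] by blast
  then show ?thesis using that by blast
qed

lemma cofin_nullity: "cofin (\<lambda>s. nullity (pencil B s + K) \<le> k)"
  unfolding cofin_def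
proof (intro allI impI)
  fix s d
  have eq: "pencil B (s + \<tau> *s d) + K = affine_path (pencil B s + K) (pencil B d) \<tau>" for \<tau>
    by (simp add: pencil_affine_path affine_path_def vec_eq_iff)
  assume "\<exists>\<tau>. nullity (pencil B (s + \<tau> *s d) + K) \<le> k"
  then obtain \<tau> where "nullity (pencil B (s + \<tau> *s d) + K) \<le> k" by blast
  from finite_nullity_gt[OF this[unfolded eq]]
  show "finite {\<tau>. \<not> nullity (pencil B (s + \<tau> *s d) + K) \<le> k}"
    unfolding eq not_le .
qed

lemma cofin_det2: "cofin (\<lambda>s. det2 p s \<noteq> 0)"
  unfolding cofin_def
proof (intro allI impI)
  fix s d
  assume "\<exists>\<tau>. det2 p (s + \<tau> *s d) \<noteq> 0"
  then obtain \<tau>0 where "det2 p s + \<tau>0 * det2 p d \<noteq> 0" by auto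
  then have "{\<tau>. det2 p s + \<tau> * det2 p d = 0} \<subseteq> {- det2 p s / det2 p d}"
    by (cases "det2 p d = 0") (auto simp: field_simps add_eq_0_iff)
  then show "finite {\<tau>. \<not> det2 p (s + \<tau> *s d) \<noteq> 0}"
    by (simp add: finite_subset)
qed

text \<open>The factors \<open>- p $ 2\<close> and \<open>p $ 1\<close> are the coefficients of the
  form \<open>det2 p\<close>, so the member at \<open>p\<close> is unchanged.\<close>

definition rank1_perturb :: "complex^'n^'n^2 \<Rightarrow> complex^2 \<Rightarrow> complex^'n \<Rightarrow> complex^'n \<Rightarrow> complex^'n^'n^2"
  where "rank1_perturb B p x y =
    (\<chi> k. B $ k + outer ((if k = 1 then - p $ 2 else p $ 1) *s x) y)"

lemma pencil_rank1_perturb: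
  "pencil (rank1_perturb B p x y) s = pencil B s + outer (det2 p s *s x) y"
  by (simp add: pencil_def rank1_perturb_def outer_def det2_def vec_eq_iff algebra_simps)

lemma rank1_perturb_small:
  assumes "e > 0"
  obtains t where "t \<noteq> 0" "dist (rank1_perturb B p (t *s x) y) B < e"
proof -
  have "((\<lambda>t. rank1_perturb B p (t *s x) y) \<longlongrightarrow> rank1_perturb B p (0 *s x) y) (at 0)"
    unfolding rank1_perturb_def outer_def vector_scalar_mult_def by (intro tendsto_intros)
  moreover have "rank1_perturb B p (0 *s x) y = B"
    by (simp add: rank1_perturb_def outer_def vec_eq_iff)
  ultimately have "\<forall>\<^sub>F t in at 0. dist (rank1_perturb B p (t *s x) y) B < e"
    using assms tendstoD by fastforce
  then have "\<forall>\<^sub>F t in at 0. t \<noteq> 0 \<and> dist (rank1_perturb B p (t *s x) y) B < e"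
    using eventually_neq_at_within[of 0 0 UNIV] by eventually_elim simp
  then obtain t where "t \<noteq> 0" "dist (rank1_perturb B p (t *s x) y) B < e"
    using eventually_happens'[OF at_neq_bot] by blast
  then show ?thesis by (rule that)
qed

text \<open>The vectors \<open>y\<close> and \<open>x\<close> are only known to be nonzero on
  kernels at two possibly different generic points. Each fact is recast as a nullity bound for an
  auxiliary rank-one update, which is a \<open>cofin\<close> condition, so that both hold at a
  common \<open>s\<close> where \<open>det2 p s\<close> is nonzero.\<close>

lemma gnull_rank1_perturb_less:
  fixes B :: "complex^'n^'n^2"
  assumes p: "p \<noteq> 0" and t: "t \<noteq> 0"
    and s1: "s1 \<in> generic B" "u1 \<in> kern (pencil B s1)" "y \<odot> u1 \<noteq> 0"
    and s2: "s2 \<in> generic B" "w2 \<in> kern (transpose (pencil B s2))" "x \<odot> w2 \<noteq> 0"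
  shows "gnull (rank1_perturb B p (t *s x) y) < gnull B"
proof -
  let ?g = "gnull B"
  have g1: "nullity (pencil B s1) = ?g" and g2: "nullity (pencil B s2) = ?g"
    using s1(1) s2(1) by (simp_all add: generic_def)
  have "u1 \<noteq> 0" using s1 by auto
  then have gpos: "?g > 0" using g1 s1(2) nullity_pos[of "pencil B s1"] by auto
  then obtain w1 where w1: "w1 \<in> kern (transpose (pencil B s1))" "w1 \<noteq> 0"
    using nullity_pos[of "transpose (pencil B s1)"] g1 by (auto simp: nullity_transpose)
  obtain u2 where u2: "u2 \<in> kern (pencil B s2)" "u2 \<noteq> 0"
    using nullity_pos[of "pencil B s2"] g2 gpos by auto
  obtain x' where x': "x' \<odot> w1 \<noteq> 0" using nonzero_pairing[OF w1(2)] .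
  obtain y' where y': "y' \<odot> u2 \<noteq> 0" using nonzero_pairing[OF u2(2)] .
  have P1: "nullity (pencil B s1 + outer x' y) \<le> ?g - 1"
    using nullity_outer_less[OF w1(1) _ s1(2,3), of x'] x' g1 by (simp add: sp_commute)
  have P2: "nullity (pencil B s2 + outer x y') \<le> ?g - 1"
    using nullity_outer_less[OF s2(2) _ u2(1) y', of x] s2(3) g2 by (simp add: sp_commute)
  obtain s3 where s3: "det2 p s3 = 1" using det2_complement[OF p] .
  obtain r where r: "nullity (pencil B r + outer x' y) \<le> ?g - 1" "nullity (pencil B r + outer x y') \<le> ?g - 1"
    by (rule cofin_common_point[OF cofin_nullity cofin_nullity P1 P2])
  obtain s where s: "nullity (pencil B s + outer x' y) \<le> ?g - 1"
      "nullity (pencil B s + outer x y') \<le> ?g - 1" "det2 p s \<noteq> 0"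
  proof (rule cofin_common_point[OF cofin_conj[OF cofin_nullity cofin_nullity] cofin_det2])
    show "nullity (pencil B r + outer x' y) \<le> ?g - 1 \<and> nullity (pencil B r + outer x y') \<le> ?g - 1"
      using r by simp
    show "det2 p s3 \<noteq> 0" using s3 by simp
  qed (use that in blast)
  \<comment> \<open>A rank-one update lowers the nullity by at most one, so the bound
    \<open>?g - 1\<close> after the update makes \<open>s\<close> generic.\<close>
  have gs: "nullity (pencil B s) = ?g"
    using nullity_outer_ge[of "pencil B s" x' y] gnull_le[of B s] s(1) gpos by linarith
  have "\<exists>u\<in>kern (pencil B s). y \<odot> u \<noteq> 0"
  proof (rule ccontr)
    assume "\<not> ?thesis"
    then have "kern (pencil B s) \<subseteq> kern (pencil B s + outer x' y)"
      by (auto simp: matrix_vector_mult_add_rdistrib)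
    from vec.dim_subset[OF this] show False using s(1) gs gpos by (simp add: nullity_def)
  qed
  then obtain u where u: "u \<in> kern (pencil B s)" "y \<odot> u \<noteq> 0" by blast
  have "\<exists>w\<in>kern (transpose (pencil B s)). x \<odot> w \<noteq> 0"
  proof (rule ccontr)
    assume "\<not> ?thesis"
    then have "kern (transpose (pencil B s)) \<subseteq> kern (transpose (pencil B s + outer x y'))"
      by (auto simp: matrix_vector_mult_add_rdistrib)
    from vec.dim_subset[OF this]
    have "nullity (transpose (pencil B s)) \<le> nullity (transpose (pencil B s + outer x y'))"
      by (simp only: nullity_def)
    then show False using s(2) gs gpos by (simp only: nullity_transpose)
  qed
  then obtain w where w: "w \<in> kern (transpose (pencil B s))" "x \<odot> w \<noteq> 0" by blast
  have "nullity (pencil B s + outer (det2 p s *s (t *s x)) y) < nullity (pencil B s)"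
    using w u s(3) t by (intro nullity_outer_less[OF w(1) _ u]) (simp add: sp_commute)
  then show ?thesis
    using gnull_le[of "rank1_perturb B p (t *s x) y" s] gs by (simp add: pencil_rank1_perturb)
qed

text \<open>Extends generic kernels to nongeneric points \<open>a\<close>: genericity fails only
  finitely often on the line from \<open>a\<close> to a generic point, and unit kernel vectors at
  points tending to \<open>a\<close> have a convergent subsequence.\<close>

lemma limit_kernel_vector:
  fixes B :: "complex^'n^'n^2"
  assumes "gnull B > 0"
  obtains S V v where "\<And>n. S n \<in> generic B" "S \<longlonglongrightarrow> a"
    "\<And>n. V n \<in> kern (pencil B (S n))" "V \<longlonglongrightarrow> v" "v \<noteq> 0"
proof -
  obtain s where s: "s \<in> generic B" by (rule generic_exists)
  define S where "S n = a + (1 / of_nat (Suc n)) *s (s - a)" for n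
  have "nullity (affine_path (pencil B a) (pencil B (s - a)) 1) \<le> gnull B"
    using s by (simp add: pencil_affine_path[symmetric] generic_def)
  from finite_nullity_gt[OF this]
  have fin: "finite {\<tau>. nullity (pencil B (a + \<tau> *s (s - a))) > gnull B}"
    unfolding pencil_affine_path .
  have "inj (\<lambda>n. 1 / of_nat (Suc n) :: complex)"
    by (rule injI) (simp add: field_simps flip: of_nat_Suc)
  then have "finite {n. nullity (pencil B (S n)) > gnull B}"
    using finite_vimageI[OF fin] by (simp add: vimage_def S_def)
  then obtain N where N: "\<And>n. nullity (pencil B (S n)) > gnull B \<Longrightarrow> n < N"
    using finite_nat_set_iff_bounded[of "{n. nullity (pencil B (S n)) > gnull B}"] by auto
  have gen: "S (n + N) \<in> generic B" for n
    using N[of "n + N"] gnull_le[of B "S (n + N)"] unfolding generic_def by fastforce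
  have inv: "(\<lambda>n. 1 / of_nat (Suc n) :: complex) \<longlonglongrightarrow> 0"
    by (rule LIMSEQ_Suc[OF lim_1_over_n])
  have "S = (\<lambda>n. \<chi> i. a $ i + (1 / of_nat (Suc n)) * (s - a) $ i)"
    by (simp add: S_def fun_eq_iff vec_eq_iff diff_divide_distrib del: of_nat_Suc)
  also have "\<dots> \<longlonglongrightarrow> (\<chi> i. a $ i + 0 * (s - a) $ i)"
    by (intro tendsto_intros inv)
  also have "(\<chi> i. a $ i + 0 * (s - a) $ i) = a" by (simp add: vec_eq_iff)
  finally have lim: "S \<longlonglongrightarrow> a" .
  have "\<exists>v\<in>kern (pencil B (S (n + N))). norm v = 1" for n
  proof -
    have "nullity (pencil B (S (n + N))) > 0" using gen[of n] assms by (simp add: generic_def)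
    then obtain u where u: "u \<in> kern (pencil B (S (n + N)))" "u \<noteq> 0" by (auto simp: nullity_pos)
    have sc: "inverse (norm u) *\<^sub>R u = complex_of_real (inverse (norm u)) *s u"
      by (simp add: vec_eq_iff scaleR_conv_of_real[where 'a = complex])
    have "norm (inverse (norm u) *\<^sub>R u) = 1" using u by simp
    moreover have "inverse (norm u) *\<^sub>R u \<in> kern (pencil B (S (n + N)))"
      unfolding sc by (rule vec.subspace_scale[OF subspace_kern u(1)])
    ultimately show ?thesis by blast
  qed
  then obtain V where V: "\<And>n. V n \<in> kern (pencil B (S (n + N)))" "\<And>n. norm (V n) = 1"
    by metis
  have "seq_compact (sphere (0 :: complex^'n) 1)"
    using compact_sphere compact_imp_seq_compact by blast
  then obtain v r where v: "v \<in> sphere 0 1" "strict_mono r" "(V \<circ> r) \<longlonglongrightarrow> v"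
    using V(2) by (elim seq_compactE[of _ V]) auto
  show ?thesis
  proof (rule that[of "\<lambda>n. S (r n + N)" "V \<circ> r" v])
    have "(\<lambda>n. S (n + N)) \<longlonglongrightarrow> a" using lim by (rule LIMSEQ_ignore_initial_segment)
    from LIMSEQ_subseq_LIMSEQ[OF this v(2)] show "(\<lambda>n. S (r n + N)) \<longlonglongrightarrow> a"
      by (simp add: o_def)
    show "v \<noteq> 0" using v(1) by auto
  qed (use gen V v in auto)
qed

lemma generic_zero:
  assumes "0 \<in> generic B"
  shows "pencil B s *v u = 0"
proof -
  have "kern (pencil B 0) = UNIV" by (auto simp: pencil_mult)
  then have "gnull B = CARD('a)"
    using assms vec_dim_card by (metis (mono_tags, lifting) generic_def mem_Collect_eq nullity_def)
  then have "nullity (pencil B s) = CARD('a)"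
    using gnull_le[of B s] dim_subset_UNIV_cart_gen[of "kern (pencil B s)"]
    unfolding nullity_def by linarith
  then have "vec.dim (UNIV :: (complex^'a) set) \<le> vec.dim (kern (pencil B s))"
    unfolding vec_dim_card by (simp add: nullity_def)
  then have "kern (pencil B s) = UNIV"
    by (intro vec.subspace_dim_equal) auto
  then show ?thesis by (metis UNIV_I in_kern)
qed

section \<open>The three kinds of perturbation\<close>

lemma extend_to_dim:
  fixes L K :: "(complex^'n) set"
  assumes "vec.subspace L" "vec.subspace K" "L \<subseteq> K" "vec.dim L \<le> d" "d \<le> vec.dim K"
  obtains F where "finite F" "card F = d - vec.dim L" "F \<subseteq> K" "vec.dim (vec.span (L \<union> F)) = d"
proof -
  obtain C where C: "C \<subseteq> L" "vec.independent C" "vec.span C = L" "card C = vec.dim L"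
    using vec.basis_subspace_exists[OF assms(1)] by metis
  obtain E where E: "C \<subseteq> E" "E \<subseteq> K" "vec.independent E" "K \<subseteq> vec.span E"
    using vec.maximal_independent_subset_extend[of C K] C assms(3) by auto
  have "card E = vec.dim K" by (rule vec.basis_card_eq_dim[OF E(2,4,3)])
  moreover have "finite E" using E(3) by (rule vec.finiteI_independent)
  ultimately obtain H where H: "C \<subseteq> H" "H \<subseteq> E" "card H = d"
    using exists_subset_between[of C d E] C(4) assms(4,5) E(1) by auto
  have finH: "finite H" using H \<open>finite E\<close> finite_subset by blast
  have indH: "vec.independent H" using E(3) H(2) by (rule vec.independent_mono)
  have "vec.span (L \<union> (H - C)) = vec.span H"
  proof
    have "L \<union> (H - C) \<subseteq> vec.span H"
      using vec.span_mono[OF H(1)] C(3) vec.span_superset[of H] by auto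
    then show "vec.span (L \<union> (H - C)) \<subseteq> vec.span H"
      by (intro vec.span_minimal) auto
    show "vec.span H \<subseteq> vec.span (L \<union> (H - C))"
      using C(1) by (intro vec.span_mono) auto
  qed
  moreover have "vec.dim (vec.span H) = d"
    using indH H(3) by (simp add: vec.dim_eq_card_independent)
  ultimately show ?thesis
    using that[of "H - C"] finH H E C by (simp add: card_Diff_subset finite_subset) blast
qed

text \<open>
  At \<open>p i\<close> the row vector \<open>y\<close> lies in the row space for \<open>i < k\<close>, the column vector \<open>x\<close> in the
  column space for \<open>i > k\<close>, and the linear coefficient vanishes for \<open>i = k\<close>: none of the ranks at
  the \<open>p i\<close> can grow, although the generic rank does.
\<close>

lemma perturb_raise_rank:
  fixes B :: "complex^'n^'n^2"
  assumes p: "\<And>i. i < m \<Longrightarrow> p i \<noteq> 0"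
      "\<And>i j. i < m \<Longrightarrow> j < m \<Longrightarrow> i \<noteq> j \<Longrightarrow> det2 (p i) (p j) \<noteq> 0"
    and B: "\<And>i. i < m \<Longrightarrow> d \<le> nullity (pencil B (p i))"
    and k: "k < m" "k * gnull B < vec.dim (gker B)"
      "(m - 1 - k) * gnull B < vec.dim (gker (transpose_pencil B))"
    and e: "e > 0"
  obtains B' where "dist B' B < e" "\<And>i. i < m \<Longrightarrow> d \<le> nullity (pencil B' (p i))" "gnull B' < gnull B"
proof -
  have I: "finite {..<k}" "card {..<k} * gnull B < vec.dim (gker B)" using k by auto
  have J: "finite {k+1..<m}"
    "card {k+1..<m} * gnull (transpose_pencil B) < vec.dim (gker (transpose_pencil B))"
    using k by auto
  obtain y s1 u1 where y: "\<And>i v. i \<in> {..<k} \<Longrightarrow> v \<in> kern (pencil B (p i)) \<Longrightarrow> y \<odot> v = 0"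
    "s1 \<in> generic B" "u1 \<in> kern (pencil B s1)" "y \<odot> u1 \<noteq> 0"
    by (rule functional_vanishing_on_kernels[OF I(1) _ _ I(2), of p]) (use p k in auto)
  obtain x s2 w2 where x:
    "\<And>i v. i \<in> {k+1..<m} \<Longrightarrow> v \<in> kern (pencil (transpose_pencil B) (p i)) \<Longrightarrow> x \<odot> v = 0"
    "s2 \<in> generic (transpose_pencil B)" "w2 \<in> kern (pencil (transpose_pencil B) s2)" "x \<odot> w2 \<noteq> 0"
    by (rule functional_vanishing_on_kernels[OF J(1) _ _ J(2), of p]) (use p k in auto)
  obtain t where t: "t \<noteq> 0" "dist (rank1_perturb B (p k) (t *s x) y) B < e"
    using rank1_perturb_small[OF e] .
  let ?B = "rank1_perturb B (p k) (t *s x) y"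
  have "d \<le> nullity (pencil ?B (p i))" if i: "i < m" for i
  proof -
    consider "i < k" | "i = k" | "i \<in> {k+1..<m}" using i by fastforce
    then show ?thesis
    proof cases
      case 1
      then have "kern (pencil B (p i)) \<subseteq> kern (pencil ?B (p i))"
        using y(1) by (auto simp: pencil_rank1_perturb matrix_vector_mult_add_rdistrib)
      from vec.dim_subset[OF this] show ?thesis using B[OF i] by (simp add: nullity_def)
    next
      case 2
      have "outer (det2 (p i) (p i) *s (t *s x)) y = 0" by (simp add: outer_def vec_eq_iff)
      then show ?thesis using B[OF i] 2 by (simp add: pencil_rank1_perturb)
    next
      case 3
      have "kern (transpose (pencil B (p i))) \<subseteq> kern (transpose (pencil ?B (p i)))"
        using x(1)[OF 3] by (auto simp: pencil_rank1_perturb matrix_vector_mult_add_rdistrib)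
      from vec.dim_subset[OF this]
      have "nullity (transpose (pencil B (p i))) \<le> nullity (transpose (pencil ?B (p i)))"
        by (simp only: nullity_def)
      then show ?thesis using B[OF i] by (simp only: nullity_transpose)
    qed
  qed
  moreover have "gnull ?B < gnull B"
    using x(2,3) by (intro gnull_rank1_perturb_less[OF p(1)[OF k(1)] t(1) y(2-4) _ _ x(4)]) auto
  ultimately show ?thesis using that t(2) by blast
qed

text \<open>Every nullity exceeds \<open>d\<close> and a rank-one update lowers it by at most one,
  so only the drop of the generic nullity has to be arranged.\<close>

lemma perturb_raise_rank_excess:
  fixes B :: "complex^'n^'n^2"
  assumes g: "d < gnull B" and e: "e > 0"
  obtains B' where "dist B' B < e" "\<And>s. d \<le> nullity (pencil B' s)" "gnull B' < gnull B"
proof -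
  obtain s where s: "s \<in> generic B" "s \<noteq> 0" by (rule generic_exists)
  have n: "nullity (pencil B s) > 0" using s g by (simp add: generic_def)
  obtain u where u: "u \<in> kern (pencil B s)" "u \<noteq> 0" using n by (auto simp: nullity_pos)
  obtain w where w: "w \<in> kern (transpose (pencil B s))" "w \<noteq> 0"
    using n nullity_pos[of "transpose (pencil B s)"] by (auto simp: nullity_transpose)
  obtain y where y: "y \<odot> u \<noteq> 0" using nonzero_pairing[OF u(2)] .
  obtain x where x: "x \<odot> w \<noteq> 0" using nonzero_pairing[OF w(2)] .
  obtain t where t: "t \<noteq> 0" "dist (rank1_perturb B s (t *s x) y) B < e"
    using rank1_perturb_small[OF e] .
  have "d \<le> nullity (pencil (rank1_perturb B s (t *s x) y) r)" for r
    using nullity_outer_ge[of "pencil B r" "det2 s r *s (t *s x)" y] gnull_le[of B r] g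
    by (simp add: pencil_rank1_perturb)
  moreover have "gnull (rank1_perturb B s (t *s x) y) < gnull B"
    by (rule gnull_rank1_perturb_less[OF s(2) t(1) s(1) u(1) y s(1) w(1) x])
  ultimately show ?thesis using that t(2) by blast
qed

text \<open>By interpolation all images of \<open>w\<close> are multiples of one vector; when
  \<open>p\<close> is proportional to \<open>s\<close>, \<open>w\<close> is a generic kernel vector
  and images of \<open>gker\<close> coincide. A space spanned by such \<open>w\<close> together with
  the left \<open>gker\<close> is therefore mapped by every member into its image under the member
  at \<open>s\<close>.\<close>

lemma transpose_kernel_image:
  assumes s: "s \<in> generic B" "s \<noteq> 0" and p: "p \<noteq> 0" and w: "w \<in> kern (transpose (pencil B p))"
  shows "\<exists>v\<in>vec.span (insert w (gker (transpose_pencil B))).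
    transpose (pencil B r) *v w = transpose (pencil B s) *v v"
proof (cases "det2 p s = 0")
  case True
  have "p \<in> generic (transpose_pencil B)" using generic_proportional[OF s p True] by simp
  then have "w \<in> gker (transpose_pencil B)"
    using kern_subset_gker[of p "transpose_pencil B"] w unfolding pencil_transpose by blast
  from subsetD[OF gker_image_subset[OF s(2), of "transpose_pencil B" r] imageI[OF this]]
  obtain v where v: "v \<in> gker (transpose_pencil B)"
      "transpose (pencil B r) *v w = transpose (pencil B s) *v v"
    unfolding pencil_transpose by (elim imageE) (rule that)
  have "v \<in> vec.span (insert w (gker (transpose_pencil B)))"
    using v(1) by (intro vec.span_base) simp
  then show ?thesis using v(2) by blast
next
  case False
  have "det2 p s *s (transpose (pencil B r) *v w) = det2 p r *s (transpose (pencil B s) *v w)"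
    using pencil_interpolation[of p s "transpose_pencil B" r w] w by simp
  then have "(1 / det2 p s) *s (det2 p s *s (transpose (pencil B r) *v w)) =
      (1 / det2 p s) *s (det2 p r *s (transpose (pencil B s) *v w))" by simp
  then have "transpose (pencil B r) *v w = transpose (pencil B s) *v ((det2 p r / det2 p s) *s w)"
    unfolding vector_smult_assoc using False by (simp add: vector_scalar_commute)
  moreover have "(det2 p r / det2 p s) *s w \<in> vec.span (insert w (gker (transpose_pencil B)))"
    by (intro vec.span_scale vec.span_base) simp
  ultimately show ?thesis by blast
qed

text \<open>The image of \<open>gker B\<close> at \<open>s\<close> lies in its image at
  \<open>p\<close>, which \<open>w\<close> annihilates.\<close>

lemma gker_pairing_zero:
  assumes "p \<noteq> 0" "w \<in> kern (transpose (pencil B p))" "u \<in> gker B"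
  shows "w \<odot> (pencil B s *v u) = 0"
  by (rule gker_annihilator[OF assms(1) _ assms(3)]) (use assms(2) in \<open>simp add: sp_matrix\<close>)

lemma gker_gker_pairing_zero:
  assumes w: "w \<in> gker (transpose_pencil B)" and u: "u \<in> gker B"
  shows "w \<odot> (pencil B s *v u) = 0"
proof -
  have "gker (transpose_pencil B) \<subseteq> {w. (pencil B s *v u) \<odot> w = 0}"
    unfolding gker_def
  proof (rule vec.span_minimal)
    show "(\<Union>r\<in>generic (transpose_pencil B). kern (pencil (transpose_pencil B) r))
        \<subseteq> {w. (pencil B s *v u) \<odot> w = 0}"
    proof clarify
      fix r v assume r: "r \<in> generic (transpose_pencil B)"
        and v: "v \<in> kern (pencil (transpose_pencil B) r)"
      have "v \<odot> (pencil B s *v u) = 0"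
      proof (cases "r = 0")
        case True
        then show ?thesis using r generic_zero[of B s u] by simp
      next
        case False
        then show ?thesis using v by (intro gker_pairing_zero[OF False _ u]) simp
      qed
      then show "(pencil B s *v u) \<odot> v = 0" by (simp add: sp_commute)
    qed
  qed simp
  then show ?thesis using w by (auto simp: sp_commute)
qed

text \<open>
  The subspace \<open>U\<close> below contains \<open>gker B\<close> strictly, and one generic member of the pencil maps it
  onto \<open>ann D\<close>. Inverting that member there turns a second one into an operator on \<open>U\<close> modulo
  \<open>gker B\<close>, whose eigenvector is the required \<open>u\<close>.
\<close>

lemma free_eigenvector:
  fixes B :: "complex^'n^'n^2"
  assumes N: "CARD('n) = m * d"
    and p: "\<And>i. i < m \<Longrightarrow> p i \<noteq> 0"
    and B: "\<And>i. i < m \<Longrightarrow> d \<le> nullity (pencil B (p i))"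
    and g: "gnull B \<le> d"
    and small: "vec.dim (gker B) + vec.dim (gker (transpose_pencil B)) < (m + 1) * gnull B"
  obtains a u D where "a \<noteq> 0" "u \<notin> gker B" "u \<in> kern (pencil B a)"
    "\<And>s. pencil B s *v u \<in> ann D" "gker (transpose_pencil B) \<subseteq> D"
    "\<And>i. i < m \<Longrightarrow> d \<le> vec.dim (D \<inter> kern (transpose (pencil B (p i))))"
proof -
  let ?g = "gnull B" and ?A = "gker B" and ?A' = "gker (transpose_pencil B)"
  let ?K = "\<lambda>i. kern (transpose (pencil B (p i)))"
  have K: "vec.dim (?K i \<inter> ?A') = ?g" "d \<le> vec.dim (?K i)" if "i < m" for i
    using dim_kern_Int_gker[OF p[OF that], of "transpose_pencil B"] B[OF that]
    by (simp_all add: nullity_def[symmetric] nullity_transpose)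
  \<comment> \<open>\<open>D\<close> has to contain \<open>d\<close> dimensions of each left kernel
    and be small. Since \<open>?g\<close> of them lie in \<open>?A'\<close> anyway,
    \<open>d - ?g\<close> vectors per point suffice.\<close>
  have "\<exists>F. finite F \<and> card F = d - ?g \<and> F \<subseteq> ?K i \<and> vec.dim (vec.span ((?K i \<inter> ?A') \<union> F)) = d"
    if i: "i < m" for i
  proof -
    have "vec.subspace (?K i \<inter> ?A')" by (intro vec.subspace_inter) auto
    then obtain F where "finite F" "card F = d - vec.dim (?K i \<inter> ?A')" "F \<subseteq> ?K i"
      "vec.dim (vec.span ((?K i \<inter> ?A') \<union> F)) = d"
      using extend_to_dim[of "?K i \<inter> ?A'" "?K i" d] K[OF i] g by (metis Int_lower1 subspace_kern)
    then show ?thesis using K[OF i] by auto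
  qed
  then obtain F where F: "\<And>i. i < m \<Longrightarrow> finite (F i)" "\<And>i. i < m \<Longrightarrow> card (F i) = d - ?g"
    "\<And>i. i < m \<Longrightarrow> F i \<subseteq> ?K i" "\<And>i. i < m \<Longrightarrow> vec.dim (vec.span ((?K i \<inter> ?A') \<union> F i)) = d"
    by metis
  define D where "D = vec.span (?A' \<union> (\<Union>i<m. F i))"
  have D: "vec.subspace D" "?A' \<subseteq> D" "\<And>i. i < m \<Longrightarrow> F i \<subseteq> D"
    using vec.span_superset[of "?A' \<union> (\<Union>i<m. F i)"] by (auto simp: D_def)
  have dimD: "vec.dim D \<le> vec.dim ?A' + m * (d - ?g)"
  proof -
    obtain C where C: "finite C" "vec.span C = ?A'" "card C = vec.dim ?A'"
      using vec.basis_subspace_exists[OF subspace_gker] by metis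
    have "?A' \<union> (\<Union>i<m. F i) \<subseteq> vec.span (C \<union> (\<Union>i<m. F i))"
      using vec.span_mono[of C "C \<union> (\<Union>i<m. F i)"] vec.span_superset[of "C \<union> (\<Union>i<m. F i)"] C(2)
      by auto
    then have "vec.dim D \<le> card (C \<union> (\<Union>i<m. F i))"
      unfolding D_def vec.dim_span using C F(1) by (intro vec.dim_le_card) auto
    also have "\<dots> \<le> card C + card (\<Union>i<m. F i)" by (rule card_Un_le)
    also have "card (\<Union>i<m. F i) \<le> (\<Sum>i<m. card (F i))" by (rule card_UN_le) simp
    also have "(\<Sum>i<m. card (F i)) = m * (d - ?g)" using F(2) by simp
    finally show ?thesis using C(3) by simp
  qed
  obtain s0 where s0: "s0 \<in> generic B" "s0 \<noteq> 0" by (rule generic_exists)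
  define D' where "D' = (*v) (transpose (pencil B s0)) ` D"
  have D': "vec.subspace D'" using D(1) by (simp add: D'_def)
  have image_D: "transpose (pencil B s) *v w \<in> D'" if w: "w \<in> D" for s w
  proof -
    have "D \<subseteq> {w. transpose (pencil B s) *v w \<in> D'}"
      unfolding D_def
    proof (rule vec.span_minimal)
      show "vec.subspace {w. transpose (pencil B s) *v w \<in> D'}"
        using vec.linear_subspace_vimage[OF matrix_vector_mul_linear_gen D'] by (simp add: vimage_def)
      show "?A' \<union> (\<Union>i<m. F i) \<subseteq> {w. transpose (pencil B s) *v w \<in> D'}"
      proof
        fix w assume "w \<in> ?A' \<union> (\<Union>i<m. F i)"
        then consider "w \<in> ?A'" | i where "i < m" "w \<in> F i" by auto
        then show "w \<in> {w. transpose (pencil B s) *v w \<in> D'}"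
        proof cases
          case 1
          then show ?thesis
            using gker_image_subset[OF s0(2), of "transpose_pencil B" s] D(2) unfolding D'_def by auto
        next
          case 2
          then obtain v where v: "v \<in> vec.span (insert w ?A')"
              "transpose (pencil B s) *v w = transpose (pencil B s0) *v v"
            using transpose_kernel_image[OF s0 p[OF 2(1)], of w s] F(3) by blast
          have "vec.span (insert w ?A') \<subseteq> D"
            using D 2 by (intro vec.span_minimal) auto
          then show ?thesis using v unfolding D'_def by auto
        qed
      qed
    qed
    then show ?thesis using w by auto
  qed
  define U where "U = ann D'"
  have U: "vec.subspace U" by (simp add: U_def)
  have BU: "pencil B s *v u \<in> ann D" if "u \<in> U" for s u
    using image_D that by (auto simp: ann_def U_def sp_matrix)
  have AU: "?A \<subseteq> U"
  proof
    fix u assume u: "u \<in> ?A"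
    have "D \<subseteq> {w. (pencil B s0 *v u) \<odot> w = 0}"
      unfolding D_def
    proof (rule vec.span_minimal)
      show "?A' \<union> (\<Union>i<m. F i) \<subseteq> {w. (pencil B s0 *v u) \<odot> w = 0}"
      proof
        fix w assume "w \<in> ?A' \<union> (\<Union>i<m. F i)"
        then consider "w \<in> ?A'" | i where "i < m" "w \<in> ?K i" using F(3) by blast
        then have "w \<odot> (pencil B s0 *v u) = 0"
        proof cases
          case 1
          then show ?thesis by (rule gker_gker_pairing_zero[OF _ u])
        next
          case 2
          show ?thesis by (rule gker_pairing_zero[OF p[OF 2(1)] 2(2) u])
        qed
        then show "w \<in> {w. (pencil B s0 *v u) \<odot> w = 0}" by (simp add: sp_commute)
      qed
    qed simp
    then have "w \<odot> (pencil B s0 *v u) = 0" if "w \<in> D" for w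
      using that sp_commute[of w "pencil B s0 *v u"] by auto
    then have "(transpose (pencil B s0) *v w) \<odot> u = 0" if "w \<in> D" for w
      using that by (simp add: sp_matrix)
    then show "u \<in> U" unfolding U_def D'_def by (intro annI) auto
  qed
  have kA': "kern (transpose (pencil B s0)) \<subseteq> ?A'"
    using kern_subset_gker[of s0 "transpose_pencil B"] s0 by simp
  \<comment> \<open>The left kernel at \<open>s0\<close> lies entirely in \<open>D\<close>, so
    exactly \<open>?g\<close> dimensions are lost.\<close>
  have "vec.dim D' + ?g = vec.dim D"
  proof -
    have "D \<inter> kern (transpose (pencil B s0)) = kern (transpose (pencil B s0))"
      using kA' D(2) by auto
    moreover have "vec.dim (kern (transpose (pencil B s0))) = ?g"
      using dim_kern_generic[of s0 "transpose_pencil B"] s0 by simp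
    ultimately show ?thesis
      using dim_image_kern[OF D(1), of "transpose (pencil B s0)"] by (simp only: D'_def)
  qed
  then have dimU: "vec.dim U + vec.dim D = CARD('n) + ?g"
    using dim_ann[of D'] by (simp add: U_def)
  \<comment> \<open>The dimension of \<open>U\<close> is at least
    \<open>m d + g - (a' + m (d - g)) = (m + 1) g - a'\<close>, which exceeds \<open>a\<close> by
    \<open>small\<close>.\<close>
  have "vec.dim ?A < vec.dim U"
  proof -
    have "m * (d - ?g) + m * ?g = m * d" using g by (simp add: add_mult_distrib2[symmetric])
    then show ?thesis
      using dimU dimD small N unfolding add_mult_distrib by linarith
  qed
  then have AltU: "?A \<subset> U" using AU by auto
  have image_U: "(*v) (pencil B s0) ` U = ann D"
  proof (rule vec.subspace_dim_equal)
    show "(*v) (pencil B s0) ` U \<subseteq> ann D" using BU by auto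
    have "U \<inter> kern (pencil B s0) = kern (pencil B s0)"
      using kern_subset_gker[OF s0(1)] AU by auto
    then have "vec.dim ((*v) (pencil B s0) ` U) + ?g = vec.dim U"
      using dim_image_kern[OF U, of "pencil B s0"] dim_kern_generic[OF s0(1)] by simp
    then show "vec.dim (ann D) \<le> vec.dim ((*v) (pencil B s0) ` U)"
      using dimU dim_ann[of D] by simp
  qed (use U in simp_all)
  obtain h where h: "range h \<subseteq> U" "Vector_Spaces.linear (*s) (*s) h"
    "\<forall>v\<in>(*v) (pencil B s0) ` U. pencil B s0 *v (h v) = v"
    using vec.linear_exists_right_inverse_on[OF matrix_vector_mul_linear_gen[of "pencil B s0"] U] by blast
  obtain s1 where s1: "det2 s0 s1 = 1" using det2_complement[OF s0(2)] .
  define f where "f u = h (pencil B s1 *v u)" for u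
  have f: "Vector_Spaces.linear (*s) (*s) f"
    using Vector_Spaces.linear_compose[OF matrix_vector_mul_linear_gen[of "pencil B s1"] h(2)]
    by (simp add: f_def[abs_def] o_def)
  have Bf: "pencil B s0 *v f u = pencil B s1 *v u" if "u \<in> U" for u
    using h(3) BU[OF that, of s1] unfolding f_def image_U by blast
  obtain \<mu> u where u: "u \<in> U" "u \<notin> ?A" "f u - \<mu> *s u \<in> ?A"
    by (rule eigenvector_modulo[OF f U _ subspace_gker AltU]) (use h(1) in \<open>auto simp: f_def\<close>)
  \<comment> \<open>The eigenvalue as a projective point: \<open>pencil B a *v u\<close> is the
    image of \<open>f u - \<mu> *s u\<close> under \<open>pencil B s0\<close>, hence lies in the
    common image of \<open>gker B\<close>. Subtracting some \<open>v\<close> in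
    \<open>gker B\<close> from \<open>u\<close> gives a kernel vector at \<open>a\<close>.\<close>
  define a where "a = s1 + (- \<mu>) *s s0"
  have "det2 s0 a = 1" using s1 unfolding a_def det2_linear by simp
  then have a: "a \<noteq> 0" by (auto simp: det2_def)
  have "pencil B a *v u = pencil B s1 *v u - \<mu> *s (pencil B s0 *v u)"
    by (simp add: a_def pencil_mult vec_eq_iff algebra_simps)
  also have "\<dots> = pencil B s0 *v (f u - \<mu> *s u)"
    using Bf[OF u(1)] by (simp add: matrix_vector_mult_diff_distrib vector_scalar_commute)
  finally have "pencil B a *v u \<in> (*v) (pencil B a) ` ?A"
    using gker_image_subset[OF a, of B s0] u(3) by auto
  then obtain v where v: "v \<in> ?A" "pencil B a *v u = pencil B a *v v" by auto
  show ?thesis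
  proof (rule that[of a "u - v" D])
    show "u - v \<notin> ?A"
    proof
      assume "u - v \<in> ?A"
      from vec.subspace_add[OF subspace_gker this v(1)] show False using u(2) by simp
    qed
    show "u - v \<in> kern (pencil B a)" using v(2) by (simp add: matrix_vector_mult_diff_distrib)
    show "pencil B s *v (u - v) \<in> ann D" for s
      by (rule BU) (use u(1) v(1) AU U in \<open>auto intro: vec.subspace_diff\<close>)
    show "d \<le> vec.dim (D \<inter> ?K i)" if i: "i < m" for i
    proof -
      have "vec.span ((?K i \<inter> ?A') \<union> F i) \<subseteq> D \<inter> ?K i"
        using D F(3)[OF i] i by (intro vec.span_minimal vec.subspace_inter) auto
      from vec.dim_subset[OF this] show ?thesis using F(4)[OF i] by simp
    qed
  qed (use a D in auto)
qed

text \<open>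
  Away from \<open>a\<close> the perturbed pencil is the old one composed with a shear along \<open>u\<close>, so ranks
  do not change there. The shear drags the generic kernel towards \<open>u\<close>, which merges the
  eigenvector \<open>u\<close> into \<open>gker\<close>.
\<close>

lemma perturb_enlarge_kernel:
  fixes B :: "complex^'n^'n^2"
  assumes gpos: "gnull B > 0" and e: "e > 0" and a: "a \<noteq> 0"
    and u: "u \<notin> gker B" "u \<in> kern (pencil B a)"
    and D: "\<And>s. pencil B s *v u \<in> ann D" "gker (transpose_pencil B) \<subseteq> D"
  obtains B' where "dist B' B < e"
    "\<And>s. D \<inter> kern (transpose (pencil B s)) \<subseteq> kern (transpose (pencil B' s))"
    "gnull B' < gnull B \<or> gnull B' = gnull B \<and> vec.dim (gker B) < vec.dim (gker B') \<and>
      vec.dim (gker (transpose_pencil B)) \<le> vec.dim (gker (transpose_pencil B'))"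
proof -
  obtain q where q: "det2 a q = 1" using det2_complement[OF a] .
  define x where "x = pencil B q *v u"
  have Bu: "pencil B s *v u = det2 a s *s x" for s
    using pencil_interpolation[of a q B s u] q u(2) by (simp add: x_def)
  have xD: "x \<in> ann D" using D(1) by (simp add: x_def)
  \<comment> \<open>A kernel vector at \<open>a\<close> outside \<open>gker B\<close> shows that
    \<open>a\<close> is not generic; so \<open>det2 a\<close> can be divided by at generic
    points.\<close>
  have da: "det2 a s \<noteq> 0" if s: "s \<in> generic B" for s
  proof
    assume 0: "det2 a s = 0"
    have "a \<in> generic B"
    proof (cases "s = 0")
      case True
      then have "kern (pencil B r) = kern (pencil B s)" for r
        using generic_zero[of B] s by auto
      from this[of a] show ?thesis using s unfolding generic_def nullity_def by simp
    next
      case False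
      show ?thesis by (rule generic_proportional[OF s False a 0])
    qed
    then show False using u kern_subset_gker by blast
  qed
  obtain S V v where lim: "\<And>n. S n \<in> generic B" "S \<longlonglongrightarrow> a"
      "\<And>n. V n \<in> kern (pencil B (S n))" "V \<longlonglongrightarrow> v" "v \<noteq> 0"
    by (rule limit_kernel_vector[OF gpos, of a]) (rule that; assumption)
  have vA: "v \<in> gker B"
  proof (rule ccontr)
    assume "v \<notin> gker B"
    then obtain z where z: "\<And>w. w \<in> gker B \<Longrightarrow> z \<odot> w = 0" "z \<odot> v \<noteq> 0"
      using separating_functional[OF subspace_gker] by blast
    have "z \<odot> V n = 0" for n
      using z(1) kern_subset_gker[OF lim(1)] lim(3) by blast
    then have "(\<lambda>n. 0) \<longlonglongrightarrow> z \<odot> v" using tendsto_sp[OF lim(4), of z] by simp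
    then show False using z(2) LIMSEQ_const_iff by metis
  qed
  have "v \<notin> vec.span {u}"
  proof
    assume "v \<in> vec.span {u}"
    then obtain c where c: "v = c *s u" by (auto simp: vec.span_singleton)
    then have "c \<noteq> 0" using lim(5) by auto
    then have "u = (1 / c) *s v" unfolding c vector_smult_assoc by simp
    then show False using vec.subspace_scale[OF subspace_gker vA] u(1) by simp
  qed
  \<comment> \<open>Since \<open>y\<close> kills \<open>u\<close>, a shear along \<open>u\<close> is
    inverted by changing its sign; since \<open>y\<close> does not kill the limit \<open>v\<close>,
    the shear acts on generic kernel vectors close to \<open>a\<close>.\<close>
  then obtain y where y: "\<And>w. w \<in> vec.span {u} \<Longrightarrow> y \<odot> w = 0" "y \<odot> v \<noteq> 0"
    using separating_functional[OF vec.subspace_span] by blast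
  have yu: "y \<odot> u = 0" by (rule y(1)) (simp add: vec.span_base)
  obtain t where t: "t \<noteq> 0" "dist (rank1_perturb B q (t *s x) y) B < e"
    using rank1_perturb_small[OF e] .
  define B' where "B' = rank1_perturb B q (t *s x) y"
  have B': "pencil B' s *v w = pencil B s *v w + (y \<odot> w * det2 q s * t) *s x" for s w
    by (simp add: B'_def pencil_rank1_perturb matrix_vector_mult_add_rdistrib vector_smult_assoc mult_ac)
  have B'T: "transpose (pencil B' s) *v w = transpose (pencil B s) *v w + (x \<odot> w * det2 q s * t) *s y" for s w
    by (simp add: B'_def pencil_rank1_perturb matrix_vector_mult_add_rdistrib vector_smult_assoc mult_ac)
  \<comment> \<open>The shear coefficient has a pole at \<open>a\<close>: this is what drags kernel
    vectors near \<open>a\<close> towards \<open>u\<close>.\<close>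
  define c where "c s = t * det2 q s / det2 a s" for s
  have shear: "pencil B' s *v w = pencil B s *v (w + (c s * (y \<odot> w)) *s u)" if "det2 a s \<noteq> 0" for s w
    using that by (simp add: B' matrix_vector_right_distrib vector_scalar_commute Bu c_def vector_smult_assoc mult_ac)
  have kernB': "w - (c s * (y \<odot> w)) *s u \<in> kern (pencil B' s)"
    if s: "s \<in> generic B" and w: "w \<in> kern (pencil B s)" for s w
    using w yu by (simp add: shear[OF da[OF s]])
  have null: "nullity (pencil B' s) \<le> gnull B" if s: "s \<in> generic B" for s
  proof -
    let ?M = "mat 1 + outer (c s *s u) y"
    let ?L = "mat 1 - outer (c s *s u) y"
    have "w \<in> (*v) ?L ` kern (pencil B s)" if "w \<in> kern (pencil B' s)" for w
    proof -
      have "?M *v w = w + (c s * (y \<odot> w)) *s u"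
        by (simp add: matrix_vector_mult_add_rdistrib vector_smult_assoc mult.commute)
      then have "?M *v w \<in> kern (pencil B s)" using that by (simp add: shear[OF da[OF s]])
      moreover have "w = ?L *v (?M *v w)"
        using yu by (simp add: matrix_vector_mult_add_rdistrib matrix_vector_mult_diff_rdistrib)
      ultimately show ?thesis by blast
    qed
    then have "vec.dim (kern (pencil B' s)) \<le> vec.dim ((*v) ?L ` kern (pencil B s))"
      by (intro vec.dim_subset) auto
    also have "\<dots> \<le> vec.dim (kern (pencil B s))"
      by (rule vec.dim_image_le[OF matrix_vector_mul_linear_gen])
    finally show ?thesis using dim_kern_generic[OF s] by (simp add: nullity_def)
  qed
  \<comment> \<open>On \<open>D\<close> the vector \<open>x\<close> pairs to zero, so left kernel
    vectors in \<open>D\<close> survive the perturbation.\<close>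
  have kernT: "D \<inter> kern (transpose (pencil B s)) \<subseteq> kern (transpose (pencil B' s))" for s
    using xD by (auto simp: B'T ann_def sp_commute)
  have "gnull B' < gnull B \<or> gnull B' = gnull B \<and> vec.dim (gker B) < vec.dim (gker B') \<and>
      vec.dim (gker (transpose_pencil B)) \<le> vec.dim (gker (transpose_pencil B'))"
  proof (cases "gnull B' < gnull B")
    case False
    obtain s0 where s0: "s0 \<in> generic B" "s0 \<noteq> 0" by (rule generic_exists)
    then have eq: "gnull B' = gnull B" using False null[OF s0(1)] gnull_le[of B' s0] by simp
    have gen: "s \<in> generic B'" if "s \<in> generic B" for s
      using null[OF that] gnull_le[of B' s] eq by (simp add: generic_def)
    have "gker (transpose_pencil B) \<subseteq> gker (transpose_pencil B')"
      unfolding gker_def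
    proof (rule vec.span_mono, clarify)
      fix s w assume s: "s \<in> generic (transpose_pencil B)" and w: "w \<in> kern (pencil (transpose_pencil B) s)"
      then have "w \<in> D" using D(2) kern_subset_gker by blast
      then have "w \<in> kern (transpose (pencil B' s))" using kernT[of s] w by auto
      then show "w \<in> (\<Union>s\<in>generic (transpose_pencil B'). kern (pencil (transpose_pencil B') s))"
        using gen s by auto
    qed
    then have 1: "vec.dim (gker (transpose_pencil B)) \<le> vec.dim (gker (transpose_pencil B'))"
      by (rule vec.dim_subset)
    have kg: "w - (c s * (y \<odot> w)) *s u \<in> gker B'" if "s \<in> generic B" "w \<in> kern (pencil B s)" for s w
      using kernB'[OF that] kern_subset_gker[OF gen[OF that(1)]] by blast
    have ug: "u \<in> gker B'"
    proof (rule ccontr)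
      assume "u \<notin> gker B'"
      then obtain z where z: "\<And>w. w \<in> gker B' \<Longrightarrow> z \<odot> w = 0" "z \<odot> u \<noteq> 0"
        using separating_functional[OF subspace_gker] by blast
      \<comment> \<open>Multiplication by \<open>det2 a\<close> clears the pole. In the limit the
        left side vanishes, while the right side does not, as \<open>det2 q a = -1\<close>.\<close>
      have eqn: "det2 a (S n) * (z \<odot> V n) = t * det2 q (S n) * (y \<odot> V n) * (z \<odot> u)" for n
      proof -
        have "z \<odot> (V n - (c (S n) * (y \<odot> V n)) *s u) = 0" by (rule z(1)[OF kg[OF lim(1,3)]])
        then have "z \<odot> V n = c (S n) * (y \<odot> V n) * (z \<odot> u)" by simp
        then show ?thesis using da[OF lim(1)[of n]] by (simp add: c_def)
      qed
      have "(\<lambda>n. det2 a (S n) * (z \<odot> V n)) \<longlonglongrightarrow> det2 a a * (z \<odot> v)"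
        unfolding det2_def by (intro tendsto_intros lim)
      moreover have "(\<lambda>n. t * det2 q (S n) * (y \<odot> V n) * (z \<odot> u)) \<longlonglongrightarrow> t * det2 q a * (y \<odot> v) * (z \<odot> u)"
        unfolding det2_def by (intro tendsto_intros lim)
      ultimately have "det2 a a * (z \<odot> v) = t * det2 q a * (y \<odot> v) * (z \<odot> u)"
        unfolding eqn by (rule LIMSEQ_unique)
      then show False using t(1) y(2) z(2) q det2_swap[of a q] by simp
    qed
    have "gker B \<subseteq> gker B'"
      unfolding gker_def[of B]
    proof (rule vec.span_minimal, clarify)
      fix s w assume "s \<in> generic B" "w \<in> kern (pencil B s)"
      from vec.subspace_add[OF subspace_gker kg[OF this] vec.subspace_scale[OF subspace_gker ug]]
      show "w \<in> gker B'" by (metis diff_add_cancel)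
    qed simp
    then have "gker B \<subset> gker B'" using ug u(1) by blast
    then have "vec.dim (gker B) < vec.dim (gker B')"
      by (intro vec.dim_psubset) (simp add: vec.span_eq_iff[THEN iffD2])
    then show ?thesis using eq 1 by simp
  qed simp
  then show ?thesis using that[of B'] t(2) kernT by (simp add: B'_def)
qed

section \<open>Density of regular pencils\<close>

text \<open>Unless \<open>k = m - 1\<close> already works, the largest \<open>k\<close> with
  \<open>k g < a\<close> gives \<open>a \<le> (k + 1) g\<close>, hence
  \<open>a' \<ge> (m - k) g > (m - 1 - k) g\<close>. The two multipliers add up to
  \<open>m - 1\<close> because at one point the linear coefficient vanishes.\<close>

lemma balanced_split:
  fixes a a' g m :: nat
  assumes "0 < g" "0 < a" "0 < a'" "0 < m" "(m + 1) * g \<le> a + a'"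
  obtains k where "k < m" "k * g < a" "(m - 1 - k) * g < a'"
proof (cases "(m - 1) * g < a")
  case True
  then show ?thesis using assms by (intro that[of "m - 1"]) auto
next
  case False
  define k where "k = (a - 1) div g"
  have 1: "k * g \<le> a - 1" unfolding k_def by (rule div_times_less_eq_dividend)
  have 2: "a - 1 < (k + 1) * g"
    using dividend_less_div_times[of g "a - 1"] assms(1) by (simp add: k_def add.commute)
  have "k * g < (m - 1) * g" using 1 False assms(2) by linarith
  then have k: "k < m - 1" by simp
  have "(m + 1) * g = ((m - 1 - k) + (k + 1) + 1) * g"
    by (rule arg_cong[of _ _ "\<lambda>n. n * g"]) (use k in simp)
  also have "\<dots> = (m - 1 - k) * g + (k + 1) * g + g"
    unfolding add_mult_distrib by simp
  finally have "(m + 1) * g = (m - 1 - k) * g + (k + 1) * g + g" .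
  then have "(m - 1 - k) * g < a'" using 2 assms by linarith
  then show ?thesis using 1 k assms(2) by (intro that[of k]) auto
qed

lemma perturbation_step:
  fixes B :: "complex^'n^'n^2"
  assumes N: "CARD('n) = m * d"
    and p: "\<And>i. i < m \<Longrightarrow> p i \<noteq> 0"
      "\<And>i j. i < m \<Longrightarrow> j < m \<Longrightarrow> i \<noteq> j \<Longrightarrow> det2 (p i) (p j) \<noteq> 0"
    and B: "\<And>i. i < m \<Longrightarrow> d \<le> nullity (pencil B (p i))"
    and gpos: "gnull B > 0" and e: "e > 0"
  obtains B' where "dist B' B < e" "\<And>i. i < m \<Longrightarrow> d \<le> nullity (pencil B' (p i))"
    "gnull B' < gnull B \<or> gnull B' = gnull B \<and>
      vec.dim (gker B) + vec.dim (gker (transpose_pencil B))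
      < vec.dim (gker B') + vec.dim (gker (transpose_pencil B'))"
proof -
  have "0 < CARD('n)" by simp
  then have m: "0 < m" unfolding N by simp
  have dim_pos: "0 < vec.dim (gker C)" if "gnull C > 0" for C :: "complex^'n^'n^2"
  proof -
    obtain s where "s \<in> generic C" by (rule generic_exists)
    then have "gnull C \<le> vec.dim (gker C)"
      using vec.dim_subset[OF kern_subset_gker, of s C] dim_kern_generic[of s C] by simp
    then show ?thesis using that by simp
  qed
  \<comment> \<open>\<open>d < gnull B\<close> is treated apart because the eigenvector construction
    fits \<open>gnull B\<close> dimensions of generic left kernel into \<open>d\<close> dimensions
    at each point.\<close>
  consider "d < gnull B"
    | "(m + 1) * gnull B \<le> vec.dim (gker B) + vec.dim (gker (transpose_pencil B))"
    | "gnull B \<le> d" "vec.dim (gker B) + vec.dim (gker (transpose_pencil B)) < (m + 1) * gnull B"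
    by linarith
  then show ?thesis
  proof cases
    case 1
    obtain B' where "dist B' B < e" "\<And>s. d \<le> nullity (pencil B' s)" "gnull B' < gnull B"
      by (rule perturb_raise_rank_excess[OF 1 e]) (rule that; assumption)
    then show ?thesis using that[of B'] by simp
  next
    case 2
    obtain k where k: "k < m" "k * gnull B < vec.dim (gker B)"
      "(m - 1 - k) * gnull B < vec.dim (gker (transpose_pencil B))"
      by (rule balanced_split[OF gpos _ _ m 2]) (use dim_pos gpos in auto)
    obtain B' where "dist B' B < e" "\<And>i. i < m \<Longrightarrow> d \<le> nullity (pencil B' (p i))"
      "gnull B' < gnull B"
      by (rule perturb_raise_rank[where p = p and B = B, OF _ _ _ k e], erule p(1),
          erule (2) p(2), erule B) (rule that; assumption)
    then show ?thesis using that[of B'] by simp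
  next
    case 3
    obtain a u D where au: "a \<noteq> 0" "u \<notin> gker B" "u \<in> kern (pencil B a)"
      and D: "\<And>s. pencil B s *v u \<in> ann D" "gker (transpose_pencil B) \<subseteq> D"
        "\<And>i. i < m \<Longrightarrow> d \<le> vec.dim (D \<inter> kern (transpose (pencil B (p i))))"
      by (rule free_eigenvector[where p = p and B = B, OF N _ _ 3], erule p(1), erule B)
        (rule that; assumption)
    obtain B' where B': "dist B' B < e"
      "\<And>s. D \<inter> kern (transpose (pencil B s)) \<subseteq> kern (transpose (pencil B' s))"
      "gnull B' < gnull B \<or> gnull B' = gnull B \<and> vec.dim (gker B) < vec.dim (gker B') \<and>
        vec.dim (gker (transpose_pencil B)) \<le> vec.dim (gker (transpose_pencil B'))"
      by (rule perturb_enlarge_kernel[OF gpos e au D(1,2)]) (rule that; assumption)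
    have "d \<le> nullity (pencil B' (p i))" if i: "i < m" for i
    proof -
      have "d \<le> nullity (transpose (pencil B' (p i)))"
        using D(3)[OF i] vec.dim_subset[OF B'(2)[of "p i"]] by (simp add: nullity_def)
      then show ?thesis by (simp only: nullity_transpose)
    qed
    then show ?thesis using that[of B'] B'(1,3) by fastforce
  qed
qed

theorem regular_pencils_dense:
  fixes B :: "complex^'n^'n^2"
  assumes N: "CARD('n) = m * d"
    and p: "\<And>i. i < m \<Longrightarrow> p i \<noteq> 0"
      "\<And>i j. i < m \<Longrightarrow> j < m \<Longrightarrow> i \<noteq> j \<Longrightarrow> det2 (p i) (p j) \<noteq> 0"
    and B: "\<And>i. i < m \<Longrightarrow> d \<le> nullity (pencil B (p i))"
  shows "B \<in> closure {B. gnull B = 0 \<and> (\<forall>i<m. d \<le> nullity (pencil B (p i)))}"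
proof -
  \<comment> \<open>Lexicographic order packed into one number: first the generic nullity, then the
    deficit of \<open>a + a'\<close>. Both dimensions are at most \<open>CARD('n)\<close>, so the
    deficit stays below the weight \<open>2 * CARD('n) + 1\<close>.\<close>
  define \<mu> where "\<mu> C = gnull C * (2 * CARD('n) + 1) +
      (2 * CARD('n) - (vec.dim (gker C) + vec.dim (gker (transpose_pencil C))))"
    for C :: "complex^'n^'n^2"
  have "\<exists>B'. dist B' B < e \<and> gnull B' = 0 \<and> (\<forall>i<m. d \<le> nullity (pencil B' (p i)))"
    if "e > 0" "\<forall>i<m. d \<le> nullity (pencil B (p i))" for e :: real and B :: "complex^'n^'n^2"
    using that
  proof (induction "\<mu> B" arbitrary: B e rule: less_induct)
    case less
    show ?case
    proof (cases "gnull B = 0")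
      case True
      then show ?thesis using less.prems by (intro exI[of _ B]) simp
    next
      case False
      then have gpos: "gnull B > 0" by simp
      have e2: "e / 2 > 0" using less.prems by simp
      have adm: "d \<le> nullity (pencil B (p i))" if "i < m" for i using less.prems(2) that by blast
      obtain B1 where B1: "dist B1 B < e / 2" "\<And>i. i < m \<Longrightarrow> d \<le> nullity (pencil B1 (p i))"
        "gnull B1 < gnull B \<or> gnull B1 = gnull B \<and>
          vec.dim (gker B) + vec.dim (gker (transpose_pencil B))
          < vec.dim (gker B1) + vec.dim (gker (transpose_pencil B1))"
        by (rule perturbation_step[where p = p and B = B, OF N _ _ _ gpos e2], erule p(1),
            erule (2) p(2), erule adm) (rule that; assumption)
      have dims: "vec.dim (gker C) \<le> CARD('n)" for C :: "complex^'n^'n^2"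
        by (rule dim_subset_UNIV_cart_gen)
      have "\<mu> B1 < \<mu> B"
      proof (cases "gnull B1 < gnull B")
        case True
        then have "(gnull B1 + 1) * (2 * CARD('n) + 1) \<le> gnull B * (2 * CARD('n) + 1)"
          by (intro mult_right_mono) auto
        moreover have "\<mu> B1 < (gnull B1 + 1) * (2 * CARD('n) + 1)" unfolding \<mu>_def by simp
        moreover have "gnull B * (2 * CARD('n) + 1) \<le> \<mu> B" unfolding \<mu>_def by simp
        ultimately show ?thesis by linarith
      next
        case False
        then have eq: "gnull B1 = gnull B" using B1(3) by simp
        show ?thesis
          using False B1(3) dims[of B1] dims[of "transpose_pencil B1"] unfolding \<mu>_def eq by linarith
      qed
      from less.hyps[OF this e2] B1(2) obtain B' where
        B': "dist B' B1 < e / 2" "gnull B' = 0" "\<forall>i<m. d \<le> nullity (pencil B' (p i))" by blast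
      have "dist B' B < e" using dist_triangle_half_l[of B' B1 e B] B'(1) B1(1) by (simp add: dist_commute)
      then show ?thesis using B' by blast
    qed
  qed
  then show ?thesis using B unfolding closure_approachable by blast
qed

section \<open>Diagonalization of regular pencils\<close>

lemma independent_family_in_kern:
  fixes M :: "complex^'n^'m"
  assumes "CARD('b::finite) \<le> nullity M"
  obtains u :: "'b::finite \<Rightarrow> complex^'n" where "\<And>b. u b \<in> kern M"
    "\<And>c. (\<Sum>b\<in>UNIV. c b *s u b) = 0 \<Longrightarrow> (\<forall>b. c b = 0)"
proof -
  obtain E where E: "E \<subseteq> kern M" "finite E" "vec.independent E" "card E = vec.dim (kern M)"
    using vec.basis_subspace_exists[OF subspace_kern] by metis
  have "CARD('b) \<le> card E" using assms E(4) by (simp add: nullity_def)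
  then obtain F where F: "F \<subseteq> E" "card F = CARD('b)"
    by (rule obtain_subset_with_card_n)
  have "finite F" using F(1) E(2) by (rule finite_subset)
  then obtain u where u: "bij_betw u (UNIV :: 'b set) F"
    using finite_same_card_bij[of "UNIV :: 'b set" F] F(2) by force
  have ind: "vec.independent F" using E(3) F(1) by (rule vec.independent_mono)
  show ?thesis
  proof (rule that[of u])
    show "u b \<in> kern M" for b using bij_betwE[OF u] F(1) E(1) by blast
    show "\<forall>b. c b = 0" if "(\<Sum>b\<in>UNIV. c b *s u b) = 0" for c
    proof -
      have inj: "inj u" using u by (simp add: bij_betw_def)
      have "(\<Sum>x\<in>F. c (inv u x) *s x) = (\<Sum>b\<in>UNIV. c b *s u b)"
        using sum.reindex_bij_betw[OF u, of "\<lambda>x. c (inv u x) *s x"] unfolding inv_f_f[OF inj] by (rule sym)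
      also have "\<dots> = 0" by (rule that)
      finally have 0: "(\<Sum>x\<in>F. c (inv u x) *s x) = 0" .
      have "\<forall>c. (\<Sum>x\<in>F. c x *s x) = 0 \<longrightarrow> (\<forall>x\<in>F. c x = 0)"
        using ind unfolding vec.independent_explicit by (rule conjunct2)
      from spec[OF this, of "\<lambda>x. c (inv u x)"] 0 have c0: "\<forall>x\<in>F. c (inv u x) = 0" by (rule mp)
      show ?thesis
      proof
        fix b
        have "u b \<in> F" using bij_betwE[OF u] by blast
        from bspec[OF c0 this] show "c b = 0" unfolding inv_f_f[OF inj] .
      qed
    qed
  qed
qed

text \<open>Here \<open>gker B\<close> is zero, so the kernels at the points \<open>P a\<close> are
  independent and, by count, vectors chosen from them form a basis \<open>M\<close>, with inverse
  \<open>V\<close>. The pencil multiplies each basis vector by its own linear form.\<close>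

lemma regular_pencil_diagonalizable:
  fixes B :: "complex^('a::finite \<times> 'b::finite)^('a \<times> 'b)^2" and P :: "'a \<Rightarrow> complex^2"
  assumes g: "gnull B = 0" and P: "\<And>a. P a \<noteq> 0" "\<And>a a'. a \<noteq> a' \<Longrightarrow> det2 (P a) (P a') \<noteq> 0"
    and B: "\<And>a. CARD('b) \<le> nullity (pencil B (P a))"
  obtains C V :: "complex^('a \<times> 'b)^('a \<times> 'b)" where
    "\<And>s i j. pencil B s $ i $ j = (\<Sum>a\<in>UNIV. \<Sum>b\<in>UNIV. C $ i $ (a, b) * det2 (P a) s * V $ (a, b) $ j)"
proof -
  have "\<forall>a. \<exists>u :: 'b \<Rightarrow> complex^('a \<times> 'b). (\<forall>b. u b \<in> kern (pencil B (P a))) \<and>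
      (\<forall>c. (\<Sum>b\<in>UNIV. c b *s u b) = 0 \<longrightarrow> (\<forall>b. c b = 0))"
  proof
    fix a
    obtain u :: "'b \<Rightarrow> complex^('a \<times> 'b)" where "\<And>b. u b \<in> kern (pencil B (P a))"
      "\<And>c. (\<Sum>b\<in>UNIV. c b *s u b) = 0 \<Longrightarrow> (\<forall>b. c b = 0)"
      by (rule independent_family_in_kern[OF B[of a]]) (rule that; assumption)
    then show "\<exists>u :: 'b \<Rightarrow> complex^('a \<times> 'b). (\<forall>b. u b \<in> kern (pencil B (P a))) \<and>
      (\<forall>c. (\<Sum>b\<in>UNIV. c b *s u b) = 0 \<longrightarrow> (\<forall>b. c b = 0))"
      by (intro exI[of _ u]) simp
  qed
  from choice[OF this] obtain u :: "'a \<Rightarrow> 'b \<Rightarrow> complex^('a \<times> 'b)" where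
    u: "\<And>a b. u a b \<in> kern (pencil B (P a))" "\<And>a c. (\<Sum>b\<in>UNIV. c b *s u a b) = 0 \<Longrightarrow> \<forall>b. c b = 0"
    by blast
  have gker0: "gker B \<subseteq> {0}"
    unfolding gker_def
  proof (rule vec.span_minimal)
    show "(\<Union>s\<in>generic B. kern (pencil B s)) \<subseteq> {0}"
    proof clarify
      fix s x assume "s \<in> generic B" "x \<in> kern (pencil B s)"
      then show "x = 0" using g nullity_pos[of "pencil B s"] by (auto simp: generic_def)
    qed
  qed (auto simp: vec.subspace_def)
  define M :: "complex^('a \<times> 'b)^('a \<times> 'b)" where "M = (\<chi> i q. u (fst q) (snd q) $ i)"
  have Mc: "M *v c = (\<Sum>a\<in>UNIV. \<Sum>b\<in>UNIV. c $ (a, b) *s u a b)" for c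
    by (simp add: M_def matrix_vector_mult_def vec_eq_iff UNIV_Times_UNIV[symmetric]
        sum.cartesian_product' mult.commute del: UNIV_Times_UNIV)
  have "c = 0" if c: "M *v c = 0" for c
  proof -
    let ?w = "\<lambda>a. \<Sum>b\<in>UNIV. c $ (a, b) *s u a b"
    have "?w a \<in> gker B" for a
    proof (rule kernels_independent[of UNIV P])
      show "?w a \<in> kern (pencil B (P a))" for a
        using u(1) by (intro vec.subspace_sum vec.subspace_scale subspace_kern) auto
      show "sum ?w UNIV \<in> gker B"
        using c vec.subspace_0[OF subspace_gker] by (simp add: Mc)
    qed (use P in auto)
    then have "?w a = 0" for a using subsetD[OF gker0] by simp
    from u(2)[OF this] show "c = 0" unfolding vec_eq_iff by (simp add: split_paired_all)
  qed
  then have "\<exists>V. V ** M = mat 1" unfolding matrix_left_invertible_ker by simp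
  then obtain V where "V ** M = mat 1" by (elim exE)
  then have MV: "M ** V = mat 1" by (simp only: matrix_left_right_inverse)
  have "\<forall>a. \<exists>q. det2 (P a) q = 1"
  proof
    fix a
    show "\<exists>q. det2 (P a) q = 1" by (rule det2_complement[OF P(1)[of a]]) (rule exI)
  qed
  from choice[OF this] obtain Q where "\<forall>a. det2 (P a) (Q a) = 1" by (elim exE)
  then have Q: "det2 (P a) (Q a) = 1" for a by simp
  \<comment> \<open>As \<open>det2 (P a) (Q a) = 1\<close>, column \<open>(a, b)\<close> is the
    coefficient vector of \<open>det2 (P a) s\<close> in \<open>pencil B s *v u a b\<close>.\<close>
  define C where "C = (\<chi> i q. (pencil B (Q (fst q)) *v u (fst q) (snd q)) $ i)"
  have Bu: "pencil B s *v u a b = det2 (P a) s *s (pencil B (Q a) *v u a b)" for s a b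
    using pencil_interpolation[of "P a" "Q a" B s "u a b"] Q[of a] u(1)[of a b] by simp
  have "pencil B s $ i $ j = (\<Sum>a\<in>UNIV. \<Sum>b\<in>UNIV. C $ i $ (a, b) * det2 (P a) s * V $ (a, b) $ j)"
    for s i j
  proof -
    have BM: "(pencil B s ** M) $ i $ (a, b) = C $ i $ (a, b) * det2 (P a) s" for a b
    proof -
      have "(pencil B s ** M) $ i $ (a, b) = (pencil B s *v u a b) $ i"
        by (simp add: matrix_matrix_mult_def matrix_vector_mult_def M_def)
      also have "\<dots> = det2 (P a) s * C $ i $ (a, b)"
        unfolding Bu[of s a b] by (simp add: C_def)
      finally show ?thesis by (simp only: mult.commute)
    qed
    have "pencil B s = (pencil B s ** M) ** V"
      by (simp add: matrix_mul_assoc[symmetric] MV)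
    then have "pencil B s $ i $ j = ((pencil B s ** M) ** V) $ i $ j" by (rule arg_cong)
    also have "\<dots> = (\<Sum>q\<in>UNIV. (pencil B s ** M) $ i $ q * V $ q $ j)"
      unfolding matrix_matrix_mult_def[of _ V] by simp
    also have "\<dots> = (\<Sum>a\<in>UNIV. \<Sum>b\<in>UNIV. (pencil B s ** M) $ i $ (a, b) * V $ (a, b) $ j)"
      by (simp add: UNIV_Times_UNIV[symmetric] sum.cartesian_product' del: UNIV_Times_UNIV)
    finally show ?thesis by (simp add: BM)
  qed
  then show ?thesis by (rule that)
qed

section \<open>Tensors whose line meets the determinantal variety\<close>

definition network ::
  "complex^('e01::finite \<times> 'e02::finite)^'n0 \<Rightarrow> complex^('e01 \<times> 'e12::finite)^'n1 \<Rightarrow>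
    complex^('e12 \<times> 'e02)^'n2 \<Rightarrow> complex^('n0::finite \<times> 'n1::finite \<times> 'n2::finite)"
  where "network X0 X1 X2 = (\<chi> x. \<Sum>a\<in>UNIV. \<Sum>b\<in>UNIV. \<Sum>c\<in>UNIV.
    X0 $ fst x $ (a, c) * X1 $ fst (snd x) $ (a, b) * X2 $ snd (snd x) $ (b, c))"

lemma matrix_mult_axis_tensor:
  fixes X :: "complex^('a::finite \<times> 'b::finite)^'n"
  shows "X *v (axis a 1 \<otimes>\<^sub>v axis b 1) = (\<chi> k. X $ k $ (a, b))"
proof -
  have "(axis a 1 \<otimes>\<^sub>v axis b 1 :: complex^('a \<times> 'b)) = axis (a, b) 1"
    by (auto simp: tensor_vec_def axis_def vec_eq_iff)
  then show ?thesis
    by (simp only:) (simp add: matrix_vector_mult_def axis_def vec_eq_iff mult_delta_right)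
qed

lemma tensor_map_triangle: "(X0 \<otimes>\<^sub>m X1 \<otimes>\<^sub>m X2) *v triangle_tensor = network X0 X1 X2"
  unfolding triangle_tensor_def vec.linear_sum[OF matrix_vector_mul_linear_gen]
  by (simp add: tensor_map_tensor_vec matrix_mult_axis_tensor network_def vec_eq_iff)
    (simp add: tensor_vec_def mult.assoc)

lemma triangle_TNS_network:
  "triangle_TNS TYPE('e01::finite) TYPE('e12::finite) TYPE('e02::finite) =
    closure {network X0 X1 X2 | (X0 :: complex^('e01 \<times> 'e02)^'n0::finite)
      (X1 :: complex^('e01 \<times> 'e12)^'n1::finite) (X2 :: complex^('e12 \<times> 'e02)^'n2::finite). True}"
  unfolding triangle_TNS_def tensor_map_triangle by simp

lemma flattening_nth: "flattening T \<alpha> $ x = \<alpha> $ 1 * T $ (1, x) + \<alpha> $ 2 * T $ (2, x)"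
  for T :: "complex^(2 \<times> 'n1::finite \<times> 'n2::finite)"
  by (simp add: flattening_def sum_2)

lemma flattening_linear: "Vector_Spaces.linear (*s) (*s) (flattening T)"
  for T :: "complex^(2 \<times> 'n1::finite \<times> 'n2::finite)"
  by unfold_locales (simp_all add: vec_eq_iff flattening_nth algebra_simps)

lemma det2_zero:
  assumes "det2 p s = 0" "p \<noteq> 0" obtains c where "s = c *s p"
proof -
  obtain q where q: "det2 p q = 1" using det2_complement[OF assms(2)] .
  have "det2 p q *s s = det2 s q *s p + det2 p s *s q"
    by (simp add: vec_eq_iff forall_2 det2_def algebra_simps)
  then have "s = det2 s q *s p" using q assms(1) by simp
  then show ?thesis by (rule that)
qed

lemma rank_scale_le: "rank (to_matrix (c *s w)) \<le> rank (to_matrix w)"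
proof -
  have "to_matrix (c *s w) *v u = c *s (to_matrix w *v u)" for u
    by (simp add: to_matrix_def matrix_vector_mult_def vec_eq_iff sum_distrib_left mult.assoc)
  then have "kern (to_matrix w) \<subseteq> kern (to_matrix (c *s w))" by auto
  from vec.dim_subset[OF this] show ?thesis
    using rank_nullity[of "to_matrix w"] rank_nullity[of "to_matrix (c *s w)"]
    unfolding nullity_def by linarith
qed

text \<open>A point of the intersection has a representative in the image and one of small rank,
  equal up to a scalar. Proportional functionals would represent the same point, so distinct points
  give nonzero \<open>det2\<close>.\<close>

lemma line_meets_sigma_points:
  fixes T :: "complex^(2 \<times> 'n1::finite \<times> 'n2::finite)"
  assumes "line_meets_sigma r m T"
  obtains p where "\<And>i. i < m \<Longrightarrow> p i \<noteq> 0"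
    "\<And>i j. i < m \<Longrightarrow> j < m \<Longrightarrow> i \<noteq> j \<Longrightarrow> det2 (p i) (p j) \<noteq> 0"
    "\<And>i. i < m \<Longrightarrow> rank (to_matrix (flattening T (p i))) \<le> r"
proof -
  obtain P where P: "P \<subseteq> projectivization (range (flattening T)) \<inter> sigma_variety r" "finite P" "m \<le> card P"
    using assms unfolding line_meets_sigma_def by blast
  obtain h where h: "bij_betw h {0..<card P} P" using ex_bij_betw_nat_finite[OF P(2)] by blast
  have hi: "h i \<in> projectivization (range (flattening T))" "h i \<in> sigma_variety r" if "i < m" for i
    using bij_betwE[OF h] that P(1,3) by auto
  have "\<forall>i\<in>{..<m}. \<exists>\<alpha>. h i = vec.span {flattening T \<alpha>} \<and> flattening T \<alpha> \<noteq> 0 \<and>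
      rank (to_matrix (flattening T \<alpha>)) \<le> r"
  proof
    fix i assume "i \<in> {..<m}"
    then have i: "i < m" by simp
    obtain \<alpha> where \<alpha>: "h i = vec.span {flattening T \<alpha>}" "flattening T \<alpha> \<noteq> 0"
      using hi(1)[OF i] unfolding projectivization_def by auto
    obtain w where w: "h i = vec.span {w}" "rank (to_matrix w) \<le> r"
      using hi(2)[OF i] unfolding sigma_variety_def projectivization_def by auto
    have "flattening T \<alpha> \<in> vec.span {w}" using \<alpha>(1) w(1) vec.span_base[of _ "{flattening T \<alpha>}"] by auto
    then obtain c where "flattening T \<alpha> = c *s w" by (auto simp: vec.span_singleton)
    then have "rank (to_matrix (flattening T \<alpha>)) \<le> r"
      using rank_scale_le[of c w] w(2) by simp
    then show "\<exists>\<alpha>. h i = vec.span {flattening T \<alpha>} \<and> flattening T \<alpha> \<noteq> 0 \<and>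
      rank (to_matrix (flattening T \<alpha>)) \<le> r" using \<alpha> by blast
  qed
  from bchoice[OF this] obtain p where p: "\<And>i. i < m \<Longrightarrow> h i = vec.span {flattening T (p i)}"
    "\<And>i. i < m \<Longrightarrow> flattening T (p i) \<noteq> 0"
    "\<And>i. i < m \<Longrightarrow> rank (to_matrix (flattening T (p i))) \<le> r" by auto
  have p0: "p i \<noteq> 0" if "i < m" for i
    using p(2)[OF that] vec.linear_0[OF flattening_linear[of T]] by auto
  have "det2 (p i) (p j) \<noteq> 0" if ij: "i < m" "j < m" "i \<noteq> j" for i j
  proof
    assume "det2 (p i) (p j) = 0"
    then obtain c where c: "p j = c *s p i" using det2_zero p0[OF ij(1)] by blast
    then have fc: "flattening T (p j) = c *s flattening T (p i)"
      using vec.linear_scale[OF flattening_linear[of T]] by simp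
    then have "c \<noteq> 0" using p(2)[OF ij(2)] by auto
    then have "vec.span {flattening T (p j)} = vec.span {flattening T (p i)}"
      using vec.span_image_scale[of "{flattening T (p i)}" "\<lambda>_. c"] fc by simp
    then have "h i = h j" using p(1) ij by simp
    moreover have "inj_on h {0..<card P}" using h by (simp add: bij_betw_def)
    ultimately show False using ij P(3) by (auto dest: inj_onD)
  qed
  then show ?thesis using that[of p] p0 p(3) by blast
qed

lemma pencil_axis: "pencil B (axis k 1) $ i $ j = B $ k $ i $ j"
  using exhaust_2[of k] by (auto simp: pencil_def axis_def)

lemma nullity_matrix_mult_ge:
  fixes M :: "complex^'n^'m" and L :: "complex^'w^'n"
  shows "CARD('w) \<le> nullity (M ** L) + rank M"
proof -
  have "range ((*v) (M ** L)) \<subseteq> range ((*v) M)"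
    by (auto simp: matrix_vector_mul_assoc[symmetric])
  then have "vec.dim (range ((*v) (M ** L))) \<le> vec.dim (range ((*v) M))" by (rule vec.dim_subset)
  then show ?thesis using rank_nullity[of "M ** L"] by (simp add: rank_eq_dim_range)
qed

text \<open>\<open>L\<close> reads off the coordinates in \<open>range h\<close>; the padded matrix
  kills everything that \<open>?M ** L\<close> kills.\<close>

lemma nullity_padded_pencil:
  fixes T :: "complex^(2 \<times> 'n1::finite \<times> 'n2::finite)" and B :: "complex^'w^'w^2"
    and f :: "'n1 \<Rightarrow> 'w" and h :: "'n2 \<Rightarrow> 'w"
  assumes f: "inj f" and h: "inj h"
    and B: "B = (\<chi> k i j. if i \<in> range f \<and> j \<in> range h then T $ (k, inv f i, inv h j) else 0)"
  shows "CARD('w) \<le> nullity (pencil B s) + rank (to_matrix (flattening T s))"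
proof -
  let ?M = "to_matrix (flattening T s)"
  define L :: "complex^'w^'n2" where "L = (\<chi> j i. if i = h j then 1 else 0)"
  have Lu: "(L *v u) $ j = u $ h j" for u j
    by (simp add: L_def matrix_vector_mult_def mult_delta_left)
  have "kern (?M ** L) \<subseteq> kern (pencil B s)"
  proof
    fix u assume u: "u \<in> kern (?M ** L)"
    have "(pencil B s *v u) $ i = 0" for i
    proof (cases "i \<in> range f")
      case False
      then show ?thesis by (simp add: pencil_def B matrix_vector_mult_def)
    next
      case True
      then obtain i' where i': "i = f i'" by auto
      have "(pencil B s *v u) $ i = (\<Sum>j\<in>range h. pencil B s $ i $ j * u $ j)"
        unfolding matrix_vector_mult_def
        by (simp, intro sum.mono_neutral_right) (auto simp: pencil_def B)
      also have "\<dots> = (\<Sum>j\<in>UNIV. pencil B s $ i $ h j * u $ h j)"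
        using h by (simp add: sum.reindex)
      also have "\<dots> = (\<Sum>j\<in>UNIV. ?M $ i' $ j * (L *v u) $ j)"
        using f h by (intro sum.cong) (simp_all add: pencil_def B i' to_matrix_def flattening_nth Lu)
      also have "\<dots> = (?M *v (L *v u)) $ i'" by (simp add: matrix_vector_mult_def)
      also have "\<dots> = 0" using u by (simp add: matrix_vector_mul_assoc)
      finally show ?thesis .
    qed
    then show "u \<in> kern (pencil B s)" by (simp add: vec_eq_iff)
  qed
  from vec.dim_subset[OF this] show ?thesis
    using nullity_matrix_mult_ge[of ?M L] unfolding nullity_def by linarith
qed

theorem line_meets_sigma_in_TNS:
  fixes m m12 :: nat and T :: "complex^(2 \<times> 'n1::finite \<times> 'n2::finite)"
  assumes m: "m \<ge> 1"
    and card: "CARD('e01::finite) = m" "CARD('e12::finite) = m12" "CARD('e02::finite) = m"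
      "CARD('n1) \<le> m12 * m" "CARD('n2) \<le> m12 * m"
    and T: "line_meets_sigma (m12 * (m - 1)) m T"
  shows "T \<in> triangle_TNS TYPE('e01) TYPE('e12) TYPE('e02)"
proof -
  let ?S = "{network X0 X1 X2 | (X0 :: complex^('e01 \<times> 'e02)^2)
      (X1 :: complex^('e01 \<times> 'e12)^'n1) (X2 :: complex^('e12 \<times> 'e02)^'n2). True}"
  have cardw: "CARD('e01 \<times> 'e12) = m * m12" using card by simp
  obtain f :: "'n1 \<Rightarrow> 'e01 \<times> 'e12" where f: "inj f"
    using card_le_inj[of "UNIV :: 'n1 set" "UNIV :: ('e01 \<times> 'e12) set"] card cardw
    by (auto simp: mult.commute)
  obtain h :: "'n2 \<Rightarrow> 'e01 \<times> 'e12" where h: "inj h"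
    using card_le_inj[of "UNIV :: 'n2 set" "UNIV :: ('e01 \<times> 'e12) set"] card cardw
    by (auto simp: mult.commute)
  obtain \<pi> :: "'e01 \<Rightarrow> 'e02" where \<pi>: "bij \<pi>"
    using finite_same_card_bij[of "UNIV :: 'e01 set" "UNIV :: 'e02 set"] card by auto
  obtain e :: "'e01 \<Rightarrow> nat" where e: "bij_betw e UNIV {..<m}"
    using finite_same_card_bij[of "UNIV :: 'e01 set" "{..<m}"] card by auto
  obtain p where p: "\<And>i. i < m \<Longrightarrow> p i \<noteq> 0"
    "\<And>i j. i < m \<Longrightarrow> j < m \<Longrightarrow> i \<noteq> j \<Longrightarrow> det2 (p i) (p j) \<noteq> 0"
    "\<And>i. i < m \<Longrightarrow> rank (to_matrix (flattening T (p i))) \<le> m12 * (m - 1)"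
    by (rule line_meets_sigma_points[OF T]) (rule that; assumption)
  \<comment> \<open>Indexing by \<open>'e01 \<times> 'e12\<close> prepares the bonds: after
    diagonalization \<open>a\<close> numbers the points and \<open>b\<close> the copies of each
    linear form.\<close>
  define B :: "complex^('e01 \<times> 'e12)^('e01 \<times> 'e12)^2"
    where "B = (\<chi> k i j. if i \<in> range f \<and> j \<in> range h then T $ (k, inv f i, inv h j) else 0)"
  let ?R = "{B :: complex^('e01 \<times> 'e12)^('e01 \<times> 'e12)^2.
    gnull B = 0 \<and> (\<forall>i<m. m12 \<le> nullity (pencil B (p i)))}"
  \<comment> \<open>Size \<open>m * m12\<close> minus the rank bound \<open>m12 * (m - 1)\<close>
    leaves nullity \<open>m12\<close>.\<close>
  have "m * m12 = m12 * (m - 1) + m12" using m by (cases m) auto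
  then have Bp: "m12 \<le> nullity (pencil B (p i))" if "i < m" for i
    using nullity_padded_pencil[OF f h B_def, of "p i"] p(3)[OF that] cardw by linarith
  have BR: "B \<in> closure ?R"
    by (rule regular_pencils_dense[where p = p and B = B, OF cardw], erule p(1), erule (2) p(2), erule Bp)
  \<comment> \<open>Cuts the padding off again. By continuity it is enough to treat regular
    pencils.\<close>
  define \<Phi> where "\<Phi> C = (\<chi> x. C $ fst x $ f (fst (snd x)) $ h (snd (snd x)))"
    for C :: "complex^('e01 \<times> 'e12)^('e01 \<times> 'e12)^2"
  have TB: "T = \<Phi> B" using f h by (simp add: \<Phi>_def B_def vec_eq_iff)
  have "\<Phi> ` ?R \<subseteq> ?S"
  proof clarify
    fix C :: "complex^('e01 \<times> 'e12)^('e01 \<times> 'e12)^2"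
    assume C: "gnull C = 0" "\<forall>i<m. m12 \<le> nullity (pencil C (p i))"
    have e_lt: "e a < m" for a using bij_betwE[OF e] by auto
    have e_inj: "inj e" using e by (simp add: bij_betw_def)
    have P: "p (e a) \<noteq> 0" "a \<noteq> a' \<Longrightarrow> det2 (p (e a)) (p (e a')) \<noteq> 0"
      "CARD('e12) \<le> nullity (pencil C (p (e a)))" for a a'
      using p(1)[OF e_lt] p(2)[OF e_lt e_lt] inj_eq[OF e_inj] C(2) e_lt card(2) by auto
    obtain D V :: "complex^('e01 \<times> 'e12)^('e01 \<times> 'e12)" where DV: "\<And>s i j. pencil C s $ i $ j =
        (\<Sum>a\<in>UNIV. \<Sum>b\<in>UNIV. D $ i $ (a, b) * det2 (p (e a)) s * V $ (a, b) $ j)"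
      by (rule regular_pencil_diagonalizable[where P = "\<lambda>a. p (e a)", OF C(1) P(1) _ P(3)],
          erule P(2)) (rule that; assumption)
    \<comment> \<open>Diagonal once the bonds \<open>01\<close> and \<open>02\<close> are identified
      by \<open>\<pi>\<close>; the diagonal entries are the coefficients of
      \<open>det2 (p (e a))\<close>.\<close>
    define X0 :: "complex^('e01 \<times> 'e02)^2"
      where "X0 = (\<chi> k x. if snd x = \<pi> (fst x) then det2 (p (e (fst x))) (axis k 1) else 0)"
    define X1 :: "complex^('e01 \<times> 'e12)^'n1" where "X1 = (\<chi> i x. D $ f i $ x)"
    define X2 :: "complex^('e12 \<times> 'e02)^'n2" where "X2 = (\<chi> j x. V $ (inv \<pi> (snd x), fst x) $ h j)"
    have "\<Phi> C $ (k, i, j) = network X0 X1 X2 $ (k, i, j)" for k i j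
    proof -
      have "inv \<pi> (\<pi> a) = a" for a using \<pi> by (simp add: bij_is_inj)
      then have "network X0 X1 X2 $ (k, i, j) = (\<Sum>a\<in>UNIV. \<Sum>b\<in>UNIV.
          det2 (p (e a)) (axis k 1) * D $ f i $ (a, b) * V $ (a, b) $ h j)"
        by (simp add: network_def X0_def X1_def X2_def mult_delta_left)
      also have "\<dots> = pencil C (axis k 1) $ f i $ h j"
        unfolding DV by (simp add: mult_ac)
      finally show ?thesis by (simp add: \<Phi>_def pencil_axis)
    qed
    then have "\<Phi> C = network X0 X1 X2" by (simp add: vec_eq_iff split_paired_all)
    then show "\<exists>(X0 :: complex^('e01 \<times> 'e02)^2) (X1 :: complex^('e01 \<times> 'e12)^'n1)
        (X2 :: complex^('e12 \<times> 'e02)^'n2). \<Phi> C = network X0 X1 X2 \<and> True"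
      by blast
  qed
  then have "\<Phi> ` ?R \<subseteq> closure ?S" using closure_subset by blast
  moreover have "continuous_on (closure ?R) \<Phi>" unfolding \<Phi>_def by (intro continuous_intros)
  ultimately have "\<Phi> ` closure ?R \<subseteq> closure ?S"
    by (intro image_closure_subset) auto
  then have "T \<in> closure ?S" using BR TB by blast
  then show ?thesis unfolding triangle_TNS_network .
qed

section \<open>Generic networks\<close>

text \<open>Triangularization: an eigenvector modulo the span so far extends the flag, and the
  \<open>\<mu> i\<close> are the diagonal entries.\<close>

lemma invariant_flag:
  fixes f :: "complex^'n \<Rightarrow> complex^'n"
  assumes f: "Vector_Spaces.linear (*s) (*s) f" and k: "k \<le> CARD('n)"
  shows "\<exists>v \<mu>. \<forall>i<k. v i \<notin> vec.span (v ` {..<i}) \<and> f (v i) - \<mu> i *s v i \<in> vec.span (v ` {..<i})"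
  using k
proof (induction k)
  case (Suc k)
  then obtain v \<mu> where v: "\<And>i. i < k \<Longrightarrow> v i \<notin> vec.span (v ` {..<i})"
    "\<And>i. i < k \<Longrightarrow> f (v i) - \<mu> i *s v i \<in> vec.span (v ` {..<i})" by auto
  let ?A = "vec.span (v ` {..<k})"
  have fA: "f u \<in> ?A" if "u \<in> ?A" for u
  proof -
    have "?A \<subseteq> {u. f u \<in> ?A}"
    proof (rule vec.span_minimal)
      show "vec.subspace {u. f u \<in> ?A}"
        using vec.linear_subspace_vimage[OF f vec.subspace_span] by (simp add: vimage_def)
      show "v ` {..<k} \<subseteq> {u. f u \<in> ?A}"
      proof clarify
        fix i assume i: "i < k"
        have "vec.span (v ` {..<i}) \<subseteq> ?A" using i by (intro vec.span_mono image_mono) auto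
        then have "f (v i) - \<mu> i *s v i \<in> ?A" using v(2)[OF i] by blast
        moreover have "\<mu> i *s v i \<in> ?A" using i by (intro vec.span_scale vec.span_base) auto
        ultimately have "f (v i) - \<mu> i *s v i + \<mu> i *s v i \<in> ?A" by (rule vec.span_add)
        then show "f (v i) \<in> ?A" by simp
      qed
    qed
    then show ?thesis using that by blast
  qed
  have "vec.dim ?A \<le> card (v ` {..<k})"
    unfolding vec.dim_span by (intro vec.dim_le_card vec.span_superset) simp
  also have "\<dots> \<le> k" using card_image_le[of "{..<k}" v] by simp
  finally have "vec.dim ?A < CARD('n)" using Suc.prems by simp
  then have "?A \<noteq> UNIV" using vec_dim_card by (metis less_irrefl)
  then have "?A \<subset> UNIV" by blast
  then obtain \<nu> u where u: "u \<notin> ?A" "f u - \<nu> *s u \<in> ?A"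
    by (rule eigenvector_modulo[OF f vec.subspace_UNIV UNIV_I vec.subspace_span]) (rule that)
  have im: "(v(k := u)) ` {..<i} = v ` {..<i}" if "i \<le> k" for i using that by (intro image_cong) auto
  have "(v(k := u)) i \<notin> vec.span ((v(k := u)) ` {..<i}) \<and>
    f ((v(k := u)) i) - (\<mu>(k := \<nu>)) i *s (v(k := u)) i \<in> vec.span ((v(k := u)) ` {..<i})"
    if "i < Suc k" for i
    using v u that im[of i] by (cases "i = k") auto
  then show ?case by blast
qed simp

text \<open>The span of the vectors up to \<open>v i\<close> is mapped into a space of smaller
  dimension.\<close>

lemma singular_from_flag:
  fixes v :: "nat \<Rightarrow> complex^'n" and M :: "complex^'n^'n"
  assumes v: "\<And>j. j \<le> i \<Longrightarrow> v j \<notin> vec.span (v ` {..<j})"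
    and M: "\<And>j. j \<le> i \<Longrightarrow> M *v v j \<in> vec.span (v ` {..<i})"
  shows "nullity M > 0"
proof -
  let ?S = "vec.span (v ` {..i})" and ?A = "vec.span (v ` {..<i})"
  have "(*v) M ` ?S \<subseteq> ?A"
  proof -
    have "?S \<subseteq> {u. M *v u \<in> ?A}"
    proof (rule vec.span_minimal)
      show "vec.subspace {u. M *v u \<in> ?A}"
        using vec.linear_subspace_vimage[OF matrix_vector_mul_linear_gen vec.subspace_span]
        by (simp add: vimage_def)
    qed (use M in auto)
    then show ?thesis by auto
  qed
  then have 1: "vec.dim ((*v) M ` ?S) \<le> vec.dim ?A" by (rule vec.dim_subset)
  have "?A \<subset> ?S"
  proof -
    have "?A \<subseteq> ?S" by (intro vec.span_mono image_mono) auto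
    moreover have "v i \<in> ?S" by (intro vec.span_base) auto
    ultimately show ?thesis using v[of i] by blast
  qed
  then have 2: "vec.dim ?A < vec.dim ?S" by (intro vec.dim_psubset) (simp only: vec.span_span)
  have "vec.dim ((*v) M ` ?S) + vec.dim (?S \<inter> kern M) = vec.dim ?S"
    by (rule dim_image_kern) simp
  then have "vec.dim (?S \<inter> kern M) > 0" using 1 2 by linarith
  moreover have "vec.dim (?S \<inter> kern M) \<le> nullity M" unfolding nullity_def by (intro vec.dim_subset) auto
  ultimately show ?thesis by linarith
qed

text \<open>In a basis triangularizing \<open>A\<close>, let \<open>D\<close> be diagonal with
  entries \<open>0, 1, 2, ...\<close>. The path is then triangular with eigenvalues
  \<open>\<mu> i + t * of_nat i\<close>; \<open>F\<close> collects the finitely many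
  \<open>t\<close> at which two of them coincide.\<close>

lemma distinct_eigenvalue_direction:
  fixes A :: "complex^'n^'n"
  obtains D :: "complex^'n^'n" and F :: "complex set" where "finite F"
    "\<And>t. t \<notin> F \<Longrightarrow> \<exists>\<nu>. inj_on \<nu> {..<CARD('n)} \<and>
      (\<forall>i<CARD('n). nullity (affine_path A D t - mat (\<nu> i)) > 0)"
proof -
  let ?n = "CARD('n)"
  obtain v \<mu> where v: "\<And>i. i < ?n \<Longrightarrow> v i \<notin> vec.span (v ` {..<i})"
    "\<And>i. i < ?n \<Longrightarrow> A *v v i - \<mu> i *s v i \<in> vec.span (v ` {..<i})"
    using invariant_flag[OF matrix_vector_mul_linear_gen[of A] order_refl] by blast
  have ind: "vec.independent (v ` {..<k})" if "k \<le> ?n" for k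
    using that
  proof (induction k)
    case (Suc k)
    then show ?case using v(1)[of k] by (simp add: lessThan_Suc vec.independent_insertI)
  qed (simp add: vec.independent_empty)
  have neq: "v i \<noteq> v j" if "i < j" "j < ?n" for i j
    using v(1)[OF that(2)] vec.span_base[of "v i" "v ` {..<j}"] that(1) by auto
  have inj: "inj_on v {..<?n}"
    by (rule linorder_inj_onI) (use neq in auto)
  obtain d where d: "Vector_Spaces.linear (*s) (*s) d"
    "\<forall>x\<in>v ` {..<?n}. d x = of_nat (the_inv_into {..<?n} v x) *s x"
    using vec.linear_independent_extend[OF ind[OF order_refl],
        of "\<lambda>x. of_nat (the_inv_into {..<?n} v x) *s x"] by blast
  define D where "D = matrix d"
  have Dv: "D *v v i = of_nat i *s v i" if "i < ?n" for i
    using d that the_inv_into_f_f[OF inj, of i] by (simp add: D_def matrix_works)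
  have path: "affine_path A D t *v x = A *v x + t *s (D *v x)" for t x
    by (simp add: affine_path_def matrix_vector_mult_def vec_eq_iff algebra_simps sum.distrib sum_distrib_left)
  define F where "F = (\<Union>i<?n. \<Union>j\<in>{..<?n} - {i}. {(\<mu> j - \<mu> i) / (of_nat i - of_nat j)})"
  show ?thesis
  proof (rule that[of F D])
    show "finite F" by (simp add: F_def)
    show "\<exists>\<nu>. inj_on \<nu> {..<?n} \<and> (\<forall>i<?n. nullity (affine_path A D t - mat (\<nu> i)) > 0)" if t: "t \<notin> F" for t
    proof (intro exI[of _ "\<lambda>i. \<mu> i + t * of_nat i"] conjI allI impI)
      show "inj_on (\<lambda>i. \<mu> i + t * of_nat i) {..<?n}"
      proof (rule inj_onI, rule ccontr)
        fix i j assume ij: "i \<in> {..<?n}" "j \<in> {..<?n}" "\<mu> i + t * of_nat i = \<mu> j + t * of_nat j" "i \<noteq> j"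
        have "t * (of_nat i - of_nat j) = \<mu> j - \<mu> i" using ij(3) by (simp add: algebra_simps)
        then have "t = (\<mu> j - \<mu> i) / (of_nat i - of_nat j)" using ij(4) by (simp add: field_simps)
        then show False using t ij unfolding F_def by blast
      qed
      fix i assume i: "i < ?n"
      show "nullity (affine_path A D t - mat (\<mu> i + t * of_nat i)) > 0"
      proof (rule singular_from_flag[of i v])
        show "v j \<notin> vec.span (v ` {..<j})" if "j \<le> i" for j using v(1) that i by simp
        fix j assume j: "j \<le> i"
        let ?c = "\<mu> j + t * of_nat j - (\<mu> i + t * of_nat i)"
        have eq: "(affine_path A D t - mat (\<mu> i + t * of_nat i)) *v v j = (A *v v j - \<mu> j *s v j) + ?c *s v j"
          using Dv[of j] i j
          by (simp add: matrix_vector_mult_diff_rdistrib path mat_mult_vec vector_smult_assoc vec_eq_iff algebra_simps)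
        have "A *v v j - \<mu> j *s v j \<in> vec.span (v ` {..<i})"
        proof -
          have "vec.span (v ` {..<j}) \<subseteq> vec.span (v ` {..<i})" using j by (intro vec.span_mono image_mono) auto
          then show ?thesis using v(2)[of j] i j by auto
        qed
        moreover have "?c *s v j \<in> vec.span (v ` {..<i})"
        proof (cases "j = i")
          case True
          then show ?thesis by (simp add: vec.span_zero)
        next
          case False
          then show ?thesis using j by (intro vec.span_scale vec.span_base) auto
        qed
        ultimately show "(affine_path A D t - mat (\<mu> i + t * of_nat i)) *v v j \<in> vec.span (v ` {..<i})"
          unfolding eq by (rule vec.span_add)
      qed
    qed
  qed
qed

section \<open>Pencils singular at distinct points\<close>

definition split_pencil :: "nat \<Rightarrow> complex^'n^'n^2 \<Rightarrow> bool"
  where "split_pencil m B \<longleftrightarrow> (\<exists>p. (\<forall>i<m. p i \<noteq> 0 \<and> nullity (pencil B (p i)) > 0) \<and>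
    (\<forall>i<m. \<forall>j<m. i \<noteq> j \<longrightarrow> det2 (p i) (p j) \<noteq> 0))"

lemma cofinite_path_closure:
  assumes lim: "(f \<longlongrightarrow> x) (at (0::complex))" and fin: "finite F" "\<And>t. t \<notin> F \<Longrightarrow> f t \<in> S"
  shows "(x :: 'a::metric_space) \<in> closure S"
proof -
  have "open (- (F - {0}))" using fin(1) by (intro open_Compl finite_imp_closed) auto
  then have "\<forall>\<^sub>F t in nhds 0. t \<in> - (F - {0})" by (intro eventually_nhds_in_open) auto
  then have "\<forall>\<^sub>F t in at 0. t \<in> - (F - {0})"
    unfolding eventually_at_filter by (rule eventually_mono) auto
  then have "\<forall>\<^sub>F t in at 0. f t \<in> closure S"
    using eventually_neq_at_within[of 0 0 UNIV]
  proof eventually_elim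
    case (elim t)
    then show ?case using fin(2)[of t] closure_subset by auto
  qed
  then show ?thesis by (rule Lim_in_closed_set[OF closed_closure _ at_neq_bot lim])
qed

text \<open>If \<open>B $ 2\<close> is invertible, write \<open>B $ 1 = A ** B $ 2\<close> and
  perturb \<open>A\<close>: an eigenvalue \<open>\<nu>\<close> yields the singular point
  \<open>(1, - \<nu>)\<close>. Invertibility of \<open>B $ 2\<close> holds off finitely many points
  on the line towards the identity.\<close>

lemma split_pencils_dense: "B \<in> closure {B. split_pencil CARD('n) B}"
  for B :: "complex^'n^'n^2"
proof -
  let ?S = "{B :: complex^'n^'n^2. split_pencil CARD('n) B}"
  have 1: "B \<in> closure ?S" if B: "det (B $ 2) \<noteq> 0" for B :: "complex^'n^'n^2"
  proof -
    have "invertible (B $ 2)" using B invertible_det_nz by blast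
    then obtain M where M: "B $ 2 ** M = mat 1" "M ** B $ 2 = mat 1"
      unfolding invertible_def by blast
    define A where "A = B $ 1 ** M"
    have AB: "A ** B $ 2 = B $ 1" by (simp add: A_def matrix_mul_assoc[symmetric] M)
    obtain D :: "complex^'n^'n" and F :: "complex set" where F: "finite F"
      "\<And>t. t \<notin> F \<Longrightarrow> \<exists>\<nu>. inj_on \<nu> {..<CARD('n)} \<and>
        (\<forall>i<CARD('n). nullity (affine_path A D t - mat (\<nu> i)) > 0)"
      by (rule distinct_eigenvalue_direction[of A]) (rule that; assumption)
    define f where "f t = (\<chi> k. if k = 1 then affine_path A D t ** B $ 2 else B $ k)" for t
    have "((\<lambda>t. affine_path A D t ** B $ 2) \<longlongrightarrow> A ** B $ 2) (at 0)"
      unfolding matrix_matrix_mult_def by (intro tendsto_intros tendsto_affine_path)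
    then have "(f \<longlongrightarrow> (\<chi> k. if k = 1 then A ** B $ 2 else B $ k)) (at 0)"
      unfolding f_def by (intro tendsto_vec_lambda) auto
    moreover have "(\<chi> k. if k = 1 then A ** B $ 2 else B $ k) = B"
      by (simp add: AB vec_eq_iff)
    ultimately have lim: "(f \<longlongrightarrow> B) (at 0)" by simp
    show ?thesis
    proof (rule cofinite_path_closure[OF lim F(1)])
      fix t assume "t \<notin> F"
      then obtain \<nu> where \<nu>: "inj_on \<nu> {..<CARD('n)}"
        "\<And>i. i < CARD('n) \<Longrightarrow> nullity (affine_path A D t - mat (\<nu> i)) > 0"
        using F(2) by blast
      define p :: "nat \<Rightarrow> complex^2" where "p i = (\<chi> k. if k = 1 then 1 else - \<nu> i)" for i
      have "nullity (pencil (f t) (p i)) > 0" if i: "i < CARD('n)" for i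
      proof -
        obtain x where x: "(affine_path A D t - mat (\<nu> i)) *v x = 0" "x \<noteq> 0"
          using \<nu>(2)[OF i] nullity_pos by blast
        have BM: "B $ 2 *v (M *v x) = x" by (simp add: matrix_vector_mul_assoc M)
        have "pencil (f t) (p i) *v (M *v x) = affine_path A D t *v x - \<nu> i *s x"
          unfolding pencil_mult
          by (simp add: p_def f_def matrix_vector_mul_assoc[symmetric] BM vector_smult_lneg)
        also have "\<dots> = 0" using x(1) by (simp add: matrix_vector_mult_diff_rdistrib mat_mult_vec)
        finally have "pencil (f t) (p i) *v (M *v x) = 0" .
        moreover have "M *v x \<noteq> 0" using BM x(2) by auto
        ultimately show ?thesis using nullity_pos by blast
      qed
      moreover have "p i \<noteq> 0" for i by (simp add: p_def vec_eq_iff forall_2)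
      moreover have "det2 (p i) (p j) \<noteq> 0" if "i < CARD('n)" "j < CARD('n)" "i \<noteq> j" for i j
        using inj_onD[OF \<nu>(1), of i j] that by (auto simp: det2_def p_def)
      ultimately show "f t \<in> ?S" unfolding split_pencil_def by blast
    qed
  qed
  define f where "f t = (\<chi> k. if k = 2 then affine_path (B $ 2) (mat 1 - B $ 2) t else B $ k)" for t
  have "affine_path (B $ 2) (mat 1 - B $ 2) 1 = mat 1" by (simp add: affine_path_def vec_eq_iff)
  moreover have "nullity (mat 1 :: complex^'n^'n) = 0" using det_nz_iff_nullity[of "mat 1 :: complex^'n^'n"] by simp
  ultimately have "finite {t. nullity (affine_path (B $ 2) (mat 1 - B $ 2) t) > 0}"
    using finite_nullity_gt[of "B $ 2" "mat 1 - B $ 2" 1 0] by simp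
  moreover have "f t \<in> {B. det (B $ 2) \<noteq> 0}"
    if "t \<notin> {t. nullity (affine_path (B $ 2) (mat 1 - B $ 2) t) > 0}" for t
    using that by (simp add: f_def det_nz_iff_nullity)
  moreover have "(f \<longlongrightarrow> B) (at 0)"
  proof -
    have "(f \<longlongrightarrow> (\<chi> k. if k = 2 then B $ 2 else B $ k)) (at 0)"
      unfolding f_def using tendsto_affine_path by (intro tendsto_vec_lambda) auto
    moreover have "(\<chi> k. if k = 2 then B $ 2 else B $ k) = B" by (simp add: vec_eq_iff)
    ultimately show ?thesis by simp
  qed
  ultimately have "B \<in> closure {B. det (B $ 2) \<noteq> 0}" using cofinite_path_closure by blast
  moreover have "closure {B :: complex^'n^'n^2. det (B $ 2) \<noteq> 0} \<subseteq> closure ?S"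
    using 1 by (intro closure_minimal) auto
  ultimately show ?thesis by blast
qed

text \<open>A left kernel vector \<open>f\<close> of the bond matrix \<open>A\<close> confines the
  image of \<open>A \<otimes> 1\<close> to the tensors that \<open>f\<close> annihilates in the
  first factor, a space of dimension \<open>CARD('e12) * (CARD('e01) - 1)\<close>.\<close>

lemma rank_network_le:
  fixes X0 :: "complex^('e01::finite \<times> 'e02::finite)^2" and X1 :: "complex^('e01 \<times> 'e12::finite)^'n1::finite"
    and X2 :: "complex^('e12 \<times> 'e02)^'n2::finite" and f :: "complex^'e01"
  assumes f: "f \<noteq> 0" and 0: "\<And>c. (\<Sum>a\<in>UNIV. f $ a * (s $ 1 * X0 $ 1 $ (a, c) + s $ 2 * X0 $ 2 $ (a, c))) = 0"
  shows "rank (to_matrix (flattening (network X0 X1 X2) s)) \<le> CARD('e12) * (CARD('e01) - 1)"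
proof -
  let ?M = "to_matrix (flattening (network X0 X1 X2) s)"
  obtain a0 where a0: "f $ a0 \<noteq> 0" using f by (auto simp: vec_eq_iff)
  define A where "A a c = s $ 1 * X0 $ 1 $ (a, c) + s $ 2 * X0 $ 2 $ (a, c)" for a c
  define col where "col a b = (\<chi> i. X1 $ i $ (a, b))" for a b
  \<comment> \<open>The images under \<open>X1\<close> of the spanning vectors
    \<open>(e_a - (f_a / f_a0) e_a0) \<otimes> e_b\<close> of that space; those with
    \<open>a = a0\<close> vanish.\<close>
  define g where "g x = col (fst x) (snd x) - (f $ fst x / f $ a0) *s col a0 (snd x)" for x
  let ?G = "g ` ((UNIV - {a0}) \<times> UNIV)"
  have "?M *v u \<in> vec.span ?G" for u
  proof -
    define z where "z a b = (\<Sum>c\<in>UNIV. A a c * (\<Sum>j\<in>UNIV. X2 $ j $ (b, c) * u $ j))" for a b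
    have Mij: "?M $ i $ j = (\<Sum>a\<in>UNIV. \<Sum>b\<in>UNIV. \<Sum>c\<in>UNIV. A a c * X1 $ i $ (a, b) * X2 $ j $ (b, c))" for i j
      by (simp add: to_matrix_def flattening_nth network_def A_def sum_distrib_left
          sum.distrib[symmetric] algebra_simps)
    have "(?M *v u) $ i = (\<Sum>a\<in>UNIV. \<Sum>b\<in>UNIV. z a b * col a b $ i)" for i
    proof -
      have "(?M *v u) $ i = (\<Sum>j\<in>UNIV. \<Sum>a\<in>UNIV. \<Sum>b\<in>UNIV. \<Sum>c\<in>UNIV.
          A a c * X1 $ i $ (a, b) * X2 $ j $ (b, c) * u $ j)"
        by (simp add: matrix_vector_mult_def Mij sum_distrib_right)
      also have "\<dots> = (\<Sum>a\<in>UNIV. \<Sum>j\<in>UNIV. \<Sum>b\<in>UNIV. \<Sum>c\<in>UNIV.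
          A a c * X1 $ i $ (a, b) * X2 $ j $ (b, c) * u $ j)"
        by (rule sum.swap)
      also have "\<dots> = (\<Sum>a\<in>UNIV. \<Sum>b\<in>UNIV. \<Sum>j\<in>UNIV. \<Sum>c\<in>UNIV.
          A a c * X1 $ i $ (a, b) * X2 $ j $ (b, c) * u $ j)"
        by (intro sum.cong refl sum.swap)
      also have "\<dots> = (\<Sum>a\<in>UNIV. \<Sum>b\<in>UNIV. \<Sum>c\<in>UNIV. \<Sum>j\<in>UNIV.
          A a c * X1 $ i $ (a, b) * X2 $ j $ (b, c) * u $ j)"
        by (intro sum.cong refl sum.swap)
      finally show ?thesis
        by (simp add: z_def col_def sum_distrib_left sum_distrib_right mult_ac)
    qed
    then have "?M *v u = (\<Sum>a\<in>UNIV. \<Sum>b\<in>UNIV. z a b *s col a b)" by (simp add: vec_eq_iff)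
    also have "\<dots> = (\<Sum>b\<in>UNIV. \<Sum>a\<in>UNIV. z a b *s col a b)" by (rule sum.swap)
    also have "\<dots> = (\<Sum>b\<in>UNIV. \<Sum>a\<in>UNIV. z a b *s g (a, b))"
    proof (rule sum.cong[OF refl])
      fix b
      have "(\<Sum>a\<in>UNIV. f $ a * z a b) = (\<Sum>a\<in>UNIV. \<Sum>c\<in>UNIV. f $ a * A a c * (\<Sum>j\<in>UNIV. X2 $ j $ (b, c) * u $ j))"
        by (simp add: z_def sum_distrib_left mult.assoc)
      also have "\<dots> = (\<Sum>c\<in>UNIV. (\<Sum>a\<in>UNIV. f $ a * A a c) * (\<Sum>j\<in>UNIV. X2 $ j $ (b, c) * u $ j))"
        unfolding sum_distrib_right[of _ UNIV "\<Sum>j\<in>UNIV. X2 $ j $ (b, _) * u $ j"] by (subst sum.swap) (simp add: sum_distrib_right)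
      also have "\<dots> = 0" using 0 by (simp add: A_def)
      finally have z0: "(\<Sum>a\<in>UNIV. f $ a * z a b) = 0" .
      have "(\<Sum>a\<in>UNIV. z a b *s g (a, b)) =
          (\<Sum>a\<in>UNIV. z a b *s col a b) - (\<Sum>a\<in>UNIV. (f $ a * z a b / f $ a0) *s col a0 b)"
        by (simp add: g_def vector_ssub_ldistrib vector_smult_assoc sum_subtractf mult.commute)
      also have "(\<Sum>a\<in>UNIV. (f $ a * z a b / f $ a0) *s col a0 b) = ((\<Sum>a\<in>UNIV. f $ a * z a b) / f $ a0) *s col a0 b"
        by (simp add: vec.scale_sum_left[symmetric] sum_divide_distrib)
      finally show "(\<Sum>a\<in>UNIV. z a b *s col a b) = (\<Sum>a\<in>UNIV. z a b *s g (a, b))" using z0 by simp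
    qed
    also have "\<dots> \<in> vec.span ?G"
    proof (intro vec.span_sum vec.span_scale)
      fix a b
      show "g (a, b) \<in> vec.span ?G"
      proof (cases "a = a0")
        case True
        then have "g (a, b) = 0" using a0 by (simp add: g_def)
        then show ?thesis by (simp add: vec.span_zero)
      next
        case False
        then show ?thesis by (intro vec.span_base) auto
      qed
    qed
    finally show ?thesis .
  qed
  then have "vec.dim (range ((*v) ?M)) \<le> card ?G"
    by (intro vec.dim_le_card) auto
  also have "\<dots> \<le> card ((UNIV - {a0}) \<times> (UNIV :: 'e12 set))" by (rule card_image_le) simp
  also have "\<dots> = CARD('e12) * (CARD('e01) - 1)" by (simp add: card_cartesian_product card_Diff_singleton)
  finally show ?thesis by (simp add: rank_eq_dim_range)
qed

text \<open>A \<open>2 \<times> 2\<close> minor of the flattening. Where it is nonzero the image is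
  a line, which makes nondegeneracy an open polynomial condition.\<close>

definition minor :: "complex^(2 \<times> 'n1::finite \<times> 'n2::finite) \<Rightarrow> 'n1 \<times> 'n2 \<Rightarrow> 'n1 \<times> 'n2 \<Rightarrow> complex"
  where "minor T x y = T $ (1, x) * T $ (2, y) - T $ (1, y) * T $ (2, x)"

lemma inj_flattening:
  fixes T :: "complex^(2 \<times> 'n1::finite \<times> 'n2::finite)"
  assumes "minor T x y \<noteq> 0"
  shows "inj (flattening T)"
proof -
  have "\<alpha> = 0" if "flattening T \<alpha> = 0" for \<alpha>
  proof -
    have e: "\<alpha> $ 1 * T $ (1, z) + \<alpha> $ 2 * T $ (2, z) = 0" for z
      using that flattening_nth[of T \<alpha> z] by simp
    have "\<alpha> $ 1 * minor T x y = (\<alpha> $ 1 * T $ (1, x) + \<alpha> $ 2 * T $ (2, x)) * T $ (2, y)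
        - (\<alpha> $ 1 * T $ (1, y) + \<alpha> $ 2 * T $ (2, y)) * T $ (2, x)"
      by (simp add: minor_def algebra_simps)
    then have 1: "\<alpha> $ 1 * minor T x y = 0" unfolding e by simp
    have "\<alpha> $ 2 * minor T x y = (\<alpha> $ 1 * T $ (1, y) + \<alpha> $ 2 * T $ (2, y)) * T $ (1, x)
        - (\<alpha> $ 1 * T $ (1, x) + \<alpha> $ 2 * T $ (2, x)) * T $ (1, y)"
      by (simp add: minor_def algebra_simps)
    then have "\<alpha> $ 2 * minor T x y = 0" unfolding e by simp
    then show ?thesis using 1 assms by (simp add: vec_eq_iff forall_2)
  qed
  from this[of "\<alpha> - \<beta>" for \<alpha> \<beta>] show ?thesis
    by (intro injI) (simp add: vec.linear_diff[OF flattening_linear[of T]])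
qed

lemma line_meets_sigmaI:
  fixes T :: "complex^(2 \<times> 'n1::finite \<times> 'n2::finite)"
  assumes inj: "inj (flattening T)"
    and p: "\<And>i. i < m \<Longrightarrow> p i \<noteq> 0" "\<And>i j. i < m \<Longrightarrow> j < m \<Longrightarrow> i \<noteq> j \<Longrightarrow> det2 (p i) (p j) \<noteq> 0"
    and r: "\<And>i. i < m \<Longrightarrow> rank (to_matrix (flattening T (p i))) \<le> r"
  shows "line_meets_sigma r m T"
  unfolding line_meets_sigma_def
proof (intro conjI exI)
  note lin = flattening_linear[of T]
  have "vec.dim (range (flattening T)) = vec.dim (UNIV :: (complex^2) set)"
    using inj by (intro vec.dim_image_eq[OF lin]) (simp add: inj_on_subset)
  also have "\<dots> = CARD(2)" by (rule vec_dim_card)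
  finally show "vec.dim (range (flattening T)) = 2" by simp
  let ?h = "\<lambda>i. vec.span {flattening T (p i)}"
  have nz: "flattening T (p i) \<noteq> 0" if "i < m" for i
    using p(1)[OF that] injD[OF inj, of "p i" 0] vec.linear_0[OF lin] by auto
  show "?h ` {..<m} \<subseteq> projectivization (range (flattening T)) \<inter> sigma_variety r"
    using nz r unfolding projectivization_def sigma_variety_def by blast
  show "finite (?h ` {..<m})" by simp
  have "inj_on ?h {..<m}"
  proof (rule inj_onI, rule ccontr)
    fix i j assume ij: "i \<in> {..<m}" "j \<in> {..<m}" "?h i = ?h j" "i \<noteq> j"
    have "flattening T (p j) \<in> ?h i" unfolding ij(3) by (intro vec.span_base) simp
    then obtain c where "flattening T (p j) = c *s flattening T (p i)"
      by (auto simp: vec.span_singleton)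
    then have "flattening T (p j) = flattening T (c *s p i)"
      by (simp add: vec.linear_scale[OF lin])
    then have "p j = c *s p i" by (rule injD[OF inj])
    then have "det2 (p i) (p j) = 0" by simp
    then show False using p(2)[of i j] ij by simp
  qed
  then show "m \<le> card (?h ` {..<m})" by (simp add: card_image)
qed

text \<open>Only \<open>X0\<close> is perturbed, read through \<open>\<pi>\<close> as a square
  pencil. Split pencils are dense and nondegeneracy is open, so both are achieved arbitrarily
  near.\<close>

lemma nondegenerate_network_in_closure:
  fixes X0 :: "complex^('e01::finite \<times> 'e02::finite)^2" and X1 :: "complex^('e01 \<times> 'e12::finite)^'n1::finite"
    and X2 :: "complex^('e12 \<times> 'e02)^'n2::finite"
  assumes card: "CARD('e02) = CARD('e01)" and nz: "minor (network X0 X1 X2) x y \<noteq> 0"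
  shows "network X0 X1 X2 \<in> closure {T. line_meets_sigma (CARD('e12) * (CARD('e01) - 1)) CARD('e01) T}"
proof -
  let ?S = "{T. line_meets_sigma (CARD('e12) * (CARD('e01) - 1)) CARD('e01) T} ::
    (complex^(2 \<times> 'n1 \<times> 'n2)) set"
  obtain \<pi> :: "'e01 \<Rightarrow> 'e02" where \<pi>: "bij \<pi>"
    using finite_same_card_bij[of "UNIV :: 'e01 set" "UNIV :: 'e02 set"] card by auto
  define X where "X C = (\<chi> k q. C $ k $ fst q $ inv \<pi> (snd q))" for C :: "complex^'e01^'e01^2"
  define B where "B = (\<chi> k a a'. X0 $ k $ (a, \<pi> a'))"
  have "\<pi> (inv \<pi> c) = c" for c by (rule surj_f_inv_f[OF bij_is_surj[OF \<pi>]])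
  then have XB: "X B = X0" by (simp add: X_def B_def vec_eq_iff)
  define \<Psi> where "\<Psi> C = network (X C) X1 X2" for C
  have cont: "continuous_on UNIV \<Psi>"
    unfolding \<Psi>_def network_def X_def by (intro continuous_intros)
  have "continuous_on UNIV (\<lambda>C. minor (\<Psi> C) x y)"
    unfolding minor_def by (intro continuous_intros cont)
  then have op: "open {C. minor (\<Psi> C) x y \<noteq> 0}"
    using open_Collect_neq[of "\<lambda>C. minor (\<Psi> C) x y" "\<lambda>_. 0"] by simp
  let ?R = "{C. minor (\<Psi> C) x y \<noteq> 0} \<inter> {C. split_pencil CARD('e01) C}"
  have "B \<in> {C. minor (\<Psi> C) x y \<noteq> 0}" using nz by (simp add: \<Psi>_def XB)
  then have BR: "B \<in> closure ?R"
    using split_pencils_dense[of B] by (intro subsetD[OF open_Int_closure_subset[OF op]]) (rule IntI)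
  have "\<Psi> ` ?R \<subseteq> ?S"
  proof clarify
    fix C assume C: "minor (\<Psi> C) x y \<noteq> 0" "split_pencil CARD('e01) C"
    obtain p where p: "\<And>i. i < CARD('e01) \<Longrightarrow> p i \<noteq> 0"
      "\<And>i. i < CARD('e01) \<Longrightarrow> nullity (pencil C (p i)) > 0"
      "\<And>i j. i < CARD('e01) \<Longrightarrow> j < CARD('e01) \<Longrightarrow> i \<noteq> j \<Longrightarrow> det2 (p i) (p j) \<noteq> 0"
    proof -
      from C(2) obtain p where "\<forall>i<CARD('e01). p i \<noteq> 0 \<and> nullity (pencil C (p i)) > 0"
        "\<forall>i<CARD('e01). \<forall>j<CARD('e01). i \<noteq> j \<longrightarrow> det2 (p i) (p j) \<noteq> 0"
        unfolding split_pencil_def by (elim exE conjE)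
      then show ?thesis by (intro that[of p]) simp_all
    qed
    have rk: "rank (to_matrix (flattening (\<Psi> C) (p i))) \<le> CARD('e12) * (CARD('e01) - 1)"
      if i: "i < CARD('e01)" for i
    proof -
      have "nullity (transpose (pencil C (p i))) > 0" using p(2)[OF i] by (simp only: nullity_transpose)
      then obtain f where f: "transpose (pencil C (p i)) *v f = 0" "f \<noteq> 0"
        unfolding nullity_pos by (elim exE conjE)
      show ?thesis
        unfolding \<Psi>_def
      proof (rule rank_network_le[OF f(2)])
        fix c
        have "(transpose (pencil C (p i)) *v f) $ inv \<pi> c = 0" using f(1) by simp
        then show "(\<Sum>a\<in>UNIV. f $ a * (p i $ 1 * X C $ 1 $ (a, c) + p i $ 2 * X C $ 2 $ (a, c))) = 0"
          by (simp add: matrix_vector_mult_def transpose_def pencil_def X_def mult.commute)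
      qed
    qed
    show "line_meets_sigma (CARD('e12) * (CARD('e01) - 1)) CARD('e01) (\<Psi> C)"
      by (rule line_meets_sigmaI[where p = p, OF inj_flattening[OF C(1)]], erule p(1),
          erule (2) p(3), erule rk)
  qed
  then have "\<Psi> ` ?R \<subseteq> closure ?S" by (rule subset_trans[OF _ closure_subset])
  then have "\<Psi> ` closure ?R \<subseteq> closure ?S"
    using continuous_on_subset[OF cont subset_UNIV] closed_closure by (intro image_closure_subset)
  from subsetD[OF this imageI[OF BR]] have "\<Psi> B \<in> closure ?S" .
  then show ?thesis by (simp add: \<Psi>_def XB)
qed

lemma network_path_poly:
  obtains P where "\<And>t. network (affine_path X0 D0 t) (affine_path X1 D1 t) (affine_path X2 D2 t) $ x = poly P t"
proof
  fix t
  show "network (affine_path X0 D0 t) (affine_path X1 D1 t) (affine_path X2 D2 t) $ x =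
    poly (\<Sum>a\<in>UNIV. \<Sum>b\<in>UNIV. \<Sum>c\<in>UNIV. [:X0 $ fst x $ (a, c), D0 $ fst x $ (a, c):] *
      [:X1 $ fst (snd x) $ (a, b), D1 $ fst (snd x) $ (a, b):] *
      [:X2 $ snd (snd x) $ (b, c), D2 $ snd (snd x) $ (b, c):]) t"
    by (simp add: network_def affine_path_def poly_sum del: mult_pCons_left mult_pCons_right)
qed

text \<open>Two bond values distinguish the slices of \<open>X0\<close>, and a space
  \<open>V1\<close> or \<open>V2\<close> of dimension at least two keeps them apart.\<close>

lemma nondegenerate_network_exists:
  assumes "CARD('e01::finite) \<ge> 2" "CARD('e02::finite) \<ge> 2"
    and "\<not> (CARD('n1::finite) = 1 \<and> CARD('n2::finite) = 1)"
  obtains X0 :: "complex^('e01::finite \<times> 'e02::finite)^2"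
    and X1 :: "complex^('e01::finite \<times> 'e12::finite)^'n1::finite"
    and X2 :: "complex^('e12::finite \<times> 'e02::finite)^'n2::finite" and x y where "minor (network X0 X1 X2) x y \<noteq> 0"
proof -
  have two: "\<exists>a b :: 'k::finite. a \<noteq> b" if "CARD('k) \<ge> 2"
  proof (rule ccontr)
    assume "\<not> ?thesis"
    then have "CARD('k) \<le> 1" by (subst card_le_Suc0_iff_eq[folded One_nat_def]) auto
    then show False using that by simp
  qed
  obtain a1 a2 :: 'e01 where a: "a1 \<noteq> a2" using two assms(1) by blast
  obtain c1 c2 :: 'e02 where c: "c1 \<noteq> c2" using two assms(2) by blast
  let ?K = "of_nat CARD('e12) * of_nat CARD('e02) :: complex"
  let ?K' = "of_nat CARD('e01) * of_nat CARD('e12) :: complex"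
  have pos: "CARD('n1) > 0" "CARD('n2) > 0" by simp_all
  then consider "CARD('n1) \<ge> 2" | "CARD('n2) \<ge> 2" using assms(3) by linarith
  then show ?thesis
  proof cases
    case 1
    then obtain i1 i2 :: 'n1 where i: "i1 \<noteq> i2" using two by blast
    obtain j :: 'n2 where True by simp
    \<comment> \<open>The slices of \<open>X0\<close> select the bond values \<open>a1\<close> and
      \<open>a2\<close>, which \<open>X1\<close> sends to \<open>i1\<close> and \<open>i2\<close>;
      \<open>?K\<close> counts the free values of the other two bonds. The second case is the mirror
      image, with bond \<open>02\<close> and \<open>X2\<close>.\<close>
    define X0 :: "complex^('e01 \<times> 'e02)^2"
      where "X0 = (\<chi> k q. if fst q = (if k = 1 then a1 else a2) then 1 else 0)"
    define X1 :: "complex^('e01 \<times> 'e12)^'n1"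
      where "X1 = (\<chi> i q. if i = (if fst q = a1 then i1 else i2) then 1 else 0)"
    define X2 :: "complex^('e12 \<times> 'e02)^'n2" where "X2 = (\<chi> j q. 1)"
    have T: "network X0 X1 X2 $ (k, i, j) =
        (if i = (if (if k = 1 then a1 else a2) = a1 then i1 else i2) then ?K else 0)" for k i
    proof -
      have "network X0 X1 X2 $ (k, i, j) = (\<Sum>a\<in>UNIV. if a = (if k = 1 then a1 else a2)
          then (if i = (if a = a1 then i1 else i2) then ?K else 0) else 0)"
        unfolding network_def vec_lambda_beta fst_conv snd_conv
        by (intro sum.cong refl) (simp add: X0_def X1_def X2_def)
      then show ?thesis by (simp only: sum.delta finite UNIV_I if_True)
    qed
    have "minor (network X0 X1 X2) (i1, j) (i2, j) = ?K * ?K"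
      unfolding minor_def T using i a by simp
    then show ?thesis using that[of X0 X1 X2 "(i1, j)" "(i2, j)"] by simp
  next
    case 2
    then obtain j1 j2 :: 'n2 where j: "j1 \<noteq> j2" using two by blast
    obtain i :: 'n1 where True by simp
    define X0 :: "complex^('e01 \<times> 'e02)^2"
      where "X0 = (\<chi> k q. if snd q = (if k = 1 then c1 else c2) then 1 else 0)"
    define X1 :: "complex^('e01 \<times> 'e12)^'n1" where "X1 = (\<chi> i q. 1)"
    define X2 :: "complex^('e12 \<times> 'e02)^'n2"
      where "X2 = (\<chi> j q. if j = (if snd q = c1 then j1 else j2) then 1 else 0)"
    have T: "network X0 X1 X2 $ (k, i, j) =
        (if j = (if (if k = 1 then c1 else c2) = c1 then j1 else j2) then ?K' else 0)" for k j
    proof -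
      have "(\<Sum>c\<in>UNIV. X0 $ k $ (a, c) * X1 $ i $ (a, b) * X2 $ j $ (b, c)) =
          (\<Sum>c\<in>UNIV. if c = (if k = 1 then c1 else c2)
            then (if j = (if c = c1 then j1 else j2) then 1 else 0) else 0)" for a b
        unfolding X0_def X1_def X2_def by (intro sum.cong refl) simp
      then have "(\<Sum>c\<in>UNIV. X0 $ k $ (a, c) * X1 $ i $ (a, b) * X2 $ j $ (b, c)) =
          (if j = (if (if k = 1 then c1 else c2) = c1 then j1 else j2) then 1 else 0)" for a b
        by (simp only: sum.delta finite UNIV_I if_True)
      then show ?thesis by (simp add: network_def)
    qed
    have "minor (network X0 X1 X2) (i, j1) (i, j2) = ?K' * ?K'"
      unfolding minor_def T using j c by simp
    then show ?thesis using that[of X0 X1 X2 "(i, j1)" "(i, j2)"] by simp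
  qed
qed

text \<open>Along the straight path of factors towards a nondegenerate network the minor is a
  polynomial in \<open>t\<close>, nonzero at \<open>t = 1\<close>, so all but finitely many networks
  on the path are nondegenerate.\<close>

theorem network_in_closure:
  fixes X0 :: "complex^('e01::finite \<times> 'e02::finite)^2" and X1 :: "complex^('e01 \<times> 'e12::finite)^'n1::finite"
    and X2 :: "complex^('e12 \<times> 'e02)^'n2::finite"
  assumes card: "CARD('e02) = CARD('e01)" "CARD('e01) \<ge> 2"
    and nontriv: "\<not> (CARD('n1) = 1 \<and> CARD('n2) = 1)"
  shows "network X0 X1 X2 \<in> closure {T. line_meets_sigma (CARD('e12) * (CARD('e01) - 1)) CARD('e01) T}"
proof -
  have card2: "CARD('e02) \<ge> 2" using card by simp
  obtain Y0 :: "complex^('e01 \<times> 'e02)^2" and Y1 :: "complex^('e01 \<times> 'e12)^'n1"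
    and Y2 :: "complex^('e12 \<times> 'e02)^'n2" and x y where Y: "minor (network Y0 Y1 Y2) x y \<noteq> 0"
    by (rule nondegenerate_network_exists[OF card(2) card2 nontriv])
  define T where "T t = network (affine_path X0 (Y0 - X0) t) (affine_path X1 (Y1 - X1) t) (affine_path X2 (Y2 - X2) t)" for t
  have "\<forall>z. \<exists>P. \<forall>t. T t $ z = poly P t"
  proof
    fix z
    show "\<exists>P. \<forall>t. T t $ z = poly P t"
      unfolding T_def by (rule network_path_poly[of X0 "Y0 - X0" X1 "Y1 - X1" X2 "Y2 - X2" z]) blast
  qed
  from choice[OF this] obtain P where P: "\<forall>z t. T t $ z = poly (P z) t" by (elim exE)
  define Q where "Q = P (1, x) * P (2, y) - P (1, y) * P (2, x)"
  have Q: "minor (T t) x y = poly Q t" for t by (simp add: minor_def Q_def P)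
  have "T 1 = network Y0 Y1 Y2" by (simp add: T_def affine_path_def vec_eq_iff)
  then have "Q \<noteq> 0" using Y Q[of 1] by auto
  then have fin: "finite {t. poly Q t = 0}" by (rule poly_roots_finite)
  have path: "((\<lambda>t. affine_path M D t $ i $ j) \<longlongrightarrow> M $ i $ j) (at 0)" for M D :: "complex^'k^'l" and i j
    by (intro tendsto_vec_nth tendsto_affine_path)
  have lim: "(T \<longlongrightarrow> network X0 X1 X2) (at 0)"
    unfolding T_def network_def by (intro tendsto_intros path)
  have "T t \<in> closure {T. line_meets_sigma (CARD('e12) * (CARD('e01) - 1)) CARD('e01) T}"
    if "t \<notin> {t. poly Q t = 0}" for t
  proof -
    have "minor (T t) x y \<noteq> 0" using that by (simp add: Q)
    then show ?thesis unfolding T_def by (rule nondegenerate_network_in_closure[OF card(1)])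
  qed
  from cofinite_path_closure[OF lim fin this] show ?thesis by simp
qed

theorem theorem5p2:
  fixes m m12 k1 k2 :: nat
  assumes "m \<ge> 2"
    and "CARD('e01::finite) = m" "CARD('e12::finite) = m12" "CARD('e02::finite) = m"
    and "CARD('n1::finite) + k1 = m12 * m" "CARD('n2::finite) + k2 = m12 * m"
    and "\<not> (CARD('n1) = 1 \<and> CARD('n2) = 1)"
  shows "(triangle_TNS TYPE('e01) TYPE('e12) TYPE('e02) :: (complex^(2 \<times> 'n1 \<times> 'n2)) set) =
    closure {T. line_meets_sigma (m12 * (m - 1)) m T}"
proof
  show "(triangle_TNS TYPE('e01) TYPE('e12) TYPE('e02) :: (complex^(2 \<times> 'n1 \<times> 'n2)) set)
      \<subseteq> closure {T. line_meets_sigma (m12 * (m - 1)) m T}"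
    unfolding triangle_TNS_network
  proof (rule closure_minimal, clarify)
    fix X0 :: "complex^('e01 \<times> 'e02)^2" and X1 :: "complex^('e01 \<times> 'e12)^'n1"
      and X2 :: "complex^('e12 \<times> 'e02)^'n2"
    show "network X0 X1 X2 \<in> closure {T. line_meets_sigma (m12 * (m - 1)) m T}"
      using network_in_closure[of X0 X1 X2] assms by simp
  qed simp
  show "closure {T. line_meets_sigma (m12 * (m - 1)) m T}
      \<subseteq> (triangle_TNS TYPE('e01) TYPE('e12) TYPE('e02) :: (complex^(2 \<times> 'n1 \<times> 'n2)) set)"
  proof (rule closure_minimal, clarify)
    fix T :: "complex^(2 \<times> 'n1 \<times> 'n2)"
    assume "line_meets_sigma (m12 * (m - 1)) m T"
    then show "T \<in> triangle_TNS TYPE('e01) TYPE('e12) TYPE('e02)"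
      using assms by (intro line_meets_sigma_in_TNS[of m]) auto
  next
    show "closed (triangle_TNS TYPE('e01) TYPE('e12) TYPE('e02) :: (complex^(2 \<times> 'n1 \<times> 'n2)) set)"
      unfolding triangle_TNS_def by simp
  qed
qed

end
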